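(* There is a number $n\in\mathbb N$, $n>2$, and there are $1\le r,s\le n-1$ such that both $\mathcal{TO}_{n,r}=\mathcal{TO}_{n,s}$ and $\mathcal O_{n,r}=\mathcal O_{n,s}$, but $\gcd(n-1,r)\ne\gcd(n-1,s)$.
   Context: Notation. Maps act on the right. $X_n=\{0,\ldots,n-1\}$; $X_n^*$ (resp. $X_n^k$) is the set of finite words (words of length $k$) over $X_n$; $\epsilon$ is the empty word; for $1\le r\le n-1$, $\dot{\mathbf r}=\{\dot 0,\ldots,\dot{(r-1)}\}$ is a further ordered alphabet; $X_{n,r}^+=\{\dot a w:\dot a\in\dot{\mathbf r},\,w\in X_n^*\}$, $X_{n,r}^*=X_{n,r}^+\cup\{\epsilon\}$. $\mathfrak C_n=X_n^\omega$ and $\mathfrak C_{n,r}=\{\dot a x:\dot a\in\dot{\mathbf r},\,x\in\mathfrak C_n\}$ are Cantor spaces. The relation $\simeq$ on $\mathfrak C_{n,r}$: $x\simeq y$ iff $x=y$, or $\{x,y\}=\{w\,i\,000\ldots,\;w\,(i-1)(n-1)(n-1)\ldots\}$ with $w\in X_{n,r}^+$ and $0<i\le n-1$, or $\{x,y\}=\{\dot a\,00\ldots,\;\dot{(a-1)}(n-1)(n-1)\ldots\}$ with $0<a\le r-1$, or $\{x,y\}=\{\dot 0\,00\ldots,\;\dot{(r-1)}(n-1)(n-1)\ldots\}$. Transducers over $X_n$. A transducer $\langle X_n,Q,\pi,\lambda\rangle$ has transition function $\pi:X_n\times Q\to Q$ and output function $\lambda:X_n\times Q\to X_n^*$, extended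 to words by $\pi(wi,q)=\pi(i,\pi(w,q))$, $\lambda(wi,q)=\lambda(w,q)\lambda(i,\pi(w,q))$, such that infinite inputs give infinite outputs; $h_q:\mathfrak C_n\to\mathfrak C_n$ is the continuous map $\delta\mapsto\lambda(\delta,q)$. Fixing an initial state $q_0$ gives an initial transducer, representing $h_{q_0}$; it is minimal if all states are reachable from $q_0$, $h_q\neq h_p$ for distinct states $q,p$, and for every state $q$ and letter $i$, $\lambda(i,q)$ is the greatest common prefix of $\{(i\delta)h_q:\delta\in\mathfrak C_n\}$. A transducer is synchronizing at level $k$ if for each $\Gamma\in X_n^k$ the state $\pi(\Gamma,q)$ does not depend on $q$ (the state forced by $\Gamma$); its core is the sub-transducer on the states forced by words of $X_n^k$. Transducers over $\mathfrak C_{n,r}$. An initial transducer $A_{q_0}$ over $\mathfrak C_{n,r}$ has state set $Q=R\sqcup S$ with $R$ finite, $q_0\in R$, and functions $\pi,\lambda$ defined on $(\dot{\mathbf r}\times\{q_0\})\sqcup(X_n\times(Q\setminus\{q_0\}))$, $\pi$ with values in $Q\setminus\{q_0\}$ and $\lambda$ with values in $X_{n,r}^*\sqcup X_n^*$, such that: a transition from a state of $R$ outputs $\epsilon$ if it ends in $R$ and a word of $X_{n,r}^+$ if it ends in $S$; transitions from $S$ end in $S$ with output in $X_n^*$; infinite words read from states of $S$ give infinite output; no state of $R$ lies on a cycle. It represents the map $h_{q_0}:\mathfrak C_{n,r}\to\mathfrak C_{n,r}$. It is minimal if all its states are reachable from $q_0$, distinct states $q,p$ induce distinct maps $\delta\mapsto\lambda(\delta,q)$,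 $\delta\mapsto\lambda(\delta,p)$ on infinite words, and for every state $q$ and every letter $i$ readable from $q$, $\lambda(i,q)$ is the greatest common prefix of $\{\lambda(i\delta,q):\delta\in\mathfrak C_n\}$; every homeomorphism of $\mathfrak C_{n,r}$ is represented by a unique minimal transducer. It is synchronizing if for some $k$ the state reached by reading a word of length $k$ from any state from which it can be read depends only on the word; its core is then the transducer over $X_n$ formed by the states forced by words of $X_n^k$. Groups. $\mathcal B_{n,r}$ is the group of homeomorphisms $h$ of $\mathfrak C_{n,r}$ such that the minimal transducers of $h$ and $h^{-1}$ are finite and synchronizing; $\mathcal{TB}_{n,r}$ is the subgroup of those $h\in\mathcal B_{n,r}$ preserving $\simeq$. For $h\in\mathcal B_{n,r}$ let $\mathrm{Core}(h)$ be the core of its minimal transducer (a transducer over $X_n$, up to renaming states). $\mathcal O_{n,r}=\{\mathrm{Core}(h):h\in\mathcal B_{n,r}\}$, $\mathcal{TO}_{n,r}=\{\mathrm{Core}(h):h\in\mathcal{TB}_{n,r}\}$, $\mathcal O_n=\bigcup_{1\le r\le n-1}\mathcal O_{n,r}$. The product of $g,h\in\mathcal O_n$ is the core of the minimal transducer representing $h_{q_1}$ followed by $h_{q_2}$, for any states $q_1$ of $g$ and $q_2$ of $h$ (independent of the choice). With this product $\mathcal O_n$ is a group, each $\mathcal O_{n,r}$ and $\mathcal{TO}_{n,r}$ is a subgroup, $\mathcal O_{n,r}\cong\mathrm{Out}(G_{n,r})$ and $\mathcal{TO}_{n,r}\cong\mathrm{Out}(T_{n,r})$ for the Higman–Thompson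 groups $G_{n,r}$ and $T_{n,r}$. Equalities in the claim are equalities of subgroups of $\mathcal O_n$. *)

theory Defs
  imports "HOL-Analysis.Analysis" "HOL-Library.Omega_Words_Fun" "HOL-Library.Sublist"
begin

section \<open>Words and Cantor spaces\<close>

text \<open>
  The letter \<open>i\<close> of \<open>X\<^sub>n\<close> is \<open>Plain i\<close> and the dotted letter \<open>a\<close> is \<open>Dotted a\<close>, so that the two
  alphabets are disjoint and words over either of them have type \<open>letter list\<close>.
\<close>

datatype letter = Dotted nat | Plain nat

definition X :: "nat \<Rightarrow> letter set" where
  "X n = Plain ` {..<n}"

definition dots :: "nat \<Rightarrow> letter set" where
  "dots r = Dotted ` {..<r}"

definition words_plus :: "nat \<Rightarrow> nat \<Rightarrow> letter list set" where
  "words_plus n r = {a # w | a w. a \<in> dots r \<and> w \<in> lists (X n)}"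

definition words_star :: "nat \<Rightarrow> nat \<Rightarrow> letter list set" where
  "words_star n r = words_plus n r \<union> {[]}"

definition cantor :: "nat \<Rightarrow> letter word set" where
  "cantor n = {x. \<forall>k. x k \<in> X n}"

definition cantor_nr :: "nat \<Rightarrow> nat \<Rightarrow> letter word set" where
  "cantor_nr n r = {a ## x | a x. a \<in> dots r \<and> x \<in> cantor n}"

definition cantor_nr_topology :: "nat \<Rightarrow> nat \<Rightarrow> letter word topology" where
  "cantor_nr_topology n r =
     subtopology (product_topology (\<lambda>_. discrete_topology UNIV) UNIV) (cantor_nr n r)"

definition circ_eq :: "nat \<Rightarrow> nat \<Rightarrow> letter word \<Rightarrow> letter word \<Rightarrow> bool" where
  "circ_eq n r x y \<longleftrightarrow>
     x = y
   \<or> (\<exists>w\<in>words_plus n r. \<exists>i. 0 < i \<and> i \<le> n - 1 \<and>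
        {x, y} = {(w @ [Plain i]) \<frown> (\<lambda>_. Plain 0), (w @ [Plain (i - 1)]) \<frown> (\<lambda>_. Plain (n - 1))})
   \<or> (\<exists>a. 0 < a \<and> a \<le> r - 1 \<and>
        {x, y} = {Dotted a ## (\<lambda>_. Plain 0), Dotted (a - 1) ## (\<lambda>_. Plain (n - 1))})
   \<or> {x, y} = {Dotted 0 ## (\<lambda>_. Plain 0), Dotted (r - 1) ## (\<lambda>_. Plain (n - 1))}"

definition greatest_common_prefix :: "letter list \<Rightarrow> letter word set \<Rightarrow> bool" where
  "greatest_common_prefix w L \<longleftrightarrow>
     (\<forall>x\<in>L. \<exists>y. x = w \<frown> y) \<and>
     (\<forall>u. (\<forall>x\<in>L. \<exists>y. x = u \<frown> y) \<longrightarrow> Sublist.prefix u w)"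


section \<open>Transducers\<close>

record 'q transducer =
  states :: "'q set"
  next_state :: "letter \<Rightarrow> 'q \<Rightarrow> 'q"
  outp :: "letter \<Rightarrow> 'q \<Rightarrow> letter list"

record 'q initial_transducer = "'q transducer" +
  init :: 'q

definition read_word :: "('q, 'z) transducer_scheme \<Rightarrow> letter list \<Rightarrow> 'q \<Rightarrow> 'q" where
  "read_word A w q = fold (next_state A) w q"

primrec output_word :: "('q, 'z) transducer_scheme \<Rightarrow> letter list \<Rightarrow> 'q \<Rightarrow> letter list" where
  "output_word A [] q = []"
| "output_word A (i # w) q = outp A i q @ output_word A w (next_state A i q)"

definition infinite_output :: "('q, 'z) transducer_scheme \<Rightarrow> letter word \<Rightarrow> 'q \<Rightarrow> bool" where
  "infinite_output A \<delta> q \<longleftrightarrow>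
     (\<forall>m. \<exists>k. m < length (output_word A (Omega_Words_Fun.prefix k \<delta>) q))"

text \<open>
  The infinite output on the infinite input \<open>\<delta>\<close>: its \<open>m\<close>-th letter is read off the output of any
  finite prefix of \<open>\<delta>\<close> long enough to produce it. Meaningful if \<^const>\<open>infinite_output\<close> holds.
\<close>

definition output_omega :: "('q, 'z) transducer_scheme \<Rightarrow> letter word \<Rightarrow> 'q \<Rightarrow> letter word" where
  "output_omega A \<delta> q = (\<lambda>m.
     output_word A (Omega_Words_Fun.prefix
       (LEAST k. m < length (output_word A (Omega_Words_Fun.prefix k \<delta>) q)) \<delta>) q ! m)"


subsection \<open>Transducers over \<open>X\<^sub>n\<close>\<close>

text \<open>
  The functions \<^const>\<open>next_state\<close> and \<^const>\<open>outp\<close> are total in HOL; only their values at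
  letters of \<open>X\<^sub>n\<close> and states of the transducer matter.
\<close>

definition transducer_over :: "nat \<Rightarrow> ('q, 'z) transducer_scheme \<Rightarrow> bool" where
  "transducer_over n A \<longleftrightarrow>
     (\<forall>q\<in>states A. \<forall>i\<in>X n. next_state A i q \<in> states A \<and> outp A i q \<in> lists (X n)) \<and>
     (\<forall>q\<in>states A. \<forall>\<delta>\<in>cantor n. infinite_output A \<delta> q)"

definition same_up_to_renaming ::
  "nat \<Rightarrow> ('p, 'y) transducer_scheme \<Rightarrow> ('q, 'z) transducer_scheme \<Rightarrow> bool" where
  "same_up_to_renaming n A B \<longleftrightarrow> (\<exists>f. bij_betw f (states A) (states B) \<and>
     (\<forall>q\<in>states A. \<forall>i\<in>X n.
        next_state B i (f q) = f (next_state A i q) \<and> outp B i (f q) = outp A i q))"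


subsection \<open>Initial transducers over the Cantor space with dotted first letters\<close>

definition letters_from :: "nat \<Rightarrow> nat \<Rightarrow> ('q, 'z) initial_transducer_scheme \<Rightarrow> 'q \<Rightarrow> letter set" where
  "letters_from n r A q = (if q = init A then dots r else X n)"

definition words_from ::
  "nat \<Rightarrow> nat \<Rightarrow> ('q, 'z) initial_transducer_scheme \<Rightarrow> 'q \<Rightarrow> letter list set" where
  "words_from n r A q = (if q = init A then words_star n r else lists (X n))"

definition transducer_nr :: "nat \<Rightarrow> nat \<Rightarrow> ('q, 'z) initial_transducer_scheme \<Rightarrow> bool" where
  "transducer_nr n r A \<longleftrightarrow> (\<exists>R S.
     states A = R \<union> S \<and> R \<inter> S = {} \<and> finite R \<and> init A \<in> R \<and>
     (\<forall>q\<in>states A. \<forall>i\<in>letters_from n r A q. next_state A i q \<in> states A - {init A}) \<and>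
     (\<forall>q\<in>R. \<forall>i\<in>letters_from n r A q.
        (next_state A i q \<in> R \<longrightarrow> outp A i q = []) \<and>
        (next_state A i q \<in> S \<longrightarrow> outp A i q \<in> words_plus n r)) \<and>
     (\<forall>q\<in>S. \<forall>i\<in>X n. next_state A i q \<in> S \<and> outp A i q \<in> lists (X n)) \<and>
     (\<forall>q\<in>S. \<forall>\<delta>\<in>cantor n. infinite_output A \<delta> q) \<and>
     (\<forall>q\<in>R. \<forall>w\<in>words_from n r A q. w \<noteq> [] \<longrightarrow> read_word A w q \<noteq> q))"

definition represents ::
  "nat \<Rightarrow> nat \<Rightarrow> ('q, 'z) initial_transducer_scheme \<Rightarrow> (letter word \<Rightarrow> letter word) \<Rightarrow> bool" where
  "represents n r A h \<longleftrightarrow> (\<forall>x\<in>cantor_nr n r. h x = output_omega A x (init A))"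

text \<open>
  In the second condition the initial state need not be compared with the others: the maps induced
  by it and by any other state have disjoint domains.
\<close>

definition minimal_nr :: "nat \<Rightarrow> nat \<Rightarrow> ('q, 'z) initial_transducer_scheme \<Rightarrow> bool" where
  "minimal_nr n r A \<longleftrightarrow> transducer_nr n r A \<and>
     (\<forall>q\<in>states A. \<exists>w\<in>words_star n r. read_word A w (init A) = q) \<and>
     (\<forall>p\<in>states A - {init A}. \<forall>q\<in>states A - {init A}. p \<noteq> q \<longrightarrow>
        (\<exists>\<delta>\<in>cantor n. output_omega A \<delta> p \<noteq> output_omega A \<delta> q)) \<and>
     (\<forall>q\<in>states A. \<forall>i\<in>letters_from n r A q.
        greatest_common_prefix (outp A i q) {output_omega A (i ## \<delta>) q | \<delta>. \<delta> \<in> cantor n})"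

definition synchronizing_at ::
  "nat \<Rightarrow> nat \<Rightarrow> nat \<Rightarrow> ('q, 'z) initial_transducer_scheme \<Rightarrow> bool" where
  "synchronizing_at n r k A \<longleftrightarrow> (\<forall>p\<in>states A. \<forall>q\<in>states A. \<forall>w.
     length w = k \<and> w \<in> words_from n r A p \<and> w \<in> words_from n r A q \<longrightarrow>
     read_word A w p = read_word A w q)"

definition synchronizing :: "nat \<Rightarrow> nat \<Rightarrow> ('q, 'z) initial_transducer_scheme \<Rightarrow> bool" where
  "synchronizing n r A \<longleftrightarrow> (\<exists>k. synchronizing_at n r k A)"

text \<open>
  The set of states forced by the words of \<open>X\<^sub>n\<^sup>k\<close> is the same for every level \<open>k\<close> at which the
  transducer is synchronizing, since the state forced by a word of length \<open>k + 1\<close> is the one forced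
  by its last \<open>k\<close> letters.
\<close>

definition core_states :: "nat \<Rightarrow> nat \<Rightarrow> ('q, 'z) initial_transducer_scheme \<Rightarrow> 'q set" where
  "core_states n r A = {read_word A w q | w q k. synchronizing_at n r k A \<and>
     w \<in> lists (X n) \<and> length w = k \<and> q \<in> states A \<and> w \<in> words_from n r A q}"

definition core :: "nat \<Rightarrow> nat \<Rightarrow> ('q, 'z) initial_transducer_scheme \<Rightarrow> 'q transducer" where
  "core n r A = \<lparr>states = core_states n r A, next_state = next_state A, outp = outp A\<rparr>"


section \<open>The groups\<close>

text \<open>
  States are taken to be natural numbers: all states of a minimal transducer are reachable, so it
  has at most countably many of them. As a minimal transducer of a homeomorphism exists and is
  unique up to renaming states, it may be introduced by an existential quantifier.
\<close>

definition finite_synchronizing_map ::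
  "nat \<Rightarrow> nat \<Rightarrow> (letter word \<Rightarrow> letter word) \<Rightarrow> bool" where
  "finite_synchronizing_map n r h \<longleftrightarrow> (\<exists>A :: nat initial_transducer.
     minimal_nr n r A \<and> represents n r A h \<and> finite (states A) \<and> synchronizing n r A)"

text \<open>
  Self-maps of the Cantor space are HOL functions that are \<^const>\<open>undefined\<close> outside it.
\<close>

definition B :: "nat \<Rightarrow> nat \<Rightarrow> (letter word \<Rightarrow> letter word) set" where
  "B n r = {h \<in> extensional (cantor_nr n r).
     homeomorphic_map (cantor_nr_topology n r) (cantor_nr_topology n r) h \<and>
     finite_synchronizing_map n r h \<and>
     finite_synchronizing_map n r (inv_into (cantor_nr n r) h)}"

definition TB :: "nat \<Rightarrow> nat \<Rightarrow> (letter word \<Rightarrow> letter word) set" where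
  "TB n r = {h \<in> B n r. \<forall>x\<in>cantor_nr n r. \<forall>y\<in>cantor_nr n r.
     circ_eq n r x y \<longleftrightarrow> circ_eq n r (h x) (h y)}"

text \<open>
  A transducer over \<open>X\<^sub>n\<close> up to renaming states is a class of transducers with states in
  \<^typ>\<open>nat\<close>. Subgroups of the group of all cores are given by their carrier sets, as in
  \<open>HOL-Algebra\<close>.
\<close>

definition Core :: "nat \<Rightarrow> nat \<Rightarrow> (letter word \<Rightarrow> letter word) \<Rightarrow> nat transducer set" where
  "Core n r h = {T. transducer_over n T \<and> (\<exists>A :: nat initial_transducer.
     minimal_nr n r A \<and> represents n r A h \<and> same_up_to_renaming n (core n r A) T)}"

definition Onr :: "nat \<Rightarrow> nat \<Rightarrow> nat transducer set set" where
  "Onr n r = Core n r ` B n r"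

definition TOnr :: "nat \<Rightarrow> nat \<Rightarrow> nat transducer set set" where
  "TOnr n r = Core n r ` TB n r"

end

theory Submission
  imports Defs "HOL-Number_Theory.Cong"
begin

text \<open>
  The states of a minimal transducer of \<open>h\<close> other than the initial one are the local maps of \<open>h\<close>:
  the maps \<open>d \<mapsto> h(u d)\<close> with the greatest common prefix of their values removed. It is
  synchronizing iff the local map at \<open>u\<close> depends only on a suffix of \<open>u\<close> of bounded length, and
  the core is then given by the local maps at long words.

  The number of cones of a clopen set is well defined modulo \<open>n - 1\<close>. Synchronization forces the
  number of cones of \<open>h(u C)\<close> to be a constant \<open>c\<close> modulo \<open>n - 1\<close>, and comparison with the inverse
  of \<open>h\<close> shows that \<open>c\<close> is a unit. For \<open>n = 3\<close> it is \<open>1\<close>, so that \<open>h(u C)\<close> can be identified with the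
  whole of \<open>C\<close> by replacing prefixes. Acting in this way on each of \<open>s\<close> copies of \<open>C\<close> gives an
  element of \<open>B\<close> for \<open>s\<close> with the same core. If \<open>h\<close> preserves \<open>\<simeq>\<close>, then \<open>h(u C)\<close> has exactly
  two boundary points and hence is an interval on the circle; the prefix replacement can be chosen
  to preserve the order, with the order of the copies reversed if \<open>h\<close> reverses orientation. Hence
  \<open>r = 1\<close> and \<open>s = 2\<close> give the same groups.
\<close>

text \<open>Splitting a cone replaces it by \<open>n\<close> cones, which adds \<open>n - 1\<close>.
  This is why counts make sense modulo \<open>n - 1\<close>, and why a complete prefix code obtained
  by splitting has \<open>t * (n - 1) + 1\<close> words, the only sizes that can be matched cone by
  cone with \<open>h(u C)\<close>. Modulus \<open>2\<close> leaves no room for a second unit, yet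
  \<open>gcd 2 1\<close> and \<open>gcd 2 2\<close> differ. The core survives the replacement
  because a local map forgets the common prefix of its values, and on a long input word that prefix
  is all that changes. The groups are defined by transducers, so membership has to be translated
  into statements on local maps and back, for the inverse as well. As for \<simeq>, adjacency inside
  one copy is inherited from \<open>h\<close>. The only new adjacencies are those between ends of
  copies, and there a reversal of orientation forces the copies to be listed backwards. That
  \<simeq> is also reflected follows because exactly the points with constant tail \<open>0\<close>
  or \<open>n - 1\<close> have a partner, and each has only one.\<close>

hide_const (open) Sublist.prefix Sublist.suffix

declare build_cons [simp del] build_append [simp del]

section \<open>Words, cones and prefixes of sequences\<close>

lemma build_conc: "a ## x = [a] \<frown> x"
  by (simp add: build_cons)

lemma conc_in_cantor [simp]: "w \<frown> x \<in> cantor n \<longleftrightarrow> w \<in> lists (X n) \<and> x \<in> cantor n"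
proof
  assume *: "w \<frown> x \<in> cantor n"
  have "w ! k \<in> X n" if "k < length w" for k
    using * that unfolding cantor_def by (metis (mono_tags) conc_fst mem_Collect_eq)
  moreover have "x k \<in> X n" for k
    using * unfolding cantor_def by (smt (verit) conc_snd add_diff_cancel_left' mem_Collect_eq not_add_less1)
  ultimately show "w \<in> lists (X n) \<and> x \<in> cantor n"
    by (auto simp: cantor_def in_set_conv_nth)
next
  assume "w \<in> lists (X n) \<and> x \<in> cantor n"
  then show "w \<frown> x \<in> cantor n"
    by (auto simp: cantor_def conc_def)
qed

lemma prefix_in_lists: "x \<in> cantor n \<Longrightarrow> prefix k x \<in> lists (X n)"
  by (auto simp: cantor_def)

lemma suffix_in_cantor: "x \<in> cantor n \<Longrightarrow> suffix k x \<in> cantor n"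
  by (auto simp: cantor_def)

lemma const_in_cantor [simp]: "(\<lambda>_. Plain i) \<in> cantor n \<longleftrightarrow> i < n"
  by (auto simp: cantor_def X_def)

lemma Plain_in_X [simp]: "Plain i \<in> X n \<longleftrightarrow> i < n"
  by (auto simp: X_def)

lemma Dotted_in_dots [simp]: "Dotted a \<in> dots r \<longleftrightarrow> a < r"
  by (auto simp: dots_def)

lemma Dotted_notin_X [simp]: "Dotted a \<notin> X n"
  by (auto simp: X_def)

lemma finite_X [simp]: "finite (X n)"
  by (simp add: X_def)

lemma card_X [simp]: "card (X n) = n"
  by (simp add: X_def card_image inj_on_def)

lemma Cons_in_words_plus [simp]: "a # w \<in> words_plus n r \<longleftrightarrow> a \<in> dots r \<and> w \<in> lists (X n)"
  by (auto simp: words_plus_def)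

lemma Nil_notin_words_plus [simp]: "[] \<notin> words_plus n r"
  by (auto simp: words_plus_def)

lemma append_in_words_plus:
  "u \<noteq> [] \<Longrightarrow> u @ w \<in> words_plus n r \<longleftrightarrow> u \<in> words_plus n r \<and> w \<in> lists (X n)"
  by (cases u) auto

lemma words_plus_append [intro]:
  "u \<in> words_plus n r \<Longrightarrow> w \<in> lists (X n) \<Longrightarrow> u @ w \<in> words_plus n r"
  by (cases u) auto

lemma words_plus_cases:
  assumes "u \<in> words_plus n r"
  obtains a w where "u = Dotted a # w" "a < r" "w \<in> lists (X n)"
  using assms by (auto simp: words_plus_def dots_def)

lemma words_plus_nonempty: "u \<in> words_plus n r \<Longrightarrow> u \<noteq> []"
  by auto

lemma lists_words_plus_disjoint: "u \<in> words_plus n r \<Longrightarrow> u \<notin> lists (X n)"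
  by (auto simp: words_plus_def dots_def)

lemma conc_in_cantor_nr:
  assumes "u \<noteq> []"
  shows "u \<frown> x \<in> cantor_nr n r \<longleftrightarrow> u \<in> words_plus n r \<and> x \<in> cantor n"
proof -
  obtain a w where u: "u = a # w" using assms by (cases u) auto
  show ?thesis unfolding u cantor_nr_def
    by (auto simp: build_cons)
qed

lemma conc_in_cantor_nrI [intro]:
  "u \<in> words_plus n r \<Longrightarrow> x \<in> cantor n \<Longrightarrow> u \<frown> x \<in> cantor_nr n r"
  by (simp add: conc_in_cantor_nr words_plus_nonempty)

lemma prefix_in_words_plus:
  assumes "x \<in> cantor_nr n r" "k > 0"
  shows "prefix k x \<in> words_plus n r" "suffix k x \<in> cantor n"
proof -
  have "prefix k x \<noteq> []" using assms(2) by simp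
  then have "prefix k x \<in> words_plus n r \<and> suffix k x \<in> cantor n"
    using assms(1) conc_in_cantor_nr by (metis prefix_suffix)
  then show "prefix k x \<in> words_plus n r" "suffix k x \<in> cantor n" by auto
qed

lemma cantor_nr_cases:
  assumes "x \<in> cantor_nr n r"
  obtains a d where "x = [Dotted a] \<frown> d" "a < r" "d \<in> cantor n"
  using assms by (auto simp: cantor_nr_def dots_def build_conc)

lemma conc_eq_iff_prefix: "(\<exists>y. x = w \<frown> y) \<longleftrightarrow> prefix (length w) x = w"
  by (metis prefix_conc_length prefix_suffix)

lemma prefix_eq_mono:
  assumes "prefix k x = prefix k y" "j \<le> k"
  shows "prefix j x = prefix j y"
proof -
  have "prefix j z = take j (prefix k z)" for z :: "'a word" using assms(2) by simp
  then show ?thesis using assms(1) by metis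
qed

lemma word_eq_prefix: "(\<And>k. prefix k x = prefix k y) \<Longrightarrow> x = y"
proof
  fix i assume *: "\<And>k. prefix k x = prefix k y"
  have "prefix (Suc i) x ! i = prefix (Suc i) y ! i" using * by simp
  then show "x i = y i" by (metis subsequence_nth add_0 diff_zero lessI)
qed

text \<open>The word may be dotted, plain or empty. With the empty word the cone is
  \<open>cantor n\<close>, so the same notion serves local maps, whose arguments carry no dotted
  letter.\<close>

definition cyl :: "nat \<Rightarrow> letter list \<Rightarrow> letter word set" where
  "cyl n u = (\<lambda>d. u \<frown> d) ` cantor n"

lemma cyl_Nil [simp]: "cyl n [] = cantor n"
  by (simp add: cyl_def)

lemma conc_in_cyl [simp]: "u \<frown> d \<in> cyl n u \<longleftrightarrow> d \<in> cantor n"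
  by (auto simp: cyl_def)

lemma mem_cyl: "x \<in> cyl n u \<longleftrightarrow> prefix (length u) x = u \<and> suffix (length u) x \<in> cantor n"
proof
  assume "prefix (length u) x = u \<and> suffix (length u) x \<in> cantor n"
  then show "x \<in> cyl n u" by (metis conc_in_cyl prefix_suffix)
qed (auto simp: cyl_def)

lemma cyl_subset: "u \<in> words_plus n r \<Longrightarrow> cyl n u \<subseteq> cantor_nr n r"
  by (auto simp: cyl_def)

lemma mem_cyl_nr:
  assumes "x \<in> cantor_nr n r" "u \<noteq> []"
  shows "x \<in> cyl n u \<longleftrightarrow> prefix (length u) x = u"
  using assms by (simp add: mem_cyl prefix_in_words_plus)

lemma cyl_append_subset: "w \<in> lists (X n) \<Longrightarrow> cyl n (u @ w) \<subseteq> cyl n u"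
  by (auto simp: cyl_def simp flip: conc_conc)

lemma cyl_nonempty: "n > 0 \<Longrightarrow> cyl n u \<noteq> {}"
  using const_in_cantor[of 0 n] by (auto simp: cyl_def simp del: const_in_cantor)

lemma cyl_append_image: "cyl n (u @ w) = (\<lambda>x. u \<frown> x) ` cyl n w"
  by (simp add: cyl_def image_image)

lemma cantor_two:
  assumes "n \<ge> 2"
  obtains x y where "x \<in> cantor n" "y \<in> cantor n" "x \<noteq> y"
proof
  show "(\<lambda>_. Plain 0) \<in> cantor n" "(\<lambda>_. Plain 1) \<in> cantor n" using assms by auto
qed (simp add: fun_eq_iff)


section \<open>Greatest common prefixes and local maps\<close>

lemma gcp_unique:
  assumes "greatest_common_prefix v L" "greatest_common_prefix w L"
  shows "v = w"
  using assms unfolding greatest_common_prefix_def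
  by (meson Sublist.prefix_order.antisym)

definition lcp :: "letter word set \<Rightarrow> letter list" where
  "lcp L = (THE w. greatest_common_prefix w L)"

lemma lcp_eq: "greatest_common_prefix w L \<Longrightarrow> lcp L = w"
  unfolding lcp_def using gcp_unique by blast

text \<open>Two distinct points of \<open>L\<close> bound the length on which all points agree; the
  longest common length \<open>k\<close> gives the word.\<close>

lemma gcp_exists:
  assumes "x \<in> L" "y \<in> L" "x \<noteq> y"
  shows "\<exists>w. greatest_common_prefix w L"
proof -
  define P where "P m \<longleftrightarrow> (\<forall>x\<in>L. \<forall>y\<in>L. prefix m x = prefix m y)" for m
  obtain m0 where m0: "\<not> P m0"
    using assms word_eq_prefix unfolding P_def by blast
  define m where "m = (LEAST m. \<not> P m)"
  have m: "\<not> P m" "\<And>j. j < m \<Longrightarrow> P j"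
    unfolding m_def using LeastI[of "\<lambda>m. \<not> P m", OF m0] not_less_Least by blast+
  have "P 0" by (simp add: P_def)
  then obtain k where k: "m = Suc k" using m(1) by (cases m) auto
  have up: "j \<le> k" if "P j" for j
    using that m(1) prefix_eq_mono unfolding P_def k by (metis not_less_eq_eq)
  have Pk: "P k" using m(2) k by simp
  define w where "w = prefix k x"
  have lw: "length w = k" by (simp add: w_def)
  have "greatest_common_prefix w L"
    unfolding greatest_common_prefix_def
  proof (intro conjI allI impI ballI)
    fix z assume "z \<in> L"
    then have "prefix k z = prefix k x" using Pk assms(1) unfolding P_def by blast
    then have "prefix (length w) z = w" unfolding lw by (simp add: w_def)
    then show "\<exists>y. z = w \<frown> y" using conc_eq_iff_prefix by blast
  next
    fix u assume u: "\<forall>x\<in>L. \<exists>y. x = u \<frown> y"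
    then have u': "\<forall>z\<in>L. prefix (length u) z = u" using conc_eq_iff_prefix by blast
    then have "P (length u)" unfolding P_def by simp
    then have "length u \<le> k" using up by blast
    moreover have "u = prefix (length u) x" using u' assms(1) by auto
    ultimately have "u = take (length u) w"
      unfolding w_def by simp
    then show "Sublist.prefix u w" by (metis take_is_prefix)
  qed
  then show ?thesis by blast
qed

lemma gcp_conc:
  assumes "greatest_common_prefix w L" "L \<noteq> {}"
  shows "greatest_common_prefix (v @ w) ((\<lambda>x. v \<frown> x) ` L)"
  unfolding greatest_common_prefix_def
proof (intro conjI allI impI ballI)
  fix z assume "z \<in> (\<lambda>x. v \<frown> x) ` L"
  then show "\<exists>y. z = (v @ w) \<frown> y"
    using assms(1) unfolding greatest_common_prefix_def by (metis (no_types, lifting) conc_conc imageE)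
next
  fix u assume u: "\<forall>x\<in>(\<lambda>x. v \<frown> x) ` L. \<exists>y. x = u \<frown> y"
  then have u': "prefix (length u) (v \<frown> x) = u" if "x \<in> L" for x
    using that conc_eq_iff_prefix by blast
  obtain x0 where x0: "x0 \<in> L" using assms(2) by blast
  show "Sublist.prefix u (v @ w)"
  proof (cases "length u \<le> length v")
    case True
    then have "u = take (length u) v" using u'[OF x0] by simp
    then show ?thesis by (metis Sublist.prefix_prefix take_is_prefix)
  next
    case False
    then obtain u2 where u2: "u = v @ u2"
      using u'[OF x0] by (metis nat_le_linear prefix_conc_snd)
    then have "\<forall>x\<in>L. \<exists>y. x = u2 \<frown> y"
      using u by (auto simp flip: conc_conc)
    then show ?thesis
      using assms(1) u2 unfolding greatest_common_prefix_def by simp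
  qed
qed

text \<open>Non-constancy on the cone is what makes the greatest common prefix of the values a
  finite word.\<close>

definition separating :: "nat \<Rightarrow> (letter word \<Rightarrow> letter word) \<Rightarrow> letter list \<Rightarrow> bool" where
  "separating n f u \<longleftrightarrow> (\<exists>x\<in>cantor n. \<exists>y\<in>cantor n. f (u \<frown> x) \<noteq> f (u \<frown> y))"

definition lcp_at :: "nat \<Rightarrow> (letter word \<Rightarrow> letter word) \<Rightarrow> letter list \<Rightarrow> letter list" where
  "lcp_at n f u = lcp (f ` cyl n u)"

text \<open>The restriction turns equality of local maps as HOL functions into equality on
  \<open>cantor n\<close>, so that local maps can serve as states.\<close>

definition loc :: "nat \<Rightarrow> (letter word \<Rightarrow> letter word) \<Rightarrow> letter list \<Rightarrow> letter word \<Rightarrow> letter word" where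
  "loc n f u = restrict (\<lambda>d. suffix (length (lcp_at n f u)) (f (u \<frown> d))) (cantor n)"

lemma separating_gcp:
  assumes "separating n f u"
  shows "greatest_common_prefix (lcp_at n f u) (f ` cyl n u)"
proof -
  obtain x y where "x \<in> cantor n" "y \<in> cantor n" "f (u \<frown> x) \<noteq> f (u \<frown> y)"
    using assms by (auto simp: separating_def)
  then have "\<exists>w. greatest_common_prefix w (f ` cyl n u)"
    by (intro gcp_exists[of "f (u \<frown> x)" _ "f (u \<frown> y)"]) auto
  then show ?thesis unfolding lcp_at_def using lcp_eq by metis
qed

lemma inj_separating:
  assumes "inj_on f (cantor_nr n r)" "n \<ge> 2" "u \<in> words_plus n r"
  shows "separating n f u"
proof -
  obtain x y where xy: "x \<in> cantor n" "y \<in> cantor n" "x \<noteq> y" using cantor_two assms(2) by blast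
  then have "f (u \<frown> x) \<noteq> f (u \<frown> y)"
    using assms(1,3) by (metis conc_in_cantor_nrI inj_on_eq_iff same_concat_eq)
  then show ?thesis using xy by (auto simp: separating_def)
qed

lemma lcp_at_loc:
  assumes "separating n f u" "d \<in> cantor n"
  shows "f (u \<frown> d) = lcp_at n f u \<frown> loc n f u d"
proof -
  have "f (u \<frown> d) \<in> f ` cyl n u" using assms(2) by simp
  then have "prefix (length (lcp_at n f u)) (f (u \<frown> d)) = lcp_at n f u"
    using separating_gcp[OF assms(1)] unfolding greatest_common_prefix_def
    using conc_eq_iff_prefix by blast
  then show ?thesis unfolding loc_def using assms(2)
    by (metis prefix_suffix restrict_apply)
qed

text \<open>A prefix put in front of all values joins the common prefix and is stripped with it.
  This is the reason why replacing prefixes does not affect local maps.\<close>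

lemma loc_shift:
  assumes "separating n g v" "\<And>d. d \<in> cantor n \<Longrightarrow> f (u \<frown> d) = p \<frown> g (v \<frown> d)"
  shows "lcp_at n f u = p @ lcp_at n g v" "loc n f u = loc n g v" "separating n f u"
proof -
  have "f ` cyl n u = (\<lambda>x. p \<frown> x) ` (g ` cyl n v)"
    unfolding cyl_def image_image by (intro image_cong refl) (simp add: assms(2))
  moreover have "g ` cyl n v \<noteq> {}" using assms(1) by (auto simp: separating_def cyl_def)
  ultimately show *: "lcp_at n f u = p @ lcp_at n g v"
    using gcp_conc[OF separating_gcp[OF assms(1)]] lcp_eq unfolding lcp_at_def by metis
  show "loc n f u = loc n g v"
    unfolding loc_def * by (auto simp: assms(2) restrict_def)
  show "separating n f u" using assms(1) by (auto simp: separating_def assms(2))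
qed

text \<open>The chain rule for local maps: reading \<open>w\<close> in the state of \<open>u\<close>
  leads to the state of \<open>u @ w\<close>, with the increment of the common prefix as
  output.\<close>

lemma loc_loc:
  assumes "separating n f (u @ w)" "w \<in> lists (X n)"
  shows "lcp_at n f (u @ w) = lcp_at n f u @ lcp_at n (loc n f u) w"
    "loc n (loc n f u) w = loc n f (u @ w)"
    "separating n (loc n f u) w"
proof -
  have su: "separating n f u" using assms unfolding separating_def
    by (metis conc_in_cantor conc_conc)
  have *: "f ((u @ w) \<frown> d) = lcp_at n f u \<frown> loc n f u (w \<frown> d)" if "d \<in> cantor n" for d
    using lcp_at_loc[OF su, of "w \<frown> d"] that assms(2) by simp
  show **: "separating n (loc n f u) w"
    using assms(1) unfolding separating_def using * by (metis)
  show "lcp_at n f (u @ w) = lcp_at n f u @ lcp_at n (loc n f u) w"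
    "loc n (loc n f u) w = loc n f (u @ w)"
    using loc_shift[of n "loc n f u" w f "u @ w", OF ** *] by auto
qed

declare subseq_to_Suc [simp del]

section \<open>Uniform continuity\<close>

text \<open>Koenig's lemma. A word is bad if arbitrarily long extensions of it avoid
  \<open>Q\<close>. Since the alphabet is finite, a bad word has a bad extension by one letter, and
  the resulting infinite sequence contradicts the bar.\<close>

lemma fan_cantor:
  assumes up: "\<And>w v. Q w \<Longrightarrow> Q (w @ v)" and bar: "\<And>x. x \<in> cantor n \<Longrightarrow> \<exists>k. Q (prefix k x)"
  shows "\<exists>K. \<forall>w\<in>lists (X n). K \<le> length w \<longrightarrow> Q w"
proof (rule ccontr)
  assume neg: "\<not> ?thesis"
  define bad where "bad w \<longleftrightarrow> (\<forall>K. \<exists>x\<in>lists (X n). K \<le> length x \<and> \<not> Q (w @ x))" for w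
  have bad0: "bad []" using neg by (auto simp: bad_def)
  have step: "\<exists>i\<in>X n. bad (w @ [i])" if "bad w" for w
  proof (rule ccontr)
    assume "\<not> ?thesis"
    then have "\<forall>i\<in>X n. \<exists>K. \<forall>x\<in>lists (X n). K \<le> length x \<longrightarrow> Q (w @ i # x)"
      by (auto simp: bad_def)
    then obtain K where K: "\<And>i x. i \<in> X n \<Longrightarrow> x \<in> lists (X n) \<Longrightarrow> K i \<le> length x \<Longrightarrow> Q (w @ i # x)"
      by metis
    define M where "M = Max (K ` X n)"
    obtain x where x: "x \<in> lists (X n)" "Suc M \<le> length x" "\<not> Q (w @ x)"
      using \<open>bad w\<close> unfolding bad_def by meson
    then obtain i y where y: "x = i # y" "i \<in> X n" "y \<in> lists (X n)" by (cases x) auto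
    then have "K i \<le> M" unfolding M_def by (intro Max_ge) auto
    then show False using K[of i y] x y by auto
  qed
  then obtain g where g: "\<And>w. bad w \<Longrightarrow> g w \<in> X n \<and> bad (w @ [g w])" by metis
  define s where "s = rec_nat [] (\<lambda>_ w. w @ [g w])"
  have s: "s 0 = []" "s (Suc k) = s k @ [g (s k)]" for k by (auto simp: s_def)
  have bad: "bad (s k)" for k by (induction k) (auto simp: s bad0 g)
  define x where "x k = g (s k)" for k
  have "prefix k x = s k" for k by (induction k) (auto simp: s x_def subseq_to_Suc)
  moreover have "x \<in> cantor n" using g bad by (auto simp: cantor_def x_def)
  ultimately obtain k where "Q (s k)" using bar by metis
  then show False using bad[of k] up unfolding bad_def by blast
qed

lemma fan_cantor_nr:
  assumes up: "\<And>w v. Q w \<Longrightarrow> Q (w @ v)" and bar: "\<And>x. x \<in> cantor_nr n r \<Longrightarrow> \<exists>k. Q (prefix k x)"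
  shows "\<exists>K. \<forall>x\<in>cantor_nr n r. Q (prefix K x)"
proof -
  have "\<exists>K. \<forall>w\<in>lists (X n). K \<le> length w \<longrightarrow> Q (Dotted a # w)" if "a < r" for a
  proof (rule fan_cantor)
    fix x assume x: "x \<in> cantor n"
    then obtain k where "Q (prefix k ([Dotted a] \<frown> x))"
      using bar[OF conc_in_cantor_nrI[of "[Dotted a]" n r x]] \<open>a < r\<close> by auto
    \<comment> \<open>One more letter is added so that the prefix contains the dotted letter even if
      \<open>k = 0\<close>.\<close>
    then have "Q (prefix k ([Dotted a] \<frown> x) @ [([Dotted a] \<frown> x) k])" using up by blast
    then have "Q (prefix (Suc k) ([Dotted a] \<frown> x))" by (simp add: subseq_to_Suc del: prefix_conc_snd)
    then show "\<exists>k. Q (Dotted a # prefix k x)" by auto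
  qed (metis append_Cons up)
  then obtain K where K: "\<And>a w. a < r \<Longrightarrow> w \<in> lists (X n) \<Longrightarrow> K a \<le> length w \<Longrightarrow> Q (Dotted a # w)"
    by metis
  define M where "M = Max (K ` {..<r})"
  have "Q (prefix (Suc M) x)" if x: "x \<in> cantor_nr n r" for x
  proof -
    obtain a d where d: "x = [Dotted a] \<frown> d" "a < r" "d \<in> cantor n" using x by (rule cantor_nr_cases)
    have "K a \<le> M" unfolding M_def using d by (intro Max_ge) auto
    then have "Q (Dotted a # prefix M d)" using K[of a "prefix M d"] d prefix_in_lists by auto
    then show ?thesis unfolding d by simp
  qed
  then show ?thesis by blast
qed

definition ucont :: "nat \<Rightarrow> nat \<Rightarrow> (letter word \<Rightarrow> letter word) \<Rightarrow> bool" where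
  "ucont n r f \<longleftrightarrow> (\<forall>m. \<exists>k. \<forall>x\<in>cantor_nr n r. \<forall>y\<in>cantor_nr n r.
     prefix k x = prefix k y \<longrightarrow> prefix m (f x) = prefix m (f y))"

definition sync :: "nat \<Rightarrow> nat \<Rightarrow> nat \<Rightarrow> (letter word \<Rightarrow> letter word) \<Rightarrow> bool" where
  "sync n r k f \<longleftrightarrow> (\<forall>u\<in>words_plus n r. \<forall>v\<in>words_plus n r. \<forall>x\<in>lists (X n).
     length x = k \<longrightarrow> loc n f (u @ x) = loc n f (v @ x))"

text \<open>Only the last \<open>k\<close> letters of \<open>x\<close> count; the earlier ones are
  absorbed into \<open>u\<close> and \<open>v\<close>.\<close>

lemma syncD:
  assumes "sync n r k f" "u \<in> words_plus n r" "v \<in> words_plus n r" "x \<in> lists (X n)" "k \<le> length x"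
  shows "loc n f (u @ x) = loc n f (v @ x)"
proof -
  define y z where "y = take (length x - k) x" and "z = drop (length x - k) x"
  have x: "x = y @ z" "length z = k" using assms(5) by (auto simp: y_def z_def)
  then have "y \<in> lists (X n)" "z \<in> lists (X n)" using assms(4) by auto
  then show ?thesis
    using assms(1)[unfolded sync_def, rule_format, of "u @ y" "v @ y" z] assms(2,3) x by auto
qed

lemma sync_mono: "sync n r k f \<Longrightarrow> k \<le> k' \<Longrightarrow> sync n r k' f"
  unfolding sync_def[of n r k'] using syncD by blast


section \<open>Transducers and the maps they represent\<close>

lemma read_word_Nil [simp]: "read_word A [] q = q"
  by (simp add: read_word_def)

lemma read_word_Cons [simp]: "read_word A (i # w) q = read_word A w (next_state A i q)"
  by (simp add: read_word_def)

lemma read_word_append [simp]: "read_word A (u @ w) q = read_word A w (read_word A u q)"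
  by (simp add: read_word_def)

lemma output_word_append [simp]:
  "output_word A (u @ w) q = output_word A u q @ output_word A w (read_word A u q)"
  by (induction u arbitrary: q) auto

lemma output_word_prefix_le:
  assumes "j \<le> k"
  shows "\<exists>v. output_word A (prefix k x) q = output_word A (prefix j x) q @ v"
proof -
  have "prefix k x = prefix j x @ prefix (k - j) (suffix j x)"
    by (metis assms le_add_diff_inverse subsequence_append subsequence_prefix_suffix)
  then show ?thesis by simp
qed

text \<open>Letter \<open>m\<close> is defined through the least sufficient input prefix. Outputs of
  longer prefixes extend those of shorter ones, so any sufficient prefix shows the same
  letter.\<close>

lemma output_omega_prefix:
  assumes "infinite_output A x q"
  shows "prefix (length (output_word A (prefix k x) q)) (output_omega A x q) = output_word A (prefix k x) q"
proof (rule nth_equalityI)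
  fix m assume "m < length (prefix (length (output_word A (prefix k x) q)) (output_omega A x q))"
  then have m: "m < length (output_word A (prefix k x) q)" by simp
  define K where "K = (LEAST k. m < length (output_word A (prefix k x) q))"
  have K: "m < length (output_word A (prefix K x) q)" "K \<le> k"
    unfolding K_def using m by (auto intro: LeastI Least_le)
  obtain v where "output_word A (prefix k x) q = output_word A (prefix K x) q @ v"
    using output_word_prefix_le[OF K(2), of A x q] by metis
  then have "output_word A (prefix k x) q ! m = output_word A (prefix K x) q ! m"
    using K by (simp add: nth_append)
  also have "\<dots> = output_omega A x q m" by (simp add: output_omega_def K_def)
  finally show "prefix (length (output_word A (prefix k x) q)) (output_omega A x q) ! m =
      output_word A (prefix k x) q ! m" using m by simp
qed simp

lemma output_omega_eqI:
  assumes "infinite_output A x q"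
    and "\<And>k. prefix (length (output_word A (prefix k x) q)) y = output_word A (prefix k x) q"
  shows "output_omega A x q = y"
proof
  fix m
  obtain k where k: "m < length (output_word A (prefix k x) q)"
    using assms(1) unfolding infinite_output_def by blast
  show "output_omega A x q m = y m"
    using output_omega_prefix[OF assms(1), of k] assms(2)[of k] k
    by (metis add_0 diff_zero subsequence_nth)
qed

lemma infinite_output_conc:
  "infinite_output A (w \<frown> x) q \<longleftrightarrow> infinite_output A x (read_word A w q)"
proof
  assume *: "infinite_output A (w \<frown> x) q"
  show "infinite_output A x (read_word A w q)"
    unfolding infinite_output_def
  proof
    fix m
    obtain k where k: "m + length (output_word A w q) < length (output_word A (prefix k (w \<frown> x)) q)"
      using * unfolding infinite_output_def by blast
    have "k > length w"
    proof (rule ccontr)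
      assume "\<not> ?thesis"
      then have "prefix k (w \<frown> x) = take k w" by simp
      then have "w = prefix k (w \<frown> x) @ drop k w" by simp
      then have "length (output_word A w q) \<ge> length (output_word A (prefix k (w \<frown> x)) q)"
        by (metis output_word_append le_add1 length_append)
      then show False using k by simp
    qed
    then show "\<exists>k. m < length (output_word A (prefix k x) (read_word A w q))"
      using k by (intro exI[of _ "k - length w"]) simp
  qed
next
  assume *: "infinite_output A x (read_word A w q)"
  show "infinite_output A (w \<frown> x) q"
    unfolding infinite_output_def
  proof
    fix m
    obtain k where "m < length (output_word A (prefix k x) (read_word A w q))"
      using * unfolding infinite_output_def by blast
    then show "\<exists>k. m < length (output_word A (prefix k (w \<frown> x)) q)"
      by (intro exI[of _ "length w + k"]) simp
  qed
qed

lemma output_omega_conc: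
  assumes "infinite_output A x (read_word A w q)"
  shows "output_omega A (w \<frown> x) q = output_word A w q \<frown> output_omega A x (read_word A w q)"
proof (rule output_omega_eqI)
  show "infinite_output A (w \<frown> x) q" using assms by (simp only: infinite_output_conc)
  fix k
  let ?y = "output_word A w q \<frown> output_omega A x (read_word A w q)"
  show "prefix (length (output_word A (prefix k (w \<frown> x)) q)) ?y = output_word A (prefix k (w \<frown> x)) q"
  proof (cases "k \<le> length w")
    case True
    have "output_word A w q = output_word A (take k w) q @ output_word A (drop k w) (read_word A (take k w) q)"
      by (metis append_take_drop_id output_word_append)
    then show ?thesis using True by simp
  next
    case False
    then show ?thesis using output_omega_prefix[OF assms, of "k - length w"] by simp
  qed
qed

section \<open>Induced maps of states as local maps\<close>

definition state_map :: "nat \<Rightarrow> ('q, 'z) transducer_scheme \<Rightarrow> 'q \<Rightarrow> letter word \<Rightarrow> letter word" where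
  "state_map n A q = restrict (\<lambda>d. output_omega A d q) (cantor n)"

text \<open>Uniqueness of the factorization: once the remainder has no common prefix left,
  \<open>p\<close> must be the full common prefix of the values.\<close>

lemma loc_eqI:
  assumes "\<And>d. d \<in> cantor n \<Longrightarrow> f (u \<frown> d) = p \<frown> g d" "greatest_common_prefix [] (g ` cantor n)" "n > 0"
  shows "lcp_at n f u = p" "loc n f u = restrict g (cantor n)"
proof -
  have "f ` cyl n u = (\<lambda>x. p \<frown> x) ` (g ` cantor n)"
    unfolding cyl_def image_image by (intro image_cong refl) (simp add: assms(1))
  moreover have "g ` cantor n \<noteq> {}" using cyl_nonempty[OF assms(3), of "[]"] by simp
  ultimately show *: "lcp_at n f u = p"
    using gcp_conc[OF assms(2)] lcp_eq unfolding lcp_at_def by (metis append_Nil2)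
  show "loc n f u = restrict g (cantor n)"
    unfolding loc_def * by (auto simp: assms(1) restrict_def)
qed

lemma transducer_nr_next:
  assumes "transducer_nr n r A" "q \<in> states A" "i \<in> letters_from n r A q"
  shows "next_state A i q \<in> states A - {init A}"
proof -
  from assms(1) have "\<forall>q\<in>states A. \<forall>i\<in>letters_from n r A q. next_state A i q \<in> states A - {init A}"
    unfolding transducer_nr_def by (elim exE conjE)
  then show ?thesis using assms(2,3) by blast
qed

lemma transducer_nr_init: "transducer_nr n r A \<Longrightarrow> init A \<in> states A"
  unfolding transducer_nr_def by (elim exE conjE) simp

lemma read_word_states:
  assumes "transducer_nr n r A" "q \<in> states A - {init A}" "w \<in> lists (X n)"
  shows "read_word A w q \<in> states A - {init A}"
  using assms(2,3)
proof (induction w arbitrary: q)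
  case (Cons i w)
  then show ?case using transducer_nr_next[OF assms(1), of q i] by (auto simp: letters_from_def)
qed simp

lemma read_word_plus_states:
  assumes "transducer_nr n r A" "u \<in> words_plus n r"
  shows "read_word A u (init A) \<in> states A - {init A}"
proof -
  obtain a w where u: "u = Dotted a # w" "a < r" "w \<in> lists (X n)"
    using assms(2) by (rule words_plus_cases)
  have "init A \<in> states A" using transducer_nr_init[OF assms(1)] .
  then have "next_state A (Dotted a) (init A) \<in> states A - {init A}"
    using transducer_nr_next[OF assms(1)] u by (auto simp: letters_from_def)
  then show ?thesis using read_word_states[OF assms(1)] u by simp
qed

text \<open>Since no state of \<open>R\<close> lies on a cycle, every infinite path leaves \<open>R\<close>.\<close>

lemma transducer_nr_infinite_output:
  assumes "transducer_nr n r A" "q \<in> states A - {init A}" "d \<in> cantor n"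
  shows "infinite_output A d q"
proof -
  obtain R S where RS: "states A = R \<union> S" "R \<inter> S = {}" "finite R"
    "\<And>q d. q \<in> S \<Longrightarrow> d \<in> cantor n \<Longrightarrow> infinite_output A d q"
    "\<And>q w. q \<in> R \<Longrightarrow> w \<in> words_from n r A q \<Longrightarrow> w \<noteq> [] \<Longrightarrow> read_word A w q \<noteq> q"
    using assms(1) unfolding transducer_nr_def by (elim exE conjE) (rule that, auto)
  have st: "read_word A (prefix k d) q \<in> states A - {init A}" for k
    using read_word_states[OF assms(1,2)] prefix_in_lists assms(3) by blast
  have "\<exists>k. read_word A (prefix k d) q \<in> S"
  proof (rule ccontr)
    assume "\<not> ?thesis"
    then have R: "read_word A (prefix k d) q \<in> R" for k using st RS(1) by blast
    then have "finite (range (\<lambda>k. read_word A (prefix k d) q))"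
      using RS(3) by (meson finite_subset image_subsetI)
    then have "\<not> inj (\<lambda>k. read_word A (prefix k d) q)"
      using range_inj_infinite by blast
    then obtain i j where "i \<noteq> j" "read_word A (prefix i d) q = read_word A (prefix j d) q"
      by (auto simp: inj_on_def)
    then obtain i j where ij: "i < j" "read_word A (prefix i d) q = read_word A (prefix j d) q"
      by (metis nat_neq_iff)
    let ?w = "prefix (j - i) (suffix i d)" and ?p = "read_word A (prefix i d) q"
    have "prefix j d = prefix i d @ ?w"
      by (metis ij(1) le_add_diff_inverse less_imp_le subsequence_append subsequence_prefix_suffix)
    then have "read_word A ?w ?p = ?p" using ij by simp
    moreover have "?w \<in> words_from n r A ?p"
      using st[of i] assms(3) by (auto simp: words_from_def cantor_def)
    ultimately show False using RS(5)[of ?p ?w] R ij by simp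
  qed
  then obtain k where "read_word A (prefix k d) q \<in> S" by blast
  then have "infinite_output A (suffix k d) (read_word A (prefix k d) q)"
    using RS(4) assms(3) suffix_in_cantor by blast
  then have "infinite_output A (prefix k d \<frown> suffix k d) q" by (simp only: infinite_output_conc)
  then show ?thesis by simp
qed

lemma minimal_reachable:
  assumes "minimal_nr n r A" "q \<in> states A - {init A}"
  obtains u where "u \<in> words_plus n r" "q = read_word A u (init A)"
proof -
  obtain w where "w \<in> words_star n r" "read_word A w (init A) = q"
    using assms unfolding minimal_nr_def by blast
  moreover have "w \<noteq> []" using assms(2) calculation by auto
  ultimately show thesis using that by (auto simp: words_star_def)
qed

text \<open>Minimality speaks about outputs of letters, not about states. A non-initial state
  \<open>q\<close> is entered by some transition, which already emits everything common; a common
  prefix of the values at \<open>q\<close> would lengthen the output of that transition.\<close>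

lemma minimal_state_gcp:
  assumes "minimal_nr n r A" "q \<in> states A - {init A}"
  shows "greatest_common_prefix [] (state_map n A q ` cantor n)"
proof -
  have tr: "transducer_nr n r A" using assms by (simp add: minimal_nr_def)
  obtain u where u: "u \<in> words_plus n r" "q = read_word A u (init A)"
    by (rule minimal_reachable[OF assms])
  obtain w i where w: "u = w @ [i]" using words_plus_nonempty[OF u(1)] by (cases u rule: rev_cases) auto
  define p where "p = read_word A w (init A)"
  have q: "q = next_state A i p" using u w by (simp add: p_def)
  have pi: "p \<in> states A \<and> i \<in> letters_from n r A p"
  proof (cases "w = []")
    case True
    have "init A \<in> states A" using transducer_nr_init[OF tr] .
    then show ?thesis using True u w by (auto simp: p_def letters_from_def)
  next
    case False
    then have "w \<in> words_plus n r" "i \<in> X n" using u w append_in_words_plus[of w "[i]"] by auto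
    then show ?thesis using read_word_plus_states[OF tr] by (auto simp: p_def letters_from_def)
  qed
  have g: "greatest_common_prefix (outp A i p) {output_omega A (i ## d) p | d. d \<in> cantor n}"
    using assms(1) pi unfolding minimal_nr_def by blast
  have "output_omega A (i ## d) p = outp A i p \<frown> state_map n A q d" if "d \<in> cantor n" for d
    using output_omega_conc[of A d "[i]" p] transducer_nr_infinite_output[OF tr assms(2) that] q that
    by (simp add: build_conc state_map_def)
  then have eq: "{output_omega A (i ## d) p | d. d \<in> cantor n}
      = (\<lambda>x. outp A i p \<frown> x) ` state_map n A q ` cantor n" by (auto simp: image_iff) metis+
  show ?thesis
    unfolding greatest_common_prefix_def
  proof (intro conjI allI impI ballI)
    fix v assume "\<forall>x\<in>state_map n A q ` cantor n. \<exists>y. x = v \<frown> y"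
    then have "\<forall>x\<in>(\<lambda>x. outp A i p \<frown> x) ` state_map n A q ` cantor n. \<exists>y. x = (outp A i p @ v) \<frown> y"
      by (metis (no_types, lifting) conc_conc imageE)
    then show "Sublist.prefix v []"
      using g unfolding eq greatest_common_prefix_def by fastforce
  qed simp
qed

lemma state_map_read:
  assumes "minimal_nr n r A" "q \<in> states A - {init A}" "w \<in> lists (X n)" "n > 0"
  shows "lcp_at n (state_map n A q) w = output_word A w q"
    and "loc n (state_map n A q) w = state_map n A (read_word A w q)"
proof -
  have tr: "transducer_nr n r A" using assms by (simp add: minimal_nr_def)
  let ?p = "read_word A w q"
  have p: "?p \<in> states A - {init A}" using read_word_states[OF tr] assms by blast
  have *: "state_map n A q (w \<frown> d) = output_word A w q \<frown> state_map n A ?p d" if "d \<in> cantor n" for d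
    using output_omega_conc[of A d w q] transducer_nr_infinite_output[OF tr p that] that assms(3)
    by (simp add: state_map_def)
  show "lcp_at n (state_map n A q) w = output_word A w q"
    "loc n (state_map n A q) w = state_map n A (read_word A w q)"
    using loc_eqI[of n "state_map n A q" w, OF * minimal_state_gcp[OF assms(1) p] assms(4)]
    by (auto simp: state_map_def)
qed

lemma minimal_loc:
  assumes "minimal_nr n r A" "represents n r A f" "u \<in> words_plus n r" "n > 0"
  shows "lcp_at n f u = output_word A u (init A)"
    and "loc n f u = state_map n A (read_word A u (init A))"
proof -
  have tr: "transducer_nr n r A" using assms by (simp add: minimal_nr_def)
  let ?p = "read_word A u (init A)"
  have p: "?p \<in> states A - {init A}" using read_word_plus_states[OF tr] assms by blast
  have *: "f (u \<frown> d) = output_word A u (init A) \<frown> state_map n A ?p d" if "d \<in> cantor n" for d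
    using output_omega_conc[of A d u "init A"] transducer_nr_infinite_output[OF tr p that] that
      assms(2)[unfolded represents_def, rule_format, OF conc_in_cantor_nrI[OF assms(3) that]]
    by (simp add: state_map_def)
  show "lcp_at n f u = output_word A u (init A)"
    "loc n f u = state_map n A (read_word A u (init A))"
    using loc_eqI[of n f u, OF * minimal_state_gcp[OF assms(1) p] assms(4)]
    by (auto simp: state_map_def)
qed

lemma state_map_inj:
  assumes "minimal_nr n r A"
  shows "inj_on (state_map n A) (states A - {init A})"
  using assms unfolding minimal_nr_def state_map_def inj_on_def
  by (metis (no_types, lifting) restrict_apply)

text \<open>Distinct non-initial states induce distinct maps, so forced states can be compared
  through local maps. Level \<open>0\<close> has to be excluded: the empty word can be read from
  every state, including the initial one, which no transition enters. A nonempty word readable from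
  the initial state starts with a dotted letter and cannot be read from any other state, so such
  words impose nothing.\<close>

lemma minimal_synchronizing_iff:
  assumes "minimal_nr n r A" "represents n r A f" "n > 0" "r > 0"
  shows "synchronizing_at n r k A \<longleftrightarrow> 0 < k \<and> sync n r k f"
proof
  have tr: "transducer_nr n r A" using assms by (simp add: minimal_nr_def)
  have i: "init A \<in> states A" using transducer_nr_init[OF tr] .
  {
    assume s: "synchronizing_at n r k A"
    have r: "read_word A [Dotted 0] (init A) \<in> states A - {init A}"
      by (rule read_word_plus_states[OF tr]) (simp add: assms)
    have "k \<noteq> 0"
    proof
      assume "k = 0"
      then have "init A = read_word A [Dotted 0] (init A)"
        using s i r unfolding synchronizing_at_def
        by (metis Diff_iff UnI2 insertI1 list.size(3) lists.Nil read_word_Nil words_from_def words_star_def)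
      then show False using r by simp
    qed
    moreover have "sync n r k f"
      unfolding sync_def
    proof (intro ballI impI)
      fix u v x assume *: "u \<in> words_plus n r" "v \<in> words_plus n r" "x \<in> lists (X n)" "length x = k"
      then have "read_word A x (read_word A u (init A)) = read_word A x (read_word A v (init A))"
        using s read_word_plus_states[OF tr] unfolding synchronizing_at_def words_from_def by auto
      then show "loc n f (u @ x) = loc n f (v @ x)"
        using minimal_loc[OF assms(1,2) _ assms(3)] * by (simp add: words_plus_append)
    qed
    ultimately show "0 < k \<and> sync n r k f" by simp
  }
  assume k: "0 < k \<and> sync n r k f"
  show "synchronizing_at n r k A"
    unfolding synchronizing_at_def
  proof (intro ballI allI impI)
    fix p q x assume pq: "p \<in> states A" "q \<in> states A"
      and x: "length x = k \<and> x \<in> words_from n r A p \<and> x \<in> words_from n r A q"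
    have x0: "x \<noteq> []" using x k by auto
    show "read_word A x p = read_word A x q"
    proof (cases "p = init A \<or> q = init A")
      case True
      then have "x \<in> words_plus n r"
        using x x0 by (auto simp: words_from_def words_star_def)
      then have "p = init A" "q = init A"
        using x lists_words_plus_disjoint by (auto simp: words_from_def split: if_splits)
      then show ?thesis by simp
    next
      case False
      then have xl: "x \<in> lists (X n)" using x by (simp add: words_from_def)
      obtain u v where uv: "u \<in> words_plus n r" "p = read_word A u (init A)"
          "v \<in> words_plus n r" "q = read_word A v (init A)"
        using False pq minimal_reachable[OF assms(1)] by (metis Diff_iff empty_iff insert_iff)
      have "loc n f (u @ x) = loc n f (v @ x)"
        using k uv x xl unfolding sync_def by blast
      then have "state_map n A (read_word A x p) = state_map n A (read_word A x q)"
        using minimal_loc[OF assms(1,2) _ assms(3)] uv xl by (simp add: words_plus_append)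
      moreover have "read_word A x p \<in> states A - {init A}" "read_word A x q \<in> states A - {init A}"
        using read_word_states[OF tr] pq False xl by auto
      ultimately show ?thesis using state_map_inj[OF assms(1)] by (auto dest: inj_onD)
    qed
  qed
qed

text \<open>The fan theorem is applied to the property that the output on a prefix has at least
  \<open>m\<close> letters; the resulting \<open>K\<close> is uniform.\<close>

lemma minimal_ucont:
  assumes "minimal_nr n r A" "represents n r A f"
  shows "ucont n r f"
  unfolding ucont_def
proof
  fix m
  have tr: "transducer_nr n r A" using assms by (simp add: minimal_nr_def)
  have inf: "infinite_output A x (init A)" if "x \<in> cantor_nr n r" for x
  proof -
    obtain a d where d: "x = [Dotted a] \<frown> d" "a < r" "d \<in> cantor n" using \<open>x \<in> cantor_nr n r\<close> by (rule cantor_nr_cases)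
    have "read_word A [Dotted a] (init A) \<in> states A - {init A}"
      by (rule read_word_plus_states[OF tr]) (simp add: d)
    then have "infinite_output A d (read_word A [Dotted a] (init A))"
      using transducer_nr_infinite_output[OF tr] d by blast
    then show ?thesis unfolding d by (simp only: infinite_output_conc)
  qed
  have "\<exists>K. \<forall>x\<in>cantor_nr n r. m \<le> length (output_word A (prefix K x) (init A))"
  proof (rule fan_cantor_nr)
    fix x assume "x \<in> cantor_nr n r"
    then show "\<exists>k. m \<le> length (output_word A (prefix k x) (init A))"
      using inf unfolding infinite_output_def by (meson less_imp_le)
  qed simp
  then obtain K where K: "\<And>x. x \<in> cantor_nr n r \<Longrightarrow> m \<le> length (output_word A (prefix K x) (init A))" by blast
  show "\<exists>k. \<forall>x\<in>cantor_nr n r. \<forall>y\<in>cantor_nr n r. prefix k x = prefix k y \<longrightarrow> prefix m (f x) = prefix m (f y)"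
  proof (intro exI[of _ K] ballI impI)
    fix x y assume xy: "x \<in> cantor_nr n r" "y \<in> cantor_nr n r" "prefix K x = prefix K y"
    let ?o = "output_word A (prefix K x) (init A)"
    have "prefix (length ?o) (f x) = ?o" "prefix (length ?o) (f y) = ?o"
      using output_omega_prefix[OF inf, of _ K] xy assms(2) unfolding represents_def by metis+
    then show "prefix m (f x) = prefix m (f y)" using K[OF xy(1)] prefix_eq_mono by metis
  qed
qed

text \<open>By uniform continuity all values on a long cone share their first \<open>m\<close>
  letters, and these form a common prefix.\<close>

lemma lcp_at_long:
  assumes "ucont n r f" "inj_on f (cantor_nr n r)" "n \<ge> 2"
  shows "\<exists>K. \<forall>u\<in>words_plus n r. K \<le> length u \<longrightarrow> m \<le> length (lcp_at n f u)"
proof -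
  obtain K where K: "\<And>x y. x \<in> cantor_nr n r \<Longrightarrow> y \<in> cantor_nr n r \<Longrightarrow> prefix K x = prefix K y
      \<Longrightarrow> prefix m (f x) = prefix m (f y)"
    using assms(1) unfolding ucont_def by metis
  have "m \<le> length (lcp_at n f u)" if u: "u \<in> words_plus n r" "K \<le> length u" for u
  proof -
    obtain d where d: "d \<in> cantor n" using cantor_two assms(3) by metis
    define p where "p = prefix m (f (u \<frown> d))"
    have "\<exists>z. f y = p \<frown> z" if y: "y \<in> cyl n u" for y
    proof -
      obtain d' where "y = u \<frown> d'" using y unfolding cyl_def by blast
      then have "prefix K y = prefix K (u \<frown> d)" using u(2) by simp
      moreover have "y \<in> cantor_nr n r" "u \<frown> d \<in> cantor_nr n r"
        using y cyl_subset[OF u(1)] u d by auto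
      ultimately have "prefix m (f y) = p" using K unfolding p_def by blast
      moreover have "length p = m" by (simp add: p_def)
      ultimately have "prefix (length p) (f y) = p" by simp
      then show ?thesis using conc_eq_iff_prefix by blast
    qed
    then have "Sublist.prefix p (lcp_at n f u)"
      using separating_gcp[OF inj_separating[OF assms(2,3) u(1)]]
      unfolding greatest_common_prefix_def by blast
    then show ?thesis using Sublist.prefix_length_le by (fastforce simp: p_def)
  qed
  then show ?thesis by blast
qed

section \<open>From local maps back to a finite synchronizing transducer\<close>

lemma cantor_nr_cantor_disjoint: "x \<in> cantor_nr n r \<Longrightarrow> x \<notin> cantor n"
  by (auto simp: cantor_nr_def dots_def build_conc)

lemma words_plus_snoc_split:
  assumes "u \<in> words_plus n r" "k < length u"
  obtains v x where "u = v @ x" "v \<in> words_plus n r" "x \<in> lists (X n)" "length x = k"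
proof
  let ?v = "take (length u - k) u" and ?x = "drop (length u - k) u"
  show "u = ?v @ ?x" by simp
  have "?v \<noteq> []" using assms by auto
  then show "?v \<in> words_plus n r" "?x \<in> lists (X n)"
    using assms(1) append_in_words_plus[of ?v ?x n r] by auto
  show "length ?x = k" using assms(2) by simp
qed

lemma finite_words_plus_le: "finite {u \<in> words_plus n r. length u \<le> k}"
proof (rule finite_subset)
  show "{u \<in> words_plus n r. length u \<le> k} \<subseteq> {u. set u \<subseteq> dots r \<union> X n \<and> length u \<le> k}"
    by (auto simp: words_plus_def)
  show "finite {u. set u \<subseteq> dots r \<union> X n \<and> length u \<le> k}"
    by (intro finite_lists_length_le) (auto simp: dots_def)
qed

text \<open>In a word of more than \<open>k + 1\<close> letters everything before the last
  \<open>k\<close> can be replaced by a single dotted letter, so finitely many words give all local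
  maps.\<close>

lemma finite_loc:
  assumes "sync n r k f" "r > 0"
  shows "finite (loc n f ` words_plus n r)"
proof (rule finite_subset)
  show "loc n f ` words_plus n r \<subseteq> loc n f ` {u \<in> words_plus n r. length u \<le> Suc k}"
  proof
    fix g assume "g \<in> loc n f ` words_plus n r"
    then obtain u where u: "u \<in> words_plus n r" "g = loc n f u" by blast
    show "g \<in> loc n f ` {u \<in> words_plus n r. length u \<le> Suc k}"
    proof (cases "length u \<le> Suc k")
      case False
      then obtain v x where x: "u = v @ x" "v \<in> words_plus n r" "x \<in> lists (X n)" "length x = k"
        using words_plus_snoc_split[OF u(1), of k] by auto
      have d: "[Dotted 0] \<in> words_plus n r" using assms(2) by simp
      have "g = loc n f ([Dotted 0] @ x)" using syncD[OF assms(1) x(2) d x(3)] u x by simp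
      then show ?thesis using d x by (intro image_eqI[of _ _ "[Dotted 0] @ x"]) auto
    qed (use u in auto)
  qed
qed (simp add: finite_words_plus_le)

text \<open>The states are the local maps, together with an initial state (here \<open>None\<close>, standing for \<open>f\<close>).\<close>

theorem local_maps_transducer:
  assumes n: "n \<ge> 2" and r: "r > 0" and f: "f ` cantor_nr n r \<subseteq> cantor_nr n r"
    and inj: "inj_on f (cantor_nr n r)" and uc: "ucont n r f" and sy: "sync n r k f"
  shows "finite_synchronizing_map n r f"
proof -
  \<comment> \<open>\<open>D\<close> decodes a state into its map and \<open>lo u\<close> is the
    output produced so far. They are tied by
    \<open>f (u \<frown> x) = lo u \<frown> D (st u) x\<close>.\<close>
  define D where "D s = (case s of None \<Rightarrow> f | Some g \<Rightarrow> g)" for s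
  define st where "st u = (if u = [] then None else Some (loc n f u))" for u
  define lo where "lo u = (if u = [] then [] else lcp_at n f u)" for u
  define Q where "Q = st ` words_star n r"
  have finQ: "finite Q"
  proof (rule finite_subset)
    show "Q \<subseteq> insert None (Some ` loc n f ` words_plus n r)"
      by (auto simp: Q_def st_def words_star_def)
  qed (use finite_loc[OF sy r] in auto)
  \<comment> \<open>States must be natural numbers, so the finite set \<open>Q\<close> is coded
    injectively; \<open>inv_into Q e\<close> recovers the state as an option.\<close>
  obtain e :: "(letter word \<Rightarrow> letter word) option \<Rightarrow> nat" where e: "inj_on e Q"
    using finite_imp_inj_to_nat_seg[OF finQ] by auto
  define A :: "nat initial_transducer" where
    "A = \<lparr>states = e ` Q, next_state = (\<lambda>i q. e (Some (loc n (D (inv_into Q e q)) [i]))),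
          outp = (\<lambda>i q. lcp_at n (D (inv_into Q e q)) [i]), init = e None\<rparr>"
  have star: "u \<in> words_star n r \<longleftrightarrow> u = [] \<or> u \<in> words_plus n r" for u
    by (auto simp: words_star_def)
  have plusQ [simp]: "st u \<in> Q" if "u \<in> words_plus n r \<or> u = []" for u
    using that by (auto simp: Q_def star)
  have dec [simp]: "inv_into Q e (e (st u)) = st u" if "u \<in> words_plus n r \<or> u = []" for u
    using that by (intro inv_into_f_f e plusQ)
  have est: "e (st u) = e (st v) \<longleftrightarrow> st u = st v"
    if "u \<in> words_plus n r \<or> u = []" "v \<in> words_plus n r \<or> v = []" for u v
    using inj_on_eq_iff[OF e plusQ[OF that(1)] plusQ[OF that(2)]] .
  have init: "init A = e (st [])" by (simp add: A_def st_def)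
  have states: "states A = (\<lambda>u. e (st u)) ` words_star n r" by (auto simp: A_def Q_def)
  have isinit: "e (st u) = init A \<longleftrightarrow> u = []" if "u \<in> words_plus n r \<or> u = []" for u
    using est[OF that, of "[]"] unfolding init by (auto simp: st_def)
  have sep: "separating n f u" if "u \<in> words_plus n r" for u
    using inj_separating[OF inj n that] .
  have pref: "u = [] \<or> u \<in> words_plus n r" if "u @ w \<in> words_plus n r" for u w
    using that append_in_words_plus[of u w] by auto
  have fin: "f x \<in> cantor_nr n r" if "x \<in> cantor_nr n r" for x using f that by blast
  have D: "f (u \<frown> x) = lo u \<frown> D (st u) x" if "u \<frown> x \<in> cantor_nr n r" for u x
  proof (cases "u = []")
    case False
    then show ?thesis
      using that lcp_at_loc[OF sep] by (simp add: lo_def D_def st_def conc_in_cantor_nr)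
  qed (simp add: lo_def D_def st_def)
  have next1: "next_state A i (e (st u)) = e (st (u @ [i]))"
    and outp1: "lo u @ outp A i (e (st u)) = lo (u @ [i])" if ui: "u @ [i] \<in> words_plus n r" for u i
  proof -
    have u: "u \<in> words_plus n r \<or> u = []" using pref[OF ui] by auto
    have i: "u \<noteq> [] \<Longrightarrow> [i] \<in> lists (X n)" using ui append_in_words_plus by blast
    have "next_state A i (e (st u)) = e (Some (loc n (D (st u)) [i]))"
      "outp A i (e (st u)) = lcp_at n (D (st u)) [i]"
      using dec[OF u] by (simp_all add: A_def)
    moreover have "loc n (D (st u)) [i] = loc n f (u @ [i])"
      "lo u @ lcp_at n (D (st u)) [i] = lcp_at n f (u @ [i])"
      using loc_loc[OF sep[OF ui]] i by (auto simp: D_def st_def lo_def)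
    ultimately show "next_state A i (e (st u)) = e (st (u @ [i]))"
      "lo u @ outp A i (e (st u)) = lo (u @ [i])" by (auto simp: st_def lo_def)
  qed
  have read: "read_word A w (e (st u)) = e (st (u @ w)) \<and> lo u @ output_word A w (e (st u)) = lo (u @ w)"
    if "u @ w \<in> words_plus n r \<or> w = []" for u w
    using that
  proof (induction w arbitrary: u)
    case (Cons i w)
    then have *: "(u @ [i]) @ w \<in> words_plus n r" by simp
    then have ui: "u @ [i] \<in> words_plus n r" using pref by blast
    have a: "lo u @ output_word A (i # w) (e (st u)) = lo (u @ [i]) @ output_word A w (e (st (u @ [i])))"
      using next1[OF ui] outp1[OF ui, symmetric] by simp
    have b: "read_word A (i # w) (e (st u)) = e (st (u @ i # w))"
      "lo (u @ [i]) @ output_word A w (e (st (u @ [i]))) = lo (u @ i # w)"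
      using Cons.IH[of "u @ [i]"] * next1[OF ui] by auto
    show ?case using a b by metis
  qed simp
  have pre: "u @ prefix k x \<in> words_plus n r" if "u \<frown> x \<in> cantor_nr n r" "u @ prefix k x \<noteq> []" for u x k
    using that conc_in_cantor_nr[OF that(2), of "suffix k x"] by (metis conc_conc prefix_suffix)
  have lo_plus: "lo u \<in> words_plus n r" if "u \<in> words_plus n r" "lo u \<noteq> []" for u
  proof -
    obtain d where "d \<in> cantor n" using cantor_two n by metis
    then have x: "u \<frown> d \<in> cantor_nr n r" using that by blast
    have "lo u \<frown> D (st u) d \<in> cantor_nr n r" using fin[OF x] D[OF x] by simp
    then show ?thesis using that conc_in_cantor_nr by blast
  qed
  have omega: "infinite_output A x (e (st u)) \<and> output_omega A x (e (st u)) = D (st u) x"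
    if x: "u \<frown> x \<in> cantor_nr n r" for u x
  proof
    show inf: "infinite_output A x (e (st u))"
      unfolding infinite_output_def
    proof
      fix m
      obtain K where K: "\<And>v. v \<in> words_plus n r \<Longrightarrow> K \<le> length v \<Longrightarrow>
          Suc (m + length (lo u)) \<le> length (lcp_at n f v)"
        using lcp_at_long[OF uc inj n] by metis
      have p: "u @ prefix (Suc K) x \<in> words_plus n r" using pre[OF x] by simp
      have "lo u @ output_word A (prefix (Suc K) x) (e (st u)) = lo (u @ prefix (Suc K) x)"
        using read p by blast
      then have "length (lo u) + length (output_word A (prefix (Suc K) x) (e (st u))) =
          length (lcp_at n f (u @ prefix (Suc K) x))"
        by (metis (no_types, lifting) length_append lo_def words_plus_nonempty p)
      then have "m < length (output_word A (prefix (Suc K) x) (e (st u)))"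
        using K[OF p] by simp
      then show "\<exists>k. m < length (output_word A (prefix k x) (e (st u)))" ..
    qed
    show "output_omega A x (e (st u)) = D (st u) x"
    proof (rule output_omega_eqI[OF inf])
      fix k
      let ?o = "output_word A (prefix k x) (e (st u))"
      show "prefix (length ?o) (D (st u) x) = ?o"
      proof (cases "k = 0")
        case False
        then have p: "u @ prefix k x \<in> words_plus n r" using pre[OF x] by simp
        have "f (u \<frown> x) = lo (u @ prefix k x) \<frown> D (st (u @ prefix k x)) (suffix k x)"
          using D[of "u @ prefix k x" "suffix k x"] x by (simp flip: conc_conc)
        also have "\<dots> = lo u \<frown> ?o \<frown> D (st (u @ prefix k x)) (suffix k x)"
          using read[of u "prefix k x"] p by simp
        finally have "D (st u) x = ?o \<frown> D (st (u @ prefix k x)) (suffix k x)"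
          using D[OF x] by (simp flip: conc_conc)
        then show ?thesis by simp
      qed simp
    qed
  qed
  \<comment> \<open>Whether output has begun is visible in the state: before it the local map has
    values in \<open>cantor_nr n r\<close>, afterwards in \<open>cantor n\<close>, and these sets
    are disjoint. Hence the division into \<open>R\<close> and \<open>S\<close> below is well
    defined.\<close>
  have sameRS: "lo v = []" if "u \<in> words_plus n r \<or> u = []" "v \<in> words_plus n r \<or> v = []"
      "lo u = []" "st u = st v" for u v
  proof (rule ccontr)
    assume v: "lo v \<noteq> []"
    then have v0: "v \<noteq> []" by (auto simp: lo_def)
    then have u0: "u \<noteq> []" using that(4) by (auto simp: st_def)
    obtain d where d: "d \<in> cantor n" using cantor_two n by metis
    have x: "u \<frown> d \<in> cantor_nr n r" "v \<frown> d \<in> cantor_nr n r" using that u0 v0 d by auto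
    have "D (st u) d \<in> cantor_nr n r" using fin[OF x(1)] D[OF x(1)] that(3) by simp
    moreover have "D (st v) d \<in> cantor n" using fin[OF x(2)] D[OF x(2)] conc_in_cantor_nr[OF v] by simp
    ultimately show False using that(4) cantor_nr_cantor_disjoint by metis
  qed
  have letters: "u @ [i] \<in> words_plus n r" if "u \<in> words_plus n r \<or> u = []" "i \<in> letters_from n r A (e (st u))" for u i
    using that isinit[OF that(1)] by (auto simp: letters_from_def)
  define R where "R = (\<lambda>u. e (st u)) ` {u \<in> words_star n r. lo u = []}"
  define S where "S = (\<lambda>u. e (st u)) ` {u \<in> words_star n r. lo u \<noteq> []}"
  have RS: "R \<inter> S = {}"
  proof -
    have False if "u \<in> words_star n r" "lo u = []" "v \<in> words_star n r" "lo v \<noteq> []" "e (st u) = e (st v)" for u v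
      using sameRS[of u v] est[of u v] that by (auto simp: star)
    then show ?thesis unfolding R_def S_def by blast
  qed
  have Rlo: "lo u = []" if "u \<in> words_star n r" "e (st u) \<in> R" for u
    using RS that unfolding S_def by blast
  have Slo: "lo u \<noteq> []" if "u \<in> words_star n r" "e (st u) \<in> S" for u
    using RS that unfolding R_def by blast
  have Sstate: thesis if "q \<in> S" "\<And>u. u \<in> words_plus n r \<Longrightarrow> q = e (st u) \<Longrightarrow> lo u \<noteq> [] \<Longrightarrow> thesis" for q thesis
  proof -
    obtain u where "u \<in> words_star n r" "q = e (st u)" "lo u \<noteq> []" using \<open>q \<in> S\<close> unfolding S_def by blast
    then show ?thesis using that(2)[of u] by (auto simp: star lo_def)
  qed
  have tr: "transducer_nr n r A"
    unfolding transducer_nr_def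
  proof (rule exI[of _ R], rule exI[of _ S], intro conjI ballI impI)
    show "states A = R \<union> S" unfolding states R_def S_def by blast
    then have "e ` Q = R \<union> S" by (simp add: A_def)
    then show "finite R" using finite_imageI[OF finQ, of e] by simp
    show "R \<inter> S = {}" by (rule RS)
    show "init A \<in> R" unfolding init R_def by (auto simp: star lo_def)
  next
    fix q i assume "q \<in> states A" and i: "i \<in> letters_from n r A q"
    then obtain u where u: "u \<in> words_plus n r \<or> u = []" "q = e (st u)" unfolding states using star by blast
    then have ui: "u @ [i] \<in> words_plus n r" using letters i by blast
    then show "next_state A i q \<in> states A - {init A}"
      using next1[OF ui] u isinit[of "u @ [i]"] by (auto simp: states star)
  next
    fix q i assume "q \<in> R" and i: "i \<in> letters_from n r A q"
    then obtain u where u: "u \<in> words_plus n r \<or> u = []" "q = e (st u)" "lo u = []" unfolding R_def using star by blast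
    then have ui: "u @ [i] \<in> words_plus n r" using letters i by blast
    {
      assume "next_state A i q \<in> R"
      then show "outp A i q = []" using Rlo[of "u @ [i]"] u ui next1[OF ui] outp1[OF ui] by (auto simp: star)
    }
    assume "next_state A i q \<in> S"
    then have "lo (u @ [i]) \<noteq> []" using Slo[of "u @ [i]"] u ui next1[OF ui] by (auto simp: star)
    then show "outp A i q \<in> words_plus n r" using u outp1[OF ui] lo_plus[OF ui] by auto
  next
    fix q i assume "q \<in> S" and i: "i \<in> X n"
    then obtain u where u: "u \<in> words_plus n r" "q = e (st u)" "lo u \<noteq> []"
      using Sstate by metis
    then have ui: "u @ [i] \<in> words_plus n r" using i by auto
    then have l: "lo (u @ [i]) \<noteq> []" using outp1[OF ui] u by auto
    then show "next_state A i q \<in> S" using next1[OF ui] u ui by (auto simp: S_def star)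
    show "outp A i q \<in> lists (X n)"
      using outp1[OF ui] lo_plus[OF ui l] u append_in_words_plus[of "lo u" "outp A i q" n r] by auto
  next
    fix q d assume "q \<in> S" and d: "d \<in> cantor n"
    then obtain u where u: "u \<in> words_plus n r" "q = e (st u)" "lo u \<noteq> []"
      using Sstate by metis
    then show "infinite_output A d q" using omega[OF conc_in_cantor_nrI[OF u(1) d]] by simp
  next
    fix q w assume "q \<in> R" and w: "w \<in> words_from n r A q" "w \<noteq> []"
    then obtain u where u: "u \<in> words_plus n r \<or> u = []" "q = e (st u)" "lo u = []" unfolding R_def using star by blast
    show "read_word A w q \<noteq> q"
    proof
      assume eq: "read_word A w q = q"
      have uw: "u @ w \<in> words_plus n r"
        using w u isinit[OF u(1)] by (auto simp: words_from_def star)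
      have e2: "e (st (u @ w)) = e (st u)" using eq read[of u w] uw u by auto
      then have u0: "u \<in> words_plus n r" using isinit[of "u @ w"] isinit[OF u(1)] uw u(1) w by auto
      \<comment> \<open>A cycle in \<open>R\<close> means that \<open>u @ w\<close> and
        \<open>u\<close> have the same local map and no output, so \<open>f\<close> takes the same
        values on both cones. Injectivity gives \<open>w \<frown> d = d\<close> for every
        \<open>d\<close>, which fails for two sequences with different first letters.\<close>
      have "st (u @ w) = st u" using est[of "u @ w" u] e2 uw u(1) by blast
      moreover have "lo (u @ w) = []" using sameRS[of u "u @ w"] calculation u u0 uw by auto
      ultimately have fx: "f ((u @ w) \<frown> d) = f (u \<frown> d)" if "d \<in> cantor n" for d
        using D[OF conc_in_cantor_nrI[OF u0 that]] D[OF conc_in_cantor_nrI[OF uw that]] u by simp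
      have "w \<frown> d = d" if "d \<in> cantor n" for d
      proof -
        have "(u @ w) \<frown> d = u \<frown> d"
          using inj fx[OF that] conc_in_cantor_nrI[OF u0 that] conc_in_cantor_nrI[OF uw that]
          by (meson inj_onD)
        then show ?thesis by (metis conc_conc same_concat_eq)
      qed
      then have "w ! 0 = d 0" if "d \<in> cantor n" for d
        using that w(2) by (metis conc_fst length_greater_0_conv)
      from this[of "\<lambda>_. Plain 0"] this[of "\<lambda>_. Plain 1"] show False using n by simp
    qed
  qed
  have min: "minimal_nr n r A"
    unfolding minimal_nr_def
  proof (intro conjI ballI impI)
    show "transducer_nr n r A" by (rule tr)
  next
    fix q assume "q \<in> states A"
    then obtain u where u: "u \<in> words_star n r" "q = e (st u)" unfolding states by blast
    then show "\<exists>w\<in>words_star n r. read_word A w (init A) = q"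
      using read[of "[]" u] unfolding init by (intro bexI[of _ u]) (auto simp: star)
  next
    fix p q assume "p \<in> states A - {init A}" "q \<in> states A - {init A}" and pq: "p \<noteq> q"
    then obtain u v where "u \<in> words_star n r" "p = e (st u)" "u \<noteq> []"
        "v \<in> words_star n r" "q = e (st v)" "v \<noteq> []"
      unfolding states init by (elim DiffE imageE) auto
    then have uv: "u \<in> words_plus n r" "p = e (st u)" "v \<in> words_plus n r" "q = e (st v)"
      using star by auto
    then have "loc n f u \<noteq> loc n f v" using pq words_plus_nonempty by (auto simp: st_def)
    then obtain d where d: "d \<in> cantor n" "loc n f u d \<noteq> loc n f v d"
      unfolding loc_def by (auto simp: restrict_def fun_eq_iff split: if_splits)
    then show "\<exists>d\<in>cantor n. output_omega A d p \<noteq> output_omega A d q"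
      using omega[OF conc_in_cantor_nrI[OF uv(1) d(1)]] omega[OF conc_in_cantor_nrI[OF uv(3) d(1)]] uv
        words_plus_nonempty by (auto simp: D_def st_def)
  next
    fix q i assume "q \<in> states A" and i: "i \<in> letters_from n r A q"
    then obtain u where u: "u \<in> words_plus n r \<or> u = []" "q = e (st u)" unfolding states using star by blast
    then have ui: "u @ [i] \<in> words_plus n r" using letters i by blast
    have "output_omega A (i ## d) q = D (st u) ([i] \<frown> d)" if "d \<in> cantor n" for d
      using omega[of u "[i] \<frown> d"] u conc_in_cantor_nrI[OF ui that] by (simp add: build_conc)
    then have eq: "{output_omega A (i ## d) q |d. d \<in> cantor n} = D (st u) ` cyl n [i]"
      unfolding cyl_def image_image by (auto simp: image_iff) metis+
    have "separating n (D (st u)) [i]"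
    proof (cases "u = []")
      case True
      then show ?thesis using sep[OF ui] by (simp add: D_def st_def)
    next
      case False
      then have "[i] \<in> lists (X n)" using ui append_in_words_plus by blast
      then show ?thesis using loc_loc(3)[OF sep[OF ui]] False by (simp add: D_def st_def)
    qed
    moreover have "outp A i q = lcp_at n (D (st u)) [i]" using dec[OF u(1)] u by (simp add: A_def)
    ultimately show "greatest_common_prefix (outp A i q) {output_omega A (i ## d) q |d. d \<in> cantor n}"
      using separating_gcp unfolding eq by metis
  qed
  have rep: "represents n r A f"
    using omega[of "[]"] unfolding represents_def init by (auto simp: D_def st_def)
  \<comment> \<open>The successor makes the level positive, since no transducer here synchronizes at
    level \<open>0\<close>.\<close>
  have "synchronizing_at n r (Suc k) A"
    using minimal_synchronizing_iff[OF min rep] n r sync_mono[OF sy, of "Suc k"] by auto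
  then show ?thesis
    unfolding finite_synchronizing_map_def synchronizing_def
    using min rep finQ by (auto simp: A_def intro!: exI[of _ A])
qed

section \<open>Homeomorphisms with finite synchronizing transducers\<close>

lemma topspace_cantor_nr [simp]: "topspace (cantor_nr_topology n r) = cantor_nr n r"
  by (simp add: cantor_nr_topology_def)

text \<open>Continuity into the product is tested coordinatewise. Coordinate \<open>m\<close> of
  \<open>f x\<close> is determined by finitely many letters of \<open>x\<close>, and fixing those is
  an open condition.\<close>

lemma ucont_continuous_map:
  assumes "ucont n r f" "f ` cantor_nr n r \<subseteq> cantor_nr n r"
  shows "continuous_map (cantor_nr_topology n r) (cantor_nr_topology n r) f"
proof -
  let ?C = "cantor_nr n r"
  have "continuous_map (cantor_nr_topology n r) (discrete_topology UNIV) (\<lambda>x. f x m)" for m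
    unfolding continuous_map_def
  proof (intro conjI allI impI)
    fix U :: "letter set"
    obtain k where k: "\<And>x y. x \<in> ?C \<Longrightarrow> y \<in> ?C \<Longrightarrow> prefix k x = prefix k y
        \<Longrightarrow> prefix (Suc m) (f x) = prefix (Suc m) (f y)"
      using assms(1) unfolding ucont_def by metis
    have km: "f x m = f y m" if "x \<in> ?C" "y \<in> ?C" "prefix k x = prefix k y" for x y
    proof -
      have "prefix (Suc m) (f x) ! m = prefix (Suc m) (f y) ! m" using k[OF that] by simp
      then show ?thesis by simp
    qed
    show "openin (cantor_nr_topology n r) {x \<in> topspace (cantor_nr_topology n r). f x m \<in> U}"
    proof (subst openin_subopen, intro ballI)
      fix x assume x: "x \<in> {x \<in> topspace (cantor_nr_topology n r). f x m \<in> U}"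
      let ?T = "(\<Pi>\<^sub>E i\<in>UNIV. if i < k then {x i} else UNIV) \<inter> ?C"
      have "openin (product_topology (\<lambda>_. discrete_topology UNIV) UNIV) (\<Pi>\<^sub>E i\<in>UNIV. if i < k then {x i} else UNIV)"
        by (rule product_topology_basis) (auto intro: finite_subset[of _ "{..<k}"])
      then have "openin (cantor_nr_topology n r) ?T"
        unfolding cantor_nr_topology_def openin_subtopology by blast
      moreover have "x \<in> ?T" using x by auto
      moreover have "?T \<subseteq> {x \<in> topspace (cantor_nr_topology n r). f x m \<in> U}"
      proof
        fix y assume y: "y \<in> ?T"
        have "x i = y i" if "i < k" for i
        proof -
          have "y i \<in> (if i < k then {x i} else UNIV)" using y by (auto simp: PiE_iff)
          then show ?thesis using that by simp
        qed
        then have "prefix k x = prefix k y" by (intro nth_equalityI) auto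
        then show "y \<in> {x \<in> topspace (cantor_nr_topology n r). f x m \<in> U}"
          using km[of x y] x y by auto
      qed
      ultimately show "\<exists>T. openin (cantor_nr_topology n r) T \<and> x \<in> T \<and>
          T \<subseteq> {x \<in> topspace (cantor_nr_topology n r). f x m \<in> U}" by blast
    qed
  qed simp
  then have "continuous_map (cantor_nr_topology n r) (product_topology (\<lambda>_. discrete_topology UNIV) UNIV) f"
    by (simp add: continuous_map_componentwise_UNIV)
  then show ?thesis
    using assms(2) by (subst (2) cantor_nr_topology_def) (auto simp: continuous_map_in_subtopology)
qed

text \<open>Membership in \<open>B\<close> freed from transducers: a map and its inverse, with one
  synchronizing level for both.\<close>

definition bisync :: "nat \<Rightarrow> nat \<Rightarrow> nat \<Rightarrow> (letter word \<Rightarrow> letter word) \<Rightarrow> (letter word \<Rightarrow> letter word) \<Rightarrow> bool" where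
  "bisync n r k h g \<longleftrightarrow> h ` cantor_nr n r \<subseteq> cantor_nr n r \<and> g ` cantor_nr n r \<subseteq> cantor_nr n r \<and>
     (\<forall>x\<in>cantor_nr n r. g (h x) = x \<and> h (g x) = x) \<and>
     ucont n r h \<and> ucont n r g \<and> sync n r k h \<and> sync n r k g"

lemma bisyncD:
  assumes "bisync n r k h g"
  shows "x \<in> cantor_nr n r \<Longrightarrow> h x \<in> cantor_nr n r" "x \<in> cantor_nr n r \<Longrightarrow> g x \<in> cantor_nr n r"
    "x \<in> cantor_nr n r \<Longrightarrow> g (h x) = x" "x \<in> cantor_nr n r \<Longrightarrow> h (g x) = x"
    "ucont n r h" "ucont n r g" "sync n r k h" "sync n r k g"
    "inj_on h (cantor_nr n r)" "inj_on g (cantor_nr n r)"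
  using assms unfolding bisync_def by (auto intro: inj_on_inverseI)

lemma bisync_sym: "bisync n r k h g \<Longrightarrow> bisync n r k g h"
  unfolding bisync_def by auto

lemma finite_synchronizing_map_cong:
  assumes "finite_synchronizing_map n r f" "\<And>x. x \<in> cantor_nr n r \<Longrightarrow> f x = f' x"
  shows "finite_synchronizing_map n r f'"
  using assms unfolding finite_synchronizing_map_def represents_def by auto

lemma B_bisync:
  assumes "h \<in> B n r" "n > 0" "r > 0"
  obtains k where "k > 0" "bisync n r k h (inv_into (cantor_nr n r) h)"
proof -
  let ?g = "inv_into (cantor_nr n r) h"
  have hom: "homeomorphic_map (cantor_nr_topology n r) (cantor_nr_topology n r) h"
    and fs: "finite_synchronizing_map n r h" "finite_synchronizing_map n r ?g"
    using assms(1) by (auto simp: B_def)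
  have im: "h ` cantor_nr n r = cantor_nr n r" and inj: "inj_on h (cantor_nr n r)"
    using homeomorphic_imp_surjective_map[OF hom] homeomorphic_imp_injective_map[OF hom] by auto
  have *: "ucont n r f \<and> (\<exists>k. sync n r k f)" if fs: "finite_synchronizing_map n r f" for f
  proof -
    obtain A :: "nat initial_transducer" where A: "minimal_nr n r A" "represents n r A f" "synchronizing n r A"
      using fs unfolding finite_synchronizing_map_def by blast
    then show ?thesis
      using minimal_ucont minimal_synchronizing_iff[OF A(1,2) assms(2,3)] unfolding synchronizing_def by blast
  qed
  obtain k1 k2 where "sync n r k1 h" "sync n r k2 ?g" using * fs by blast
  then have "sync n r (Suc (max k1 k2)) h" "sync n r (Suc (max k1 k2)) ?g"
    by (auto elim: sync_mono)
  moreover have "?g ` cantor_nr n r \<subseteq> cantor_nr n r"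
    using im by (metis image_subsetI inv_into_into)
  moreover have "\<forall>x\<in>cantor_nr n r. ?g (h x) = x \<and> h (?g x) = x"
    using im inj by (metis f_inv_into_f inv_into_f_f)
  ultimately have "bisync n r (Suc (max k1 k2)) h ?g"
    unfolding bisync_def using im * fs by blast
  then show thesis using that by blast
qed

lemma bisync_B:
  assumes "bisync n r k h g" "h \<in> extensional (cantor_nr n r)" "n \<ge> 2" "r > 0"
  shows "h \<in> B n r"
proof -
  note b = bisyncD[OF assms(1)]
  have im: "h ` cantor_nr n r \<subseteq> cantor_nr n r" "g ` cantor_nr n r \<subseteq> cantor_nr n r" using b by auto
  have "homeomorphic_maps (cantor_nr_topology n r) (cantor_nr_topology n r) h g"
    unfolding homeomorphic_maps_def using ucont_continuous_map im b by auto
  moreover have "finite_synchronizing_map n r h"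
    using local_maps_transducer[OF assms(3,4) im(1) b(9,5,7)] .
  moreover have "finite_synchronizing_map n r (inv_into (cantor_nr n r) h)"
  proof (rule finite_synchronizing_map_cong)
    show "finite_synchronizing_map n r g"
      using local_maps_transducer[OF assms(3,4) im(2) b(10,6,8)] .
    show "g x = inv_into (cantor_nr n r) h x" if "x \<in> cantor_nr n r" for x
      using b(2,4) that inv_into_f_f[OF b(9)] by metis
  qed
  ultimately show ?thesis
    unfolding B_def using assms(2) homeomorphic_maps_imp_map by blast
qed


section \<open>Cores\<close>

definition core_maps :: "nat \<Rightarrow> nat \<Rightarrow> nat \<Rightarrow> (letter word \<Rightarrow> letter word) \<Rightarrow> (letter word \<Rightarrow> letter word) set" where
  "core_maps n r k h = {loc n h (u @ x) | u x. u \<in> words_plus n r \<and> x \<in> lists (X n) \<and> length x = k}"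

text \<open>A long word ends in one of length \<open>k\<close>. Conversely a word of length
  \<open>k\<close> can be padded on the left by zeros, which does not change the local map by
  synchronization.\<close>

lemma core_maps_mono:
  assumes "sync n r k h" "k \<le> k'" "n > 0"
  shows "core_maps n r k h = core_maps n r k' h"
proof
  show "core_maps n r k' h \<subseteq> core_maps n r k h"
  proof
    fix p assume "p \<in> core_maps n r k' h"
    then obtain u x where u: "p = loc n h (u @ x)" "u \<in> words_plus n r" "x \<in> lists (X n)" "length x = k'"
      by (auto simp: core_maps_def)
    have "set (take (k' - k) x) \<subseteq> set x" "set (drop (k' - k) x) \<subseteq> set x"
      by (simp_all add: set_take_subset set_drop_subset)
    then have "take (k' - k) x \<in> lists (X n)" "drop (k' - k) x \<in> lists (X n)" using u(3) by auto
    moreover have "length (drop (k' - k) x) = k" using u assms by simp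
    moreover have "p = loc n h ((u @ take (k' - k) x) @ drop (k' - k) x)" using u by simp
    ultimately show "p \<in> core_maps n r k h"
      unfolding core_maps_def using u(2) words_plus_append by blast
  qed
  show "core_maps n r k h \<subseteq> core_maps n r k' h"
  proof
    fix p assume "p \<in> core_maps n r k h"
    then obtain u x where u: "p = loc n h (u @ x)" "u \<in> words_plus n r" "x \<in> lists (X n)" "length x = k"
      by (auto simp: core_maps_def)
    let ?y = "replicate (k' - k) (Plain 0)"
    have y: "?y \<in> lists (X n)" using assms(3) by auto
    then have "p = loc n h (u @ ?y @ x)"
      using syncD[OF assms(1) u(2) words_plus_append[OF u(2) y] u(3)] u by simp
    moreover have "?y @ x \<in> lists (X n)" "length (?y @ x) = k'" using y u assms(2) by auto
    ultimately show "p \<in> core_maps n r k' h"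
      unfolding core_maps_def using u(2) by blast
  qed
qed

lemma core_maps_unique:
  assumes "sync n r k h" "sync n r k' h" "n > 0"
  shows "core_maps n r k h = core_maps n r k' h"
  using assms core_maps_mono nat_le_linear by metis

lemma core_states_eq:
  assumes "minimal_nr n r A" "represents n r A h" "n > 0" "r > 0" "sync n r k h" "k > 0"
  shows "core_states n r A \<subseteq> states A - {init A}"
    and "state_map n A ` core_states n r A = core_maps n r k h"
    and "\<And>q i. q \<in> core_states n r A \<Longrightarrow> i \<in> X n \<Longrightarrow> next_state A i q \<in> core_states n r A"
proof -
  have tr: "transducer_nr n r A" using assms by (simp add: minimal_nr_def)
  \<comment> \<open>A nonempty plain word cannot be read from the initial state, so the state it is
    read from is itself reached by some \<open>u\<close>; the core is thus described by words read
    from the start.\<close>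
  have core: "core_states n r A = {read_word A (u @ x) (init A) | u x k. synchronizing_at n r k A \<and>
      u \<in> words_plus n r \<and> x \<in> lists (X n) \<and> length x = k}" (is "_ = ?R")
  proof
    show "core_states n r A \<subseteq> ?R"
    proof
      fix q assume "q \<in> core_states n r A"
      then obtain p w k where p: "q = read_word A w p" "synchronizing_at n r k A" "w \<in> lists (X n)"
          "length w = k" "p \<in> states A" "w \<in> words_from n r A p"
        unfolding core_states_def by blast
      then have "w \<noteq> []" using minimal_synchronizing_iff[OF assms(1-4), of k] by auto
      have "p \<noteq> init A"
      proof
        assume "p = init A"
        then have "w \<in> words_plus n r" using p \<open>w \<noteq> []\<close> by (simp add: words_from_def words_star_def)
        then show False using lists_words_plus_disjoint p(3) by blast
      qed
      then obtain u where "u \<in> words_plus n r" "p = read_word A u (init A)"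
        using minimal_reachable[OF assms(1)] p by (metis Diff_iff empty_iff insert_iff)
      then show "q \<in> ?R" using p by auto
    qed
    show "?R \<subseteq> core_states n r A"
    proof
      fix q assume "q \<in> ?R"
      then obtain u x k where u: "q = read_word A (u @ x) (init A)" "synchronizing_at n r k A"
          "u \<in> words_plus n r" "x \<in> lists (X n)" "length x = k" by blast
      let ?p = "read_word A u (init A)"
      have "?p \<in> states A - {init A}" using read_word_plus_states[OF tr u(3)] .
      then have "x \<in> words_from n r A ?p" "?p \<in> states A" using u by (auto simp: words_from_def)
      moreover have "q = read_word A x ?p" using u by simp
      ultimately show "q \<in> core_states n r A" unfolding core_states_def using u by blast
    qed
  qed
  have sync: "synchronizing_at n r k A \<longleftrightarrow> 0 < k \<and> sync n r k h" for k
    using minimal_synchronizing_iff[OF assms(1-4)] .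
  show "core_states n r A \<subseteq> states A - {init A}"
  proof
    fix q assume "q \<in> core_states n r A"
    then obtain u x where "q = read_word A (u @ x) (init A)" "u \<in> words_plus n r" "x \<in> lists (X n)"
      unfolding core by blast
    then show "q \<in> states A - {init A}"
      using read_word_plus_states[OF tr words_plus_append[of u n r x]] by simp
  qed
  have sm: "state_map n A (read_word A (u @ x) (init A)) = loc n h (u @ x)"
    if "u \<in> words_plus n r" "x \<in> lists (X n)" for u x
    using minimal_loc(2)[OF assms(1,2) words_plus_append[OF that] assms(3)] by simp
  show "state_map n A ` core_states n r A = core_maps n r k h"
  proof
    show "state_map n A ` core_states n r A \<subseteq> core_maps n r k h"
    proof
      fix p assume "p \<in> state_map n A ` core_states n r A"
      then obtain u x k' where u: "p = state_map n A (read_word A (u @ x) (init A))" "sync n r k' h"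
          "u \<in> words_plus n r" "x \<in> lists (X n)" "length x = k'"
        unfolding core sync by blast
      then have "p \<in> core_maps n r k' h" using sm unfolding core_maps_def by blast
      then show "p \<in> core_maps n r k h" using core_maps_unique assms u by blast
    qed
    show "core_maps n r k h \<subseteq> state_map n A ` core_states n r A"
    proof
      fix p assume "p \<in> core_maps n r k h"
      then obtain u x where u: "p = loc n h (u @ x)" "u \<in> words_plus n r" "x \<in> lists (X n)" "length x = k"
        by (auto simp: core_maps_def)
      have "read_word A (u @ x) (init A) \<in> core_states n r A"
        unfolding core sync using u assms by blast
      then show "p \<in> state_map n A ` core_states n r A" using sm u by (metis imageI)
    qed
  qed
  fix q i assume "q \<in> core_states n r A" and i: "i \<in> X n"
  then obtain u x k where u: "q = read_word A (u @ x) (init A)" "synchronizing_at n r k A"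
          "u \<in> words_plus n r" "x \<in> lists (X n)" "length x = k" unfolding core by blast
  \<comment> \<open>The first letter of \<open>x\<close> is moved to \<open>u\<close>, so that
    \<open>y @ [i]\<close> has the synchronizing length again.\<close>
  then obtain j y where x: "x = j # y" using sync by (cases x) auto
  have "next_state A i q = read_word A ((u @ [j]) @ (y @ [i])) (init A)" using u x by simp
  moreover have "u @ [j] \<in> words_plus n r" using u x by auto
  moreover have "y @ [i] \<in> lists (X n)" "length (y @ [i]) = k" using u x i by auto
  ultimately show "next_state A i q \<in> core_states n r A" unfolding core using u(2) by blast
qed

text \<open>A state is sent to the state with the same induced map. Since
  \<open>state_map_read\<close> expresses transitions and outputs by the induced map alone, they are
  carried along.\<close>

lemma core_renaming:
  assumes n: "n > 0" "r > 0" "s > 0"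
    and A: "minimal_nr n r A" "represents n r A h" "sync n r k h" "k > 0"
    and A': "minimal_nr n s A'" "represents n s A' h'" "sync n s k' h'" "k' > 0"
    and eq: "core_maps n r k h = core_maps n s k' h'"
  shows "same_up_to_renaming n (core n s A') (core n r A)"
proof -
  note c = core_states_eq[OF A(1,2) n(1,2) A(3,4)]
  note c' = core_states_eq[OF A'(1,2) n(1,3) A'(3,4)]
  have inj: "inj_on (state_map n A) (core_states n r A)"
    using state_map_inj[OF A(1)] c(1) by (rule inj_on_subset)
  have inj': "inj_on (state_map n A') (core_states n s A')"
    using state_map_inj[OF A'(1)] c'(1) by (rule inj_on_subset)
  define F where "F = inv_into (core_states n r A) (state_map n A) \<circ> state_map n A'"
  have im: "state_map n A' ` core_states n s A' = state_map n A ` core_states n r A"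
    using c(2) c'(2) eq by simp
  have "bij_betw (state_map n A') (core_states n s A') (state_map n A ` core_states n r A)"
    using inj' im by (simp add: bij_betw_def)
  moreover have "bij_betw (inv_into (core_states n r A) (state_map n A))
      (state_map n A ` core_states n r A) (core_states n r A)"
    using inj by (simp add: inj_on_imp_bij_betw bij_betw_inv_into)
  ultimately have F: "bij_betw F (core_states n s A') (core_states n r A)"
    unfolding F_def by (rule bij_betw_trans)
  have FA: "F q \<in> core_states n r A" and FM: "state_map n A (F q) = state_map n A' q"
    if "q \<in> core_states n s A'" for q
  proof -
    show "F q \<in> core_states n r A" using F that bij_betwE by blast
    show "state_map n A (F q) = state_map n A' q"
      unfolding F_def comp_def using im that by (intro f_inv_into_f) blast
  qed
  have "next_state A i (F q) = F (next_state A' i q) \<and> outp A i (F q) = outp A' i q"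
    if q: "q \<in> core_states n s A'" and i: "i \<in> X n" for q i
  proof
    have Fq: "F q \<in> states A - {init A}" and q': "q \<in> states A' - {init A'}"
      using FA[OF q] q c(1) c'(1) by auto
    have "state_map n A (next_state A i (F q)) = loc n (state_map n A (F q)) [i]"
      using state_map_read(2)[OF A(1) Fq, of "[i]"] i n by simp
    also have "\<dots> = state_map n A' (next_state A' i q)"
      using state_map_read(2)[OF A'(1) q', of "[i]"] i n FM[OF q] by simp
    also have "\<dots> = state_map n A (F (next_state A' i q))"
      using FM c'(3) q i by simp
    finally show "next_state A i (F q) = F (next_state A' i q)"
      using inj c(3) FA q c'(3) i by (auto dest: inj_onD)
    show "outp A i (F q) = outp A' i q"
      using state_map_read(1)[OF A(1) Fq, of "[i]"] state_map_read(1)[OF A'(1) q', of "[i]"] i n FM[OF q]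
      by simp
  qed
  then show ?thesis
    unfolding same_up_to_renaming_def using F by (auto simp: core_def intro!: exI[of _ F])
qed

lemma same_up_to_renaming_trans:
  assumes "same_up_to_renaming n A1 A2" "same_up_to_renaming n A2 A3"
  shows "same_up_to_renaming n A1 A3"
proof -
  obtain f g where f: "bij_betw f (states A1) (states A2)"
      "\<And>q i. q \<in> states A1 \<Longrightarrow> i \<in> X n \<Longrightarrow> next_state A2 i (f q) = f (next_state A1 i q) \<and> outp A2 i (f q) = outp A1 i q"
    and g: "bij_betw g (states A2) (states A3)"
      "\<And>q i. q \<in> states A2 \<Longrightarrow> i \<in> X n \<Longrightarrow> next_state A3 i (g q) = g (next_state A2 i q) \<and> outp A3 i (g q) = outp A2 i q"
    using assms unfolding same_up_to_renaming_def by metis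
  have "f q \<in> states A2" if "q \<in> states A1" for q using f(1) that bij_betwE by blast
  then show ?thesis
    unfolding same_up_to_renaming_def
    using f g bij_betw_trans[OF f(1) g(1)] by (intro exI[of _ "g \<circ> f"]) simp
qed

lemma Core_subset:
  assumes n: "n > 0" "r > 0" "s > 0" and "finite_synchronizing_map n s h'"
    and "sync n r k h" "k > 0" "sync n s k' h'" "k' > 0" "core_maps n r k h = core_maps n s k' h'"
  shows "Core n r h \<subseteq> Core n s h'"
proof
  fix T assume T: "T \<in> Core n r h"
  then obtain A :: "nat initial_transducer" where A: "minimal_nr n r A" "represents n r A h"
      "same_up_to_renaming n (core n r A) T" "transducer_over n T" by (auto simp: Core_def)
  obtain A' :: "nat initial_transducer" where A': "minimal_nr n s A'" "represents n s A' h'"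
    using assms(4) by (auto simp: finite_synchronizing_map_def)
  have "same_up_to_renaming n (core n s A') (core n r A)"
    using core_renaming[OF n A(1,2) assms(5,6) A' assms(7,8,9)] .
  then show "T \<in> Core n s h'"
    unfolding Core_def using A A' same_up_to_renaming_trans by blast
qed

lemma Core_cong:
  assumes "n > 0" "r > 0" "s > 0" "h \<in> B n r" "h' \<in> B n s"
    and "sync n r k h" "k > 0" "sync n s k' h'" "k' > 0" "core_maps n r k h = core_maps n s k' h'"
  shows "Core n r h = Core n s h'"
  using assms Core_subset[of n r s h' k h k'] Core_subset[of n s r h k' h' k] by (auto simp: B_def)

section \<open>The signature\<close>

text \<open>For \<open>m > 0\<close> this says that \<open>U\<close> is a union of cones of words of
  length \<open>m\<close>; the clopen sets are those having some level.\<close>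

definition level :: "nat \<Rightarrow> nat \<Rightarrow> nat \<Rightarrow> letter word set \<Rightarrow> bool" where
  "level n r m U \<longleftrightarrow> U \<subseteq> cantor_nr n r \<and>
     (\<forall>x\<in>cantor_nr n r. \<forall>y\<in>cantor_nr n r. prefix m x = prefix m y \<longrightarrow> x \<in> U \<longrightarrow> y \<in> U)"

definition cyls :: "nat \<Rightarrow> nat \<Rightarrow> nat \<Rightarrow> letter word set \<Rightarrow> letter list set" where
  "cyls n r m U = {v \<in> words_plus n r. length v = m \<and> cyl n v \<subseteq> U}"

lemma finite_cyls [simp]: "finite (cyls n r m U)"
  by (rule finite_subset[OF _ finite_words_plus_le[of n r m]]) (auto simp: cyls_def)

lemma level_mono: "level n r m U \<Longrightarrow> m \<le> m' \<Longrightarrow> level n r m' U"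
  unfolding level_def using prefix_eq_mono by blast

lemma level_cyl_iff:
  assumes "level n r m U" "v \<in> words_plus n r" "length v = m" "x \<in> cyl n v"
  shows "cyl n v \<subseteq> U \<longleftrightarrow> x \<in> U"
proof
  assume "x \<in> U"
  show "cyl n v \<subseteq> U"
  proof
    fix y assume y: "y \<in> cyl n v"
    have "x \<in> cantor_nr n r" "y \<in> cantor_nr n r" using cyl_subset[OF assms(2)] assms(4) y by auto
    moreover have "prefix m x = prefix m y" using assms(3,4) y by (simp add: mem_cyl)
    ultimately show "y \<in> U" using assms(1) \<open>x \<in> U\<close> unfolding level_def by blast
  qed
qed (use assms(4) in blast)

lemma prefix_in_cyls:
  assumes "level n r m U" "m > 0" "x \<in> U"
  shows "prefix m x \<in> cyls n r m U" "x \<in> cyl n (prefix m x)"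
proof -
  have x: "x \<in> cantor_nr n r" using assms unfolding level_def by blast
  then show "x \<in> cyl n (prefix m x)"
    using prefix_in_words_plus(2)[OF x assms(2)] by (simp add: mem_cyl)
  then show "prefix m x \<in> cyls n r m U"
    using level_cyl_iff[OF assms(1) prefix_in_words_plus(1)[OF x assms(2)]] prefix_in_words_plus(1)[OF x assms(2)] assms(3)
    by (simp add: cyls_def)
qed

lemma level_Union:
  assumes "level n r m U" "m > 0"
  shows "U = (\<Union>v\<in>cyls n r m U. cyl n v)"
proof
  show "U \<subseteq> (\<Union>v\<in>cyls n r m U. cyl n v)" using prefix_in_cyls[OF assms] by blast
qed (auto simp: cyls_def)

lemma cyl_disjoint:
  assumes "length v = length w" "v \<noteq> w"
  shows "cyl n v \<inter> cyl n w = {}"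
  using assms by (auto simp: mem_cyl)

lemma card_cyls_Suc:
  assumes "level n r m U" "m > 0" "n > 0"
  shows "card (cyls n r (Suc m) U) = card (cyls n r m U) * n"
proof -
  have "cyls n r (Suc m) U = (\<lambda>(v, i). v @ [i]) ` (cyls n r m U \<times> X n)"
  proof
    show "(\<lambda>(v, i). v @ [i]) ` (cyls n r m U \<times> X n) \<subseteq> cyls n r (Suc m) U"
    proof clarify
      fix v i assume "v \<in> cyls n r m U" "i \<in> X n"
      then show "v @ [i] \<in> cyls n r (Suc m) U"
        using cyl_append_subset[of "[i]" n v] by (auto simp: cyls_def)
    qed
    show "cyls n r (Suc m) U \<subseteq> (\<lambda>(v, i). v @ [i]) ` (cyls n r m U \<times> X n)"
    proof
      fix w assume w: "w \<in> cyls n r (Suc m) U"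
      then obtain v i where v: "w = v @ [i]" "length v = m" by (cases w rule: rev_cases) (auto simp: cyls_def)
      then have vi: "v \<in> words_plus n r" "i \<in> X n"
        using w assms(2) append_in_words_plus[of v "[i]" n r] by (auto simp: cyls_def)
      obtain x where x: "x \<in> cyl n w" using cyl_nonempty[OF assms(3)] by blast
      then have "x \<in> cyl n v" using cyl_append_subset[of "[i]" n v] v vi by auto
      moreover have "x \<in> U" using x w by (auto simp: cyls_def)
      ultimately have "v \<in> cyls n r m U"
        using level_cyl_iff[OF assms(1) vi(1) v(2)] vi v by (auto simp: cyls_def)
      then show "w \<in> (\<lambda>(v, i). v @ [i]) ` (cyls n r m U \<times> X n)" using v vi by force
    qed
  qed
  moreover have "inj_on (\<lambda>(v, i). v @ [i]) (cyls n r m U \<times> X n)" by (auto simp: inj_on_def)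
  ultimately show ?thesis by (simp add: card_image card_cartesian_product)
qed

text \<open>Passing to the next level multiplies the count by \<open>n\<close>, which is
  \<open>1\<close> modulo \<open>n - 1\<close>.\<close>

lemma card_cyls_cong:
  assumes "level n r m U" "m > 0" "n > 0" "m \<le> m'"
  shows "[card (cyls n r m' U) = card (cyls n r m U)] (mod (n - 1))"
  using assms(4)
proof (induction rule: dec_induct)
  case (step j)
  have n1: "[n = 1] (mod (n - 1))" using assms(3) by (simp add: cong_def mod_if le_mod_geq)
  have "card (cyls n r (Suc j) U) = card (cyls n r j U) * n"
    using card_cyls_Suc[of n r j U] level_mono[OF assms(1) step(1)] step assms by auto
  moreover have "[card (cyls n r j U) * n = card (cyls n r m U) * 1] (mod (n - 1))"
    using cong_mult[OF step.IH n1] .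
  ultimately show ?case by simp
qed simp

text \<open>A relation and not a function: \<open>c\<close> matters only modulo
  \<open>n - 1\<close>, and no level of \<open>U\<close> is singled out.\<close>

definition has_sig :: "nat \<Rightarrow> nat \<Rightarrow> letter word set \<Rightarrow> nat \<Rightarrow> bool" where
  "has_sig n r U c \<longleftrightarrow> (\<exists>m>0. level n r m U \<and> [card (cyls n r m U) = c] (mod (n - 1)))"

lemma has_sig_level:
  assumes "has_sig n r U c" "level n r m U" "m > 0" "n > 0"
  shows "[card (cyls n r m U) = c] (mod (n - 1))"
proof -
  obtain m0 where m0: "m0 > 0" "level n r m0 U" "[card (cyls n r m0 U) = c] (mod (n - 1))"
    using assms(1) unfolding has_sig_def by blast
  have "[card (cyls n r (max m m0) U) = card (cyls n r m0 U)] (mod (n - 1))"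
    "[card (cyls n r (max m m0) U) = card (cyls n r m U)] (mod (n - 1))"
    using card_cyls_cong[OF m0(2,1) assms(4)] card_cyls_cong[OF assms(2,3,4)] by auto
  then show ?thesis using m0(3) by (meson cong_sym cong_trans)
qed

lemma has_sig_unique:
  assumes "has_sig n r U c" "has_sig n r U d" "n > 0"
  shows "[c = d] (mod (n - 1))"
proof -
  obtain m where m: "m > 0" "level n r m U" "[card (cyls n r m U) = c] (mod (n - 1))"
    using assms(1) unfolding has_sig_def by blast
  then show ?thesis using has_sig_level[OF assms(2) m(2,1) assms(3)] by (meson cong_sym cong_trans)
qed

lemma has_sig_empty: "has_sig n r {} 0" if "n > 0"
proof -
  have "cyls n r 1 {} = {}" using cyl_nonempty[OF that] by (auto simp: cyls_def)
  then show ?thesis unfolding has_sig_def level_def by (intro exI[of _ 1]) auto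
qed

lemma has_sig_Un:
  assumes "has_sig n r U c" "has_sig n r V d" "U \<inter> V = {}" "n > 0"
  shows "has_sig n r (U \<union> V) (c + d)"
proof -
  obtain a b where a: "a > 0" "level n r a U" and b: "b > 0" "level n r b V"
    using assms(1,2) unfolding has_sig_def by blast
  define m where "m = max a b"
  have U: "level n r m U" and V: "level n r m V" and m: "m > 0"
    using a b level_mono by (auto simp: m_def)
  have UV: "level n r m (U \<union> V)" using U V unfolding level_def by blast
  have "cyls n r m (U \<union> V) = cyls n r m U \<union> cyls n r m V"
  proof
    show "cyls n r m (U \<union> V) \<subseteq> cyls n r m U \<union> cyls n r m V"
    proof
      fix v assume v: "v \<in> cyls n r m (U \<union> V)"
      obtain x where x: "x \<in> cyl n v" using cyl_nonempty[OF assms(4)] by blast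
      then show "v \<in> cyls n r m U \<union> cyls n r m V"
        using v level_cyl_iff[OF U _ _ x] level_cyl_iff[OF V _ _ x] by (auto simp: cyls_def)
    qed
  qed (auto simp: cyls_def)
  moreover have "cyls n r m U \<inter> cyls n r m V = {}"
    using cyl_nonempty[OF assms(4)] assms(3) by (fastforce simp: cyls_def)
  ultimately have "card (cyls n r m (U \<union> V)) = card (cyls n r m U) + card (cyls n r m V)"
    by (simp add: card_Un_disjoint)
  moreover have "[card (cyls n r m U) + card (cyls n r m V) = c + d] (mod (n - 1))"
    using has_sig_level[OF assms(1) U m assms(4)] has_sig_level[OF assms(2) V m assms(4)] by (rule cong_add)
  ultimately show ?thesis unfolding has_sig_def using UV m by metis
qed

lemma has_sig_UN:
  assumes "finite I" "\<And>i. i \<in> I \<Longrightarrow> has_sig n r (U i) (c i)"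
    "\<And>i j. i \<in> I \<Longrightarrow> j \<in> I \<Longrightarrow> i \<noteq> j \<Longrightarrow> U i \<inter> U j = {}" "n > 0"
  shows "has_sig n r (\<Union>i\<in>I. U i) (\<Sum>i\<in>I. c i)"
  using assms(1-3)
proof (induction I)
  case (insert i I)
  have "U i \<inter> (\<Union>i\<in>I. U i) = {}" using insert.hyps insert.prems(2)[of i] by fastforce
  then show ?case using has_sig_Un[of n r "U i" "c i"] insert assms(4) by simp
qed (simp add: has_sig_empty assms(4))

lemma level_cyl: "u \<in> words_plus n r \<Longrightarrow> level n r (length u) (cyl n u)"
  unfolding level_def using cyl_subset mem_cyl_nr words_plus_nonempty by metis

lemma has_sig_cyl:
  assumes "u \<in> words_plus n r" "n > 0"
  shows "has_sig n r (cyl n u) 1"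
proof -
  have "cyls n r (length u) (cyl n u) = {u}"
    using assms cyl_disjoint[of _ u n] cyl_nonempty[OF assms(2)] by (fastforce simp: cyls_def)
  then show ?thesis unfolding has_sig_def
    using level_cyl[OF assms(1)] words_plus_nonempty[OF assms(1)] by (intro exI[of _ "length u"]) auto
qed

lemma card_cyls_conc:
  assumes "p \<in> words_plus n r" "E \<subseteq> cantor n" "n > 0"
  shows "card (cyls n r (length p + a) ((\<lambda>x. p \<frown> x) ` E)) = card {w \<in> lists (X n). length w = a \<and> cyl n w \<subseteq> E}"
proof -
  have p0: "p \<noteq> []" using assms(1) by auto
  have "cyls n r (length p + a) ((\<lambda>x. p \<frown> x) ` E) = (@) p ` {w \<in> lists (X n). length w = a \<and> cyl n w \<subseteq> E}"
  proof
    show "cyls n r (length p + a) ((\<lambda>x. p \<frown> x) ` E) \<subseteq> (@) p ` {w \<in> lists (X n). length w = a \<and> cyl n w \<subseteq> E}"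
    proof
      fix v assume v: "v \<in> cyls n r (length p + a) ((\<lambda>x. p \<frown> x) ` E)"
      obtain x where x: "x \<in> cantor n" using cyl_nonempty[OF assms(3), of "[]"] by auto
      obtain w where w: "v = p @ w" "length w = a"
      proof
        have "v \<frown> x \<in> (\<lambda>x. p \<frown> x) ` E" using v x by (auto simp: cyls_def)
        then obtain y where "v \<frown> x = p \<frown> y" by blast
        then have "prefix (length p) (v \<frown> x) = p" by simp
        then have "take (length p) v = p" using v by (simp add: cyls_def)
        then show "v = p @ drop (length p) v" by (metis append_take_drop_id)
        show "length (drop (length p) v) = a" using v by (simp add: cyls_def)
      qed
      have "w \<in> lists (X n)" using v w append_in_words_plus[OF p0] by (auto simp: cyls_def)
      moreover have "cyl n w \<subseteq> E"
      proof
        fix y assume "y \<in> cyl n w"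
        then have "p \<frown> y \<in> cyl n v" using w by (simp add: cyl_append_image)
        then have "p \<frown> y \<in> (\<lambda>x. p \<frown> x) ` E" using v by (auto simp: cyls_def)
        then show "y \<in> E" by auto
      qed
      ultimately show "v \<in> (@) p ` {w \<in> lists (X n). length w = a \<and> cyl n w \<subseteq> E}" using w by blast
    qed
    show "(@) p ` {w \<in> lists (X n). length w = a \<and> cyl n w \<subseteq> E} \<subseteq> cyls n r (length p + a) ((\<lambda>x. p \<frown> x) ` E)"
      using assms(1) by (auto simp: cyls_def cyl_append_image intro!: imageI)
  qed
  then show ?thesis by (simp add: card_image inj_on_def)
qed

text \<open>At a fixed depth below the prefix the count depends on \<open>E\<close> only. Adding
  \<open>m + m0\<close> to both prefix lengths reaches a level for both sets at equal depth.\<close>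

lemma has_sig_shift:
  assumes "p \<in> words_plus n r" "q \<in> words_plus n r" "E \<subseteq> cantor n" "n > 0"
    "has_sig n r ((\<lambda>x. p \<frown> x) ` E) c" "level n r m ((\<lambda>x. q \<frown> x) ` E)"
  shows "has_sig n r ((\<lambda>x. q \<frown> x) ` E) c"
proof -
  let ?U = "(\<lambda>x. p \<frown> x) ` E" and ?V = "(\<lambda>x. q \<frown> x) ` E"
  obtain m0 where m0: "level n r m0 ?U" using assms(5) unfolding has_sig_def by blast
  have U: "level n r (length p + (m + m0)) ?U" and V: "level n r (length q + (m + m0)) ?V"
    using level_mono[OF m0] level_mono[OF assms(6)] by auto
  have pos: "length p + (m + m0) > 0" "length q + (m + m0) > 0"
    using words_plus_nonempty[OF assms(1)] words_plus_nonempty[OF assms(2)] by auto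
  have "card (cyls n r (length p + (m + m0)) ?U) = card (cyls n r (length q + (m + m0)) ?V)"
    using card_cyls_conc[OF assms(1,3,4)] card_cyls_conc[OF assms(2,3,4)] by simp
  then have "[card (cyls n r (length q + (m + m0)) ?V) = c] (mod (n - 1))"
    using has_sig_level[OF assms(5) U pos(1) assms(4)] by simp
  then show ?thesis unfolding has_sig_def using V pos(2) by metis
qed

text \<open>A point \<open>x\<close> lies in the image iff \<open>g x\<close> starts with
  \<open>u\<close>, and by uniform continuity of \<open>g\<close> a bounded prefix of
  \<open>x\<close> decides this.\<close>

lemma image_level:
  assumes "bisync n r k h g" "u \<in> words_plus n r"
  shows "\<exists>m>0. level n r m (h ` cyl n u)"
proof -
  note b = bisyncD[OF assms(1)]
  have u0: "u \<noteq> []" using assms(2) by auto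
  obtain K where K: "\<And>x y. x \<in> cantor_nr n r \<Longrightarrow> y \<in> cantor_nr n r \<Longrightarrow> prefix K x = prefix K y \<Longrightarrow>
      prefix (length u) (g x) = prefix (length u) (g y)"
    using b(6) unfolding ucont_def by metis
  have mem: "x \<in> h ` cyl n u \<longleftrightarrow> prefix (length u) (g x) = u" if x: "x \<in> cantor_nr n r" for x
  proof -
    have "x \<in> h ` cyl n u \<longleftrightarrow> g x \<in> cyl n u"
      using b(3,4) x cyl_subset[OF assms(2)] by (metis image_iff subsetD)
    then show ?thesis using mem_cyl_nr[OF b(2)[OF x] u0] by simp
  qed
  have "level n r K (h ` cyl n u)"
    unfolding level_def
  proof (intro conjI ballI impI)
    show "h ` cyl n u \<subseteq> cantor_nr n r" using b(1) cyl_subset[OF assms(2)] by blast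
    fix x y assume *: "x \<in> cantor_nr n r" "y \<in> cantor_nr n r" "prefix K x = prefix K y" "x \<in> h ` cyl n u"
    then show "y \<in> h ` cyl n u" using K[OF *(1-3)] mem by metis
  qed
  then have "level n r (Suc K) (h ` cyl n u)" by (rule level_mono) simp
  then show ?thesis by blast
qed

lemma image_cyl_loc:
  assumes "separating n f u"
  shows "f ` cyl n u = (\<lambda>x. lcp_at n f u \<frown> x) ` (loc n f u ` cantor n)"
  unfolding cyl_def image_image by (intro image_cong refl lcp_at_loc[OF assms])

lemma lcp_at_words_plus:
  assumes "f ` cantor_nr n r \<subseteq> cantor_nr n r" "separating n f u" "u \<in> words_plus n r" "lcp_at n f u \<noteq> []" "n > 0"
  shows "lcp_at n f u \<in> words_plus n r" "loc n f u ` cantor n \<subseteq> cantor n"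
proof -
  have *: "lcp_at n f u \<in> words_plus n r \<and> loc n f u d \<in> cantor n" if d: "d \<in> cantor n" for d
  proof -
    have "u \<frown> d \<in> cantor_nr n r" using assms(3) d by blast
    then have "lcp_at n f u \<frown> loc n f u d \<in> cantor_nr n r" using assms(1) lcp_at_loc[OF assms(2) d] by auto
    then show ?thesis using conc_in_cantor_nr[OF assms(4)] by blast
  qed
  then show "loc n f u ` cantor n \<subseteq> cantor n" by blast
  obtain d where "d \<in> cantor n" using cyl_nonempty[OF assms(5), of "[]"] by auto
  then show "lcp_at n f u \<in> words_plus n r" using * by blast
qed

lemma cyl_split: "cyl n u = (\<Union>x\<in>{x \<in> lists (X n). length x = k}. cyl n (u @ x))"
proof
  show "cyl n u \<subseteq> (\<Union>x\<in>{x \<in> lists (X n). length x = k}. cyl n (u @ x))"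
  proof
    fix y assume "y \<in> cyl n u"
    then obtain d where d: "y = u \<frown> d" "d \<in> cantor n" by (auto simp: cyl_def)
    then have "y = (u @ prefix k d) \<frown> suffix k d" by (simp flip: conc_conc)
    moreover have "suffix k d \<in> cantor n" "prefix k d \<in> lists (X n)"
      using d suffix_in_cantor prefix_in_lists by auto
    ultimately show "y \<in> (\<Union>x\<in>{x \<in> lists (X n). length x = k}. cyl n (u @ x))"
      by (intro UN_I[of "prefix k d"]) auto
  qed
qed (use cyl_append_subset in auto)

text \<open>
  The signature of \<open>h(u C)\<close> is a sum over the extensions \<open>u x\<close> with \<open>x\<close> of synchronizing length,
  and the summand of \<open>x\<close> does not depend on \<open>u\<close>.
\<close>

lemma signature_constant:
  assumes "bisync n r k h g" "n \<ge> 2" "r > 0"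
  shows "\<exists>c. \<forall>u\<in>words_plus n r. has_sig n r (h ` cyl n u) c"
proof -
  note b = bisyncD[OF assms(1)]
  have n: "n > 0" using assms(2) by simp
  have im: "h ` cantor_nr n r \<subseteq> cantor_nr n r" using b(1) by blast
  obtain K where K: "\<And>u. u \<in> words_plus n r \<Longrightarrow> K \<le> length u \<Longrightarrow> 1 \<le> length (lcp_at n h u)"
    using lcp_at_long[OF b(5,9) assms(2)] by metis
  \<comment> \<open>Length \<open>k\<close> is needed for synchronization. Length \<open>K\<close>
    ensures that output has begun, so that the image of the cone is a dotted word followed by a
    subset of \<open>cantor n\<close> and \<open>has_sig_shift\<close> applies.\<close>
  define l where "l = max k K"
  define W where "W = {x \<in> lists (X n). length x = l}"
  have d0: "[Dotted 0] \<in> words_plus n r" using assms(3) by simp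
  have "\<exists>c. has_sig n r (h ` cyl n ([Dotted 0] @ x)) c" if x: "x \<in> W" for x
  proof -
    have "[Dotted 0] @ x \<in> words_plus n r" using x d0 words_plus_append unfolding W_def by blast
    then obtain m where "m > 0" "level n r m (h ` cyl n ([Dotted 0] @ x))" using image_level[OF assms(1)] by blast
    then show ?thesis unfolding has_sig_def by (meson cong_refl)
  qed
  then obtain c where c: "\<And>x. x \<in> W \<Longrightarrow> has_sig n r (h ` cyl n ([Dotted 0] @ x)) (c x)" by metis
  have cu: "has_sig n r (h ` cyl n (u @ x)) (c x)" if u: "u \<in> words_plus n r" and x: "x \<in> W" for u x
  proof -
    let ?v = "[Dotted 0] @ x" and ?w = "u @ x"
    have xl: "x \<in> lists (X n)" "length x = l" using x by (auto simp: W_def)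
    have v: "?v \<in> words_plus n r" and w: "?w \<in> words_plus n r" using d0 u xl(1) words_plus_append by blast+
    note sv = inj_separating[OF b(9) assms(2) v] and sw = inj_separating[OF b(9) assms(2) w]
    have "K \<le> l" by (simp add: l_def)
    then have "lcp_at n h ?v \<noteq> []" "lcp_at n h ?w \<noteq> []" using K[OF v] K[OF w] xl by fastforce+
    note lv = lcp_at_words_plus[OF im sv v this(1) n] and lw = lcp_at_words_plus[OF im sw w this(2) n]
    have eq: "loc n h ?v = loc n h ?w" using syncD[OF b(7) d0 u xl(1)] xl by (simp add: l_def)
    obtain m where "level n r m (h ` cyl n ?w)" using image_level[OF assms(1) w] by blast
    then show ?thesis
      using has_sig_shift[OF lv(1) lw(1) lv(2) n, of "c x" m] c[OF x]
      unfolding image_cyl_loc[OF sv] image_cyl_loc[OF sw] eq by blast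
  qed
  have "has_sig n r (h ` cyl n u) (\<Sum>x\<in>W. c x)" if u: "u \<in> words_plus n r" for u
  proof -
    have "finite {x. set x \<subseteq> X n \<and> length x = l}" by (rule finite_lists_length_eq) simp
    moreover have "W = {x. set x \<subseteq> X n \<and> length x = l}" by (auto simp: W_def)
    ultimately have finW: "finite W" by simp
    have "has_sig n r (\<Union>x\<in>W. h ` cyl n (u @ x)) (\<Sum>x\<in>W. c x)"
    proof (rule has_sig_UN[OF finW cu[OF u] _ n])
      fix x y assume xy: "x \<in> W" "y \<in> W" "x \<noteq> y"
      have "u @ x \<in> words_plus n r" "u @ y \<in> words_plus n r"
        using u xy words_plus_append unfolding W_def by blast+
      then have "h ` cyl n (u @ x) \<inter> h ` cyl n (u @ y) = h ` (cyl n (u @ x) \<inter> cyl n (u @ y))"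
        using inj_on_image_Int[OF b(9)] cyl_subset by metis
      moreover have "cyl n (u @ x) \<inter> cyl n (u @ y) = {}"
        using xy by (intro cyl_disjoint) (auto simp: W_def)
      ultimately show "h ` cyl n (u @ x) \<inter> h ` cyl n (u @ y) = {}" by simp
    qed
    moreover have "h ` cyl n u = (\<Union>x\<in>W. h ` cyl n (u @ x))"
      by (subst cyl_split[of n u l]) (auto simp: W_def)
    ultimately show ?thesis by simp
  qed
  then show ?thesis by blast
qed

text \<open>The image of a cone consists of \<open>card V\<close> cones, and \<open>g\<close> maps
  them onto a partition of the original cone into pieces of signature \<open>d\<close>. Hence
  \<open>card V * d\<close> is congruent to \<open>1\<close>, while \<open>card V\<close> is
  congruent to \<open>c\<close>.\<close>

lemma signature_unit:
  assumes "bisync n r k h g" "n \<ge> 2" "r > 0"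
  obtains c d where "\<And>u. u \<in> words_plus n r \<Longrightarrow> has_sig n r (h ` cyl n u) c" "[c * d = 1] (mod (n - 1))"
proof -
  note b = bisyncD[OF assms(1)]
  have n: "n > 0" using assms(2) by simp
  obtain c where c: "\<And>u. u \<in> words_plus n r \<Longrightarrow> has_sig n r (h ` cyl n u) c"
    using signature_constant[OF assms] by blast
  obtain d where d: "\<And>u. u \<in> words_plus n r \<Longrightarrow> has_sig n r (g ` cyl n u) d"
    using signature_constant[OF bisync_sym[OF assms(1)] assms(2,3)] by blast
  let ?u = "[Dotted 0]"
  have u: "?u \<in> words_plus n r" using assms(3) by simp
  obtain m where m: "m > 0" "level n r m (h ` cyl n ?u)" using image_level[OF assms(1) u] by blast
  define V where "V = cyls n r m (h ` cyl n ?u)"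
  have finV: "finite V" by (simp add: V_def)
  have V: "v \<in> words_plus n r" "length v = m" if "v \<in> V" for v using that by (auto simp: V_def cyls_def)
  have hu: "h ` cyl n ?u = (\<Union>v\<in>V. cyl n v)" using level_Union[OF m(2,1)] by (simp add: V_def)
  have "cyl n ?u = g ` h ` cyl n ?u"
    using b(3) cyl_subset[OF u] by (force simp: image_image)
  also have "\<dots> = (\<Union>v\<in>V. g ` cyl n v)" unfolding hu by blast
  finally have uV: "cyl n ?u = (\<Union>v\<in>V. g ` cyl n v)" .
  have "has_sig n r (\<Union>v\<in>V. g ` cyl n v) (\<Sum>v\<in>V. d)"
  proof (rule has_sig_UN[OF finV d[OF V(1)] _ n])
    fix v w assume vw: "v \<in> V" "w \<in> V" "v \<noteq> w"
    have "g ` cyl n v \<inter> g ` cyl n w = g ` (cyl n v \<inter> cyl n w)"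
      using inj_on_image_Int[OF b(10)] cyl_subset V vw by metis
    moreover have "cyl n v \<inter> cyl n w = {}" using vw V by (intro cyl_disjoint) auto
    ultimately show "g ` cyl n v \<inter> g ` cyl n w = {}" by simp
  qed
  then have "[card V * d = 1] (mod (n - 1))"
    using has_sig_unique[OF _ has_sig_cyl[OF u n] n] uV by simp
  moreover have "[card V = c] (mod (n - 1))"
    using has_sig_level[OF c[OF u] m(2,1) n] by (simp add: V_def)
  then have "[card V * d = c * d] (mod (n - 1))" by (rule cong_scalar_right)
  ultimately have "[c * d = 1] (mod (n - 1))" by (meson cong_sym cong_trans)
  then show thesis using that c by blast
qed

section \<open>Ordered complete prefix codes\<close>

text \<open>The code that arises from the empty word by splitting the last word \<open>t\<close>
  times. Its words have the indices \<open>0\<close> to \<open>t * (n - 1)\<close>, in lexicographic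
  order.\<close>

primrec code :: "nat \<Rightarrow> nat \<Rightarrow> nat \<Rightarrow> letter list" where
  "code n 0 j = []"
| "code n (Suc t) j = (if j < n - 1 then [Plain j] else Plain (n - 1) # code n t (j - (n - 1)))"

lemma code_lists: "n \<ge> 2 \<Longrightarrow> code n t j \<in> lists (X n)"
  by (induction t arbitrary: j) auto

lemma length_code: "length (code n t j) \<le> t"
  by (induction t arbitrary: j) auto

lemma code_cover:
  assumes "n \<ge> 2" "d \<in> cantor n"
  shows "\<exists>j\<le>t * (n - 1). \<exists>e\<in>cantor n. d = code n t j \<frown> e"
  using assms(2)
proof (induction t arbitrary: d)
  case 0
  then show ?case by auto
next
  case (Suc t)
  have "d 0 \<in> X n" using Suc.prems by (auto simp: cantor_def)
  then obtain i where i: "d 0 = Plain i" "i < n" by (auto simp: X_def)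
  have d: "d = [Plain i] \<frown> suffix 1 d" using i build_first[of d] by (simp add: build_conc)
  have s: "suffix 1 d \<in> cantor n" using Suc.prems by (rule suffix_in_cantor)
  show ?case
  proof (cases "i < n - 1")
    case True
    then have "d = code n (Suc t) i \<frown> suffix 1 d" using d by simp
    then show ?thesis using s True by (intro exI[of _ i]) auto
  next
    case False
    then have i': "i = n - 1" using i by simp
    obtain j e where j: "j \<le> t * (n - 1)" "e \<in> cantor n" "suffix 1 d = code n t j \<frown> e"
      using Suc.IH[OF s] by blast
    then have "d = code n (Suc t) (n - 1 + j) \<frown> e" using d i' by simp
    then show ?thesis using j by (intro exI[of _ "n - 1 + j"]) auto
  qed
qed

lemma code_unique:
  assumes "code n t i \<frown> x = code n t j \<frown> y" "i \<le> t * (n - 1)" "j \<le> t * (n - 1)"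
  shows "i = j"
  using assms
proof (induction t arbitrary: i j)
  case (Suc t)
  have "(code n (Suc t) i \<frown> x) 0 = (code n (Suc t) j \<frown> y) 0" using Suc.prems by simp
  then consider "i < n - 1" "i = j" | "\<not> i < n - 1" "\<not> j < n - 1"
    by (auto simp: conc_def split: if_splits)
  then show ?case
  proof cases
    case 2
    then have "[Plain (n - 1)] \<frown> (code n t (i - (n - 1)) \<frown> x) = [Plain (n - 1)] \<frown> (code n t (j - (n - 1)) \<frown> y)"
      using Suc.prems(1) by simp
    then have "code n t (i - (n - 1)) \<frown> x = code n t (j - (n - 1)) \<frown> y" by (simp only: same_concat_eq)
    then have "i - (n - 1) = j - (n - 1)" using Suc.IH Suc.prems(2,3) by auto
    then show ?thesis using 2 by simp
  qed
qed simp

lemma const_conc: "[a] \<frown> (\<lambda>_. a) = (\<lambda>_. a)"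
  by (auto simp: conc_def)

lemma code_first: "n \<ge> 2 \<Longrightarrow> code n t 0 \<frown> (\<lambda>_. Plain 0) = (\<lambda>_. Plain 0)"
  by (cases t) (auto simp: const_conc)

lemma code_last: "code n t (t * (n - 1)) \<frown> (\<lambda>_. Plain (n - 1)) = (\<lambda>_. Plain (n - 1))"
proof (induction t)
  case (Suc t)
  have "code n (Suc t) (Suc t * (n - 1)) \<frown> (\<lambda>_. Plain (n - 1))
      = [Plain (n - 1)] \<frown> (code n t (t * (n - 1)) \<frown> (\<lambda>_. Plain (n - 1)))"
    by simp
  then show ?case unfolding Suc.IH const_conc .
qed simp

text \<open>The last point of a code cone and the first point of the next one form a pair of
  \<simeq>. This makes an order-preserving exchange of cones respect \<simeq>.\<close>

lemma code_adjacent: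
  assumes "n \<ge> 2" "j < t * (n - 1)"
  shows "\<exists>w\<in>lists (X n). \<exists>i>0. i \<le> n - 1 \<and>
    code n t (Suc j) \<frown> (\<lambda>_. Plain 0) = (w @ [Plain i]) \<frown> (\<lambda>_. Plain 0) \<and>
    code n t j \<frown> (\<lambda>_. Plain (n - 1)) = (w @ [Plain (i - 1)]) \<frown> (\<lambda>_. Plain (n - 1))"
  using assms(2)
proof (induction t arbitrary: j)
  case (Suc t)
  consider "Suc j < n - 1" | "Suc j = n - 1" | "j \<ge> n - 1" by linarith
  then show ?case
  proof cases
    case 1
    then show ?thesis by (intro bexI[of _ "[]"] exI[of _ "Suc j"]) auto
  next
    case 2
    \<comment> \<open>The junction between the letter \<open>n - 2\<close> and the block below
      \<open>n - 1\<close>; the first point of that block is \<open>n - 1\<close> followed by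
      zeros.\<close>
    have "code n (Suc t) (Suc j) \<frown> (\<lambda>_. Plain 0) = [Plain (n - 1)] \<frown> (code n t 0 \<frown> (\<lambda>_. Plain 0))"
      using 2 by simp
    then have "code n (Suc t) (Suc j) \<frown> (\<lambda>_. Plain 0) = [Plain (n - 1)] \<frown> (\<lambda>_. Plain 0)"
      unfolding code_first[OF assms(1)] .
    then show ?thesis using 2 assms(1)
      by (intro bexI[of _ "[]"] exI[of _ "n - 1"]) (auto simp flip: 2)
  next
    case 3
    then have "j - (n - 1) < t * (n - 1)" using Suc.prems by auto
    then obtain w i where w: "w \<in> lists (X n)" "i > 0" "i \<le> n - 1"
      "code n t (Suc (j - (n - 1))) \<frown> (\<lambda>_. Plain 0) = (w @ [Plain i]) \<frown> (\<lambda>_. Plain 0)"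
      "code n t (j - (n - 1)) \<frown> (\<lambda>_. Plain (n - 1)) = (w @ [Plain (i - 1)]) \<frown> (\<lambda>_. Plain (n - 1))"
      using Suc.IH by blast
    have "code n (Suc t) (Suc j) = [Plain (n - 1)] @ code n t (Suc (j - (n - 1)))"
      "code n (Suc t) j = [Plain (n - 1)] @ code n t (j - (n - 1))"
      using 3 by (auto simp: Suc_diff_le)
    then have "code n (Suc t) (Suc j) \<frown> (\<lambda>_. Plain 0) = ((Plain (n - 1) # w) @ [Plain i]) \<frown> (\<lambda>_. Plain 0)"
      "code n (Suc t) j \<frown> (\<lambda>_. Plain (n - 1)) = ((Plain (n - 1) # w) @ [Plain (i - 1)]) \<frown> (\<lambda>_. Plain (n - 1))"
      using w(4,5) by (metis append_Cons append_Nil conc_conc)+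
    then show ?thesis using w assms(1) by (intro bexI[of _ "Plain (n - 1) # w"] exI[of _ i]) auto
  qed
qed simp


section \<open>Transplanting a homeomorphism\<close>

text \<open>
  The map \<open>H\<close> acts on each of the \<open>s\<close> cones of first letters as \<open>h\<close> acts on \<open>u C\<close>, with the cones
  \<open>v j\<close> of level \<open>m\<close> making up the image \<open>h(u C)\<close> replaced by the cones of a complete prefix code.
\<close>

locale transplant =
  fixes n r s k :: nat and h g :: "letter word \<Rightarrow> letter word" and u :: "letter list"
    and m t :: nat and v :: "nat \<Rightarrow> letter list" and \<rho> :: "nat \<Rightarrow> nat"
  assumes n: "n \<ge> 2" and r: "r > 0" and s: "s > 0" and bis: "bisync n r k h g"
    and u: "u \<in> words_plus n r" and m: "m > 0" and lev: "level n r m (h ` cyl n u)"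
    and v: "bij_betw v {..t * (n - 1)} (cyls n r m (h ` cyl n u))"
    and rho: "bij_betw \<rho> {..<s} {..<s}"
begin

lemmas b = bisyncD[OF bis]

lemma v_props:
  assumes "j \<le> t * (n - 1)"
  shows "v j \<in> words_plus n r" "length (v j) = m" "cyl n (v j) \<subseteq> h ` cyl n u"
  using bij_betwE[OF v] assms by (auto simp: cyls_def)

lemma v_inj: "i \<le> t * (n - 1) \<Longrightarrow> j \<le> t * (n - 1) \<Longrightarrow> v i = v j \<Longrightarrow> i = j"
  using bij_betw_imp_inj_on[OF v] by (auto dest: inj_onD)

definition idx :: "letter word \<Rightarrow> nat" where
  "idx y = inv_into {..t * (n - 1)} v (prefix m y)"

text \<open>For \<open>x = [Dotted a] \<frown> d\<close> and
  \<open>h (u \<frown> d) = v j \<frown> e\<close> the value is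
  \<open>[Dotted (\<rho> a)] \<frown> code n t j \<frown> e\<close>. The restriction provides the
  extensionality demanded by \<open>B\<close>.\<close>

definition H :: "letter word \<Rightarrow> letter word" where
  "H = restrict (\<lambda>x. [Dotted (\<rho> (THE a. x 0 = Dotted a))] \<frown> code n t (idx (h (u \<frown> suffix 1 x)))
     \<frown> suffix m (h (u \<frown> suffix 1 x))) (cantor_nr n s)"

definition G :: "letter word \<Rightarrow> letter word" where
  "G = inv_into (cantor_nr n s) H"

lemma h_split:
  assumes "d \<in> cantor n"
  obtains j e where "j \<le> t * (n - 1)" "e \<in> cantor n" "h (u \<frown> d) = v j \<frown> e"
proof -
  have y: "h (u \<frown> d) \<in> h ` cyl n u" using assms by simp
  have "prefix m (h (u \<frown> d)) \<in> cyls n r m (h ` cyl n u)" using prefix_in_cyls(1)[OF lev m y] .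
  then obtain j where j: "j \<le> t * (n - 1)" "v j = prefix m (h (u \<frown> d))"
    using bij_betw_imp_surj_on[OF v] by (metis (no_types, lifting) atMost_iff imageE)
  have "h (u \<frown> d) \<in> cantor_nr n r" using b(1) u assms by blast
  then have "suffix m (h (u \<frown> d)) \<in> cantor n" using prefix_in_words_plus(2) m by blast
  then show thesis using that[OF j(1), of "suffix m (h (u \<frown> d))"] j(2) by simp
qed

lemma v_split:
  assumes "j \<le> t * (n - 1)" "e \<in> cantor n"
  obtains d where "d \<in> cantor n" "h (u \<frown> d) = v j \<frown> e" "g (v j \<frown> e) = u \<frown> d"
proof -
  have "v j \<frown> e \<in> h ` cyl n u" using v_props(3)[OF assms(1)] assms(2) by auto
  then obtain d where d: "d \<in> cantor n" "h (u \<frown> d) = v j \<frown> e" by (auto simp: cyl_def)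
  then have "g (v j \<frown> e) = u \<frown> d" using b(3)[OF conc_in_cantor_nrI[OF u d(1)]] by simp
  then show thesis using that d by blast
qed

lemma H_eq:
  assumes "a < s" "d \<in> cantor n" "j \<le> t * (n - 1)" "h (u \<frown> d) = v j \<frown> e"
  shows "H ([Dotted a] \<frown> d) = [Dotted (\<rho> a)] \<frown> code n t j \<frown> e"
proof -
  have "prefix m (h (u \<frown> d)) = v j" "suffix m (h (u \<frown> d)) = e"
    using assms(4) v_props(2)[OF assms(3)] by auto
  then have "idx (h (u \<frown> d)) = j"
    unfolding idx_def using bij_betw_imp_inj_on[OF v] assms(3) by simp
  moreover have "[Dotted a] \<frown> d \<in> cantor_nr n s" using assms by auto
  ultimately show ?thesis
    using \<open>suffix m (h (u \<frown> d)) = e\<close> by (simp add: H_def)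
qed

lemma H_cases:
  assumes "x \<in> cantor_nr n s"
  obtains a d j e where "a < s" "d \<in> cantor n" "j \<le> t * (n - 1)" "e \<in> cantor n" "h (u \<frown> d) = v j \<frown> e"
    "x = [Dotted a] \<frown> d" "H x = [Dotted (\<rho> a)] \<frown> code n t j \<frown> e" "\<rho> a < s"
proof -
  obtain a d where d: "x = [Dotted a] \<frown> d" "a < s" "d \<in> cantor n" using assms by (rule cantor_nr_cases)
  obtain j e where "j \<le> t * (n - 1)" "e \<in> cantor n" "h (u \<frown> d) = v j \<frown> e" using h_split[OF d(3)] by blast
  moreover have "\<rho> a < s" using bij_betwE[OF rho] d by auto
  ultimately show thesis using that d H_eq by blast
qed

lemma H_image: "H ` cantor_nr n s = cantor_nr n s"
proof
  show "H ` cantor_nr n s \<subseteq> cantor_nr n s"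
  proof clarify
    fix x assume "x \<in> cantor_nr n s"
    then obtain a d j e where *: "e \<in> cantor n" "H x = [Dotted (\<rho> a)] \<frown> code n t j \<frown> e" "\<rho> a < s"
      by (rule H_cases)
    have "[Dotted (\<rho> a)] @ code n t j \<in> words_plus n s" using * code_lists[OF n] by simp
    then show "H x \<in> cantor_nr n s" using * by (metis conc_conc conc_in_cantor_nrI)
  qed
  show "cantor_nr n s \<subseteq> H ` cantor_nr n s"
  proof
    fix z assume "z \<in> cantor_nr n s"
    then obtain c y where y: "z = [Dotted c] \<frown> y" "c < s" "y \<in> cantor n" by (rule cantor_nr_cases)
    obtain a where a: "a < s" "\<rho> a = c" using rho y(2) unfolding bij_betw_def by (metis imageE lessThan_iff)
    obtain j e where j: "j \<le> t * (n - 1)" "e \<in> cantor n" "y = code n t j \<frown> e"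
      using code_cover[OF n y(3)] by blast
    obtain d where d: "d \<in> cantor n" "h (u \<frown> d) = v j \<frown> e" using v_split[OF j(1,2)] by blast
    have "H ([Dotted a] \<frown> d) = z" using H_eq[OF a(1) d(1) j(1) d(2)] y j a by simp
    moreover have "[Dotted a] \<frown> d \<in> cantor_nr n s" using a d by auto
    ultimately show "z \<in> H ` cantor_nr n s" by blast
  qed
qed

lemma Dotted_conc_eq: "[Dotted a] \<frown> x = [Dotted c] \<frown> y \<longleftrightarrow> a = c \<and> x = y"
  by (subst concat_eq) auto

lemma H_inj: "inj_on H (cantor_nr n s)"
proof (rule inj_onI)
  fix x y assume x: "x \<in> cantor_nr n s" and y: "y \<in> cantor_nr n s" and eq: "H x = H y"
  obtain a d j e where 1: "a < s" "d \<in> cantor n" "j \<le> t * (n - 1)" "e \<in> cantor n" "h (u \<frown> d) = v j \<frown> e"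
    "x = [Dotted a] \<frown> d" "H x = [Dotted (\<rho> a)] \<frown> code n t j \<frown> e" using x by (rule H_cases)
  obtain a' d' j' e' where 2: "a' < s" "d' \<in> cantor n" "j' \<le> t * (n - 1)" "e' \<in> cantor n" "h (u \<frown> d') = v j' \<frown> e'"
    "y = [Dotted a'] \<frown> d'" "H y = [Dotted (\<rho> a')] \<frown> code n t j' \<frown> e'" using y by (rule H_cases)
  have "\<rho> a = \<rho> a'" and ce: "code n t j \<frown> e = code n t j' \<frown> e'"
    using eq unfolding 1(7) 2(7) by (simp_all only: Dotted_conc_eq)
  then have "a = a'" using bij_betw_imp_inj_on[OF rho] 1(1) 2(1) by (auto dest: inj_onD)
  have "j = j'" using code_unique[OF ce 1(3) 2(3)] .
  then have "e = e'" using ce by simp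
  then have "h (u \<frown> d) = h (u \<frown> d')" using 1(5) 2(5) \<open>j = j'\<close> by simp
  then have "u \<frown> d = u \<frown> d'" using b(9) u 1(2) 2(2) by (meson conc_in_cantor_nrI inj_onD)
  then show "x = y" using 1(6) 2(6) \<open>a = a'\<close> by simp
qed

lemma G_eq:
  assumes "a < s" "j \<le> t * (n - 1)" "e \<in> cantor n"
  shows "G ([Dotted (\<rho> a)] \<frown> code n t j \<frown> e) = [Dotted a] \<frown> suffix (length u) (g (v j \<frown> e))"
proof -
  obtain d where d: "d \<in> cantor n" "h (u \<frown> d) = v j \<frown> e" "g (v j \<frown> e) = u \<frown> d"
    using v_split[OF assms(2,3)] by blast
  have "G (H ([Dotted a] \<frown> d)) = [Dotted a] \<frown> d"
    unfolding G_def using assms d by (intro inv_into_f_f H_inj) auto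
  then show ?thesis using H_eq[OF assms(1) d(1) assms(2) d(2)] d(3) by simp
qed

lemma G_cases:
  assumes "z \<in> cantor_nr n s"
  obtains a j e where "a < s" "\<rho> a < s" "j \<le> t * (n - 1)" "e \<in> cantor n" "z = [Dotted (\<rho> a)] \<frown> code n t j \<frown> e"
proof -
  obtain x where "x \<in> cantor_nr n s" "z = H x" using assms H_image by blast
  then show thesis using that H_cases by metis
qed

text \<open>The first \<open>m\<close> letters of \<open>h (u \<frown> d)\<close> determine
  \<open>j\<close>, hence the replaced prefix, and the next \<open>M\<close> letters are copied. The
  successor in \<open>Suc K\<close> accounts for the dotted letter.\<close>

lemma ucont_H: "ucont n s H"
  unfolding ucont_def
proof
  fix M
  obtain K where K: "\<And>x y. x \<in> cantor_nr n r \<Longrightarrow> y \<in> cantor_nr n r \<Longrightarrow> prefix K x = prefix K y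
      \<Longrightarrow> prefix (m + M) (h x) = prefix (m + M) (h y)"
    using b(5) unfolding ucont_def by metis
  show "\<exists>k. \<forall>x\<in>cantor_nr n s. \<forall>y\<in>cantor_nr n s. prefix k x = prefix k y \<longrightarrow> prefix M (H x) = prefix M (H y)"
  proof (intro exI[of _ "Suc K"] ballI impI)
    fix x y assume x: "x \<in> cantor_nr n s" and y: "y \<in> cantor_nr n s" and eq: "prefix (Suc K) x = prefix (Suc K) y"
    obtain a d j e where 1: "a < s" "d \<in> cantor n" "j \<le> t * (n - 1)" "e \<in> cantor n" "h (u \<frown> d) = v j \<frown> e"
      "x = [Dotted a] \<frown> d" "H x = [Dotted (\<rho> a)] \<frown> code n t j \<frown> e" using x by (rule H_cases)
    obtain a' d' j' e' where 2: "a' < s" "d' \<in> cantor n" "j' \<le> t * (n - 1)" "e' \<in> cantor n" "h (u \<frown> d') = v j' \<frown> e'"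
      "y = [Dotted a'] \<frown> d'" "H y = [Dotted (\<rho> a')] \<frown> code n t j' \<frown> e'" using y by (rule H_cases)
    have a: "a = a'" and d: "prefix K d = prefix K d'" using eq 1(6) 2(6) by auto
    have "prefix (length u + K) (u \<frown> d) = prefix (length u + K) (u \<frown> d')" using d by simp
    then have "prefix K (u \<frown> d) = prefix K (u \<frown> d')" by (rule prefix_eq_mono) simp
    then have "prefix (m + M) (v j \<frown> e) = prefix (m + M) (v j' \<frown> e')"
      using K[OF conc_in_cantor_nrI[OF u 1(2)] conc_in_cantor_nrI[OF u 2(2)]] 1(5) 2(5) by simp
    then have ve: "v j = v j'" "prefix M e = prefix M e'"
      using v_props(2)[OF 1(3)] v_props(2)[OF 2(3)] by auto
    have "j = j'" using v_inj[OF 1(3) 2(3) ve(1)] .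
    let ?c = "[Dotted (\<rho> a)] @ code n t j"
    have "prefix (length ?c + M) (H x) = prefix (length ?c + M) (H y)"
      unfolding 1(7) 2(7) using ve(2) a \<open>j = j'\<close> by simp
    then show "prefix M (H x) = prefix M (H y)" by (rule prefix_eq_mono) simp
  qed
qed

text \<open>Code words have at most \<open>t\<close> letters, so \<open>t + K\<close> letters after
  the dotted one determine \<open>j\<close> and the first \<open>K\<close> letters of
  \<open>e\<close>.\<close>

lemma ucont_G: "ucont n s G"
  unfolding ucont_def
proof
  fix M
  obtain K where K: "\<And>x y. x \<in> cantor_nr n r \<Longrightarrow> y \<in> cantor_nr n r \<Longrightarrow> prefix K x = prefix K y
      \<Longrightarrow> prefix (length u + M) (g x) = prefix (length u + M) (g y)"
    using b(6) unfolding ucont_def by metis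
  show "\<exists>k. \<forall>x\<in>cantor_nr n s. \<forall>y\<in>cantor_nr n s. prefix k x = prefix k y \<longrightarrow> prefix M (G x) = prefix M (G y)"
  proof (intro exI[of _ "Suc (t + K)"] ballI impI)
    fix x y assume x: "x \<in> cantor_nr n s" and y: "y \<in> cantor_nr n s" and eq: "prefix (Suc (t + K)) x = prefix (Suc (t + K)) y"
    obtain a j e where 1: "a < s" "j \<le> t * (n - 1)" "e \<in> cantor n" "x = [Dotted (\<rho> a)] \<frown> code n t j \<frown> e"
      using x by (rule G_cases)
    obtain a' j' e' where 2: "a' < s" "j' \<le> t * (n - 1)" "e' \<in> cantor n" "y = [Dotted (\<rho> a')] \<frown> code n t j' \<frown> e'"
      using y by (rule G_cases)
    let ?c = "code n t j" and ?c' = "code n t j'"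
    have "prefix (Suc (t + K)) ([Dotted (\<rho> a)] \<frown> (?c \<frown> e)) = prefix (Suc (t + K)) ([Dotted (\<rho> a')] \<frown> (?c' \<frown> e'))"
      using eq 1(4) 2(4) by simp
    then have r: "\<rho> a = \<rho> a'" and p: "prefix (t + K) (?c \<frown> e) = prefix (t + K) (?c' \<frown> e')"
      by (auto simp del: conc_conc)
    have a: "a = a'" using r bij_betw_imp_inj_on[OF rho] 1(1) 2(1) by (auto dest: inj_onD)
    have "prefix (length ?c) (?c' \<frown> e') = prefix (length ?c) (?c \<frown> e)"
      by (rule prefix_eq_mono[OF p[symmetric]]) (simp add: length_code trans_le_add1)
    then have "prefix (length ?c) (?c' \<frown> e') = ?c" by simp
    then obtain z where "?c' \<frown> e' = ?c \<frown> z" using conc_eq_iff_prefix by blast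
    then have j: "j' = j" using code_unique 1(2) 2(2) by blast
    have "prefix (length ?c + K) (?c \<frown> e) = prefix (length ?c + K) (?c \<frown> e')"
      by (rule prefix_eq_mono[OF p[unfolded j]]) (simp add: length_code)
    then have e: "prefix K e = prefix K e'" by simp
    have "prefix (m + K) (v j \<frown> e) = prefix (m + K) (v j \<frown> e')" using e v_props(2)[OF 1(2)] by simp
    then have "prefix K (v j \<frown> e) = prefix K (v j \<frown> e')" by (rule prefix_eq_mono) simp
    then have ge: "prefix (length u + M) (g (v j \<frown> e)) = prefix (length u + M) (g (v j \<frown> e'))"
      using K[OF conc_in_cantor_nrI[OF v_props(1)[OF 1(2)] 1(3)] conc_in_cantor_nrI[OF v_props(1)[OF 1(2)] 2(3)]] by simp
    obtain d where d: "g (v j \<frown> e) = u \<frown> d" using v_split[OF 1(2,3)] by blast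
    obtain d' where d': "g (v j \<frown> e') = u \<frown> d'" using v_split[OF 1(2) 2(3)] by blast
    have Gx: "G x = [Dotted a] \<frown> d" using G_eq[OF 1(1,2,3)] 1(4) d by simp
    have Gy: "G y = [Dotted a] \<frown> d'" using G_eq[OF 1(1,2) 2(3)] 2(4) d' a j by simp
    have "prefix M d = prefix M d'" using ge d d' by simp
    then have "prefix (Suc M) (G x) = prefix (Suc M) (G y)" unfolding Gx Gy by simp
    then show "prefix M (G x) = prefix M (G y)" by (rule prefix_eq_mono) simp
  qed
qed

text \<open>Both maps arise from \<open>suffix c (f x)\<close> by prepending a fixed word,
  \<open>p\<close> or \<open>q\<close>, so \<open>loc_shift\<close> applies to each of them.\<close>

lemma loc_transfer:
  assumes sep: "separating n f w" and f: "\<And>d. d \<in> cantor n \<Longrightarrow> prefix c (f (w \<frown> d)) = p"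
    and f': "\<And>d. d \<in> cantor n \<Longrightarrow> f' (w' \<frown> d) = q \<frown> suffix c (f (w \<frown> d))"
  shows "loc n f' w' = loc n f w"
proof -
  let ?e = "\<lambda>x. suffix c (f x)"
  have fe: "f (w \<frown> d) = p \<frown> ?e (w \<frown> d)" if "d \<in> cantor n" for d
    using f[OF that] by (metis prefix_suffix)
  then have "separating n ?e w" using sep unfolding separating_def by metis
  then show ?thesis
    using loc_shift(2)[of n ?e w f w p, OF _ fe] loc_shift(2)[of n ?e w f' w' q, OF _ f'] by simp
qed

text \<open>The bound on the common prefix says that all values of \<open>h\<close> on the cone of
  \<open>u @ x\<close> lie in a single cone \<open>v j0\<close>. There \<open>H\<close> exchanges
  one fixed prefix for another.\<close>

lemma loc_H:
  assumes "a < s" "x \<in> lists (X n)" "m \<le> length (lcp_at n h (u @ x))"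
  shows "loc n H ([Dotted a] @ x) = loc n h (u @ x)"
proof -
  have w: "u @ x \<in> words_plus n r" using u assms(2) by blast
  have sep: "separating n h (u @ x)" using inj_separating[OF b(9) n w] .
  define p where "p = take m (lcp_at n h (u @ x))"
  have p: "prefix m (h ((u @ x) \<frown> d)) = p" if "d \<in> cantor n" for d
    using lcp_at_loc[OF sep that] assms(3) by (simp add: p_def)
  obtain d0 where d0: "d0 \<in> cantor n" using cantor_two n by metis
  have "x \<frown> d0 \<in> cantor n" using d0 assms(2) by simp
  then obtain j0 e0 where j0: "j0 \<le> t * (n - 1)" "h (u \<frown> x \<frown> d0) = v j0 \<frown> e0"
    by (metis h_split)
  then have vp: "v j0 = p" using p[OF d0] v_props(2)[OF j0(1)] by auto
  show ?thesis
  proof (rule loc_transfer[OF sep p])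
    fix d assume d: "d \<in> cantor n"
    have "h (u \<frown> (x \<frown> d)) = v j0 \<frown> suffix m (h ((u @ x) \<frown> d))"
      using p[OF d] vp by (metis conc_conc prefix_suffix)
    then show "H (([Dotted a] @ x) \<frown> d) = ([Dotted (\<rho> a)] @ code n t j0) \<frown> suffix m (h ((u @ x) \<frown> d))"
      using H_eq[OF assms(1) _ j0(1), of "x \<frown> d"] d assms(2) by simp
  qed
qed

text \<open>On a cone below \<open>code n t j\<close> the inverse acts as \<open>g\<close> does
  below \<open>v j\<close>, with the leading \<open>u\<close> exchanged for the dotted
  letter.\<close>

lemma loc_G:
  assumes "a < s" "j \<le> t * (n - 1)" "y \<in> lists (X n)"
  shows "loc n G ([Dotted (\<rho> a)] @ code n t j @ y) = loc n g (v j @ y)"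
proof -
  have w: "v j @ y \<in> words_plus n r" using v_props(1)[OF assms(2)] assms(3) by blast
  have sep: "separating n g (v j @ y)" using inj_separating[OF b(10) n w] .
  show ?thesis
  proof (rule loc_transfer[OF sep, of "length u" u _ _ "[Dotted a]"])
    fix d assume d: "d \<in> cantor n"
    have yd: "y \<frown> d \<in> cantor n" using assms(3) d by simp
    show "prefix (length u) (g ((v j @ y) \<frown> d)) = u"
      using v_split[OF assms(2) yd] by (metis conc_conc prefix_conc_length)
    show "G (([Dotted (\<rho> a)] @ code n t j @ y) \<frown> d) = [Dotted a] \<frown> suffix (length u) (g ((v j @ y) \<frown> d))"
      using G_eq[OF assms(1,2) yd] by simp
  qed
qed

lemma sync_H:
  shows "\<exists>K>0. sync n s K H \<and> sync n r K h \<and> core_maps n s K H = core_maps n r K h"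
proof -
  obtain L where L: "\<And>w. w \<in> words_plus n r \<Longrightarrow> L \<le> length w \<Longrightarrow> m \<le> length (lcp_at n h w)"
    using lcp_at_long[OF b(5,9) n] by metis
  \<comment> \<open>\<open>k\<close> for synchronization of \<open>h\<close>, \<open>L\<close> for
    common prefixes of length at least \<open>m\<close>, and the successor because cores need a
    positive level.\<close>
  define K where "K = Suc (max k L)"
  have syK: "sync n r K h" using sync_mono[OF b(7), of K] by (simp add: K_def)
  have locH: "loc n H (w @ x) = loc n h (u @ x)"
    if w: "w \<in> words_plus n s" and x: "x \<in> lists (X n)" "length x = K" for w x
  proof -
    obtain a y where y: "w = Dotted a # y" "a < s" "y \<in> lists (X n)" using w by (rule words_plus_cases)
    have yx: "y @ x \<in> lists (X n)" using x y by simp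
    have "L \<le> length (u @ y @ x)" using x by (simp add: K_def)
    then have "m \<le> length (lcp_at n h (u @ y @ x))" using L[OF words_plus_append[OF u yx]] by simp
    then have "loc n H (w @ x) = loc n h ((u @ y) @ x)" using loc_H[OF y(2) yx] y by simp
    also have "\<dots> = loc n h (u @ x)" using syncD[OF syK words_plus_append[OF u y(3)] u x(1)] x by simp
    finally show ?thesis .
  qed
  have "sync n s K H" unfolding sync_def using locH by metis
  moreover have "core_maps n s K H = core_maps n r K h"
  proof -
    have "core_maps n s K H = {loc n h (u @ x) | x. x \<in> lists (X n) \<and> length x = K}"
    proof -
      have "[Dotted 0] \<in> words_plus n s" using s by simp
      then show ?thesis unfolding core_maps_def using locH by (smt (verit) Collect_cong)
    qed
    \<comment> \<open>By synchronization an arbitrary dotted prefix may be replaced by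
      \<open>u\<close>.\<close>
    also have "\<dots> = core_maps n r K h"
      unfolding core_maps_def using u syK unfolding sync_def by (smt (verit) Collect_cong)
    finally show ?thesis .
  qed
  ultimately show ?thesis using syK by (intro exI[of _ K]) (simp add: K_def)
qed

text \<open>After the dotted letter, \<open>t\<close> letters suffice to complete a code word. What
  follows is read as by \<open>g\<close> below some \<open>v j\<close>, and its last
  \<open>k\<close> letters decide the local map.\<close>

lemma sync_G: "\<exists>K. sync n s K G"
proof -
  have *: "loc n G (w @ x @ y) = loc n g ([Dotted 0] @ y)"
    if w: "w \<in> words_plus n s" and x: "x \<in> lists (X n)" "length x = t" and y: "y \<in> lists (X n)" "length y = k" for w x y
  proof -
    obtain c z where z: "w = Dotted c # z" "c < s" "z \<in> lists (X n)" using w by (rule words_plus_cases)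
    obtain a where a: "a < s" "\<rho> a = c" using rho z(2) unfolding bij_betw_def by (metis imageE lessThan_iff)
    \<comment> \<open>An arbitrary continuation, used only to find the code word with which
      \<open>z @ x\<close> begins.\<close>
    obtain d where d: "d \<in> cantor n" using cantor_two n by metis
    then have "(z @ x) \<frown> d \<in> cantor n" using x z by simp
    then obtain j e where j: "j \<le> t * (n - 1)" "e \<in> cantor n" "(z @ x) \<frown> d = code n t j \<frown> e"
      using code_cover[OF n] by blast
    have le: "length (code n t j) \<le> length (z @ x)" using length_code[of n t j] x by simp
    have "take (length (code n t j)) (z @ x) = prefix (length (code n t j)) ((z @ x) \<frown> d)"
      using le by (simp del: take_append)
    also have "\<dots> = code n t j" unfolding j(3) by simp
    finally obtain z' where z': "z @ x = code n t j @ z'" by (metis append_take_drop_id)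
    then have z'l: "z' \<in> lists (X n)" using x z by (metis append_in_lists_conv)
    have zy: "z' @ y \<in> lists (X n)" using z'l y by simp
    have eq: "w @ x @ y = [Dotted (\<rho> a)] @ code n t j @ z' @ y" using z z' a by simp
    have "loc n G (w @ x @ y) = loc n g ((v j @ z') @ y)"
      unfolding eq loc_G[OF a(1) j(1) zy] by simp
    also have "\<dots> = loc n g ([Dotted 0] @ y)"
      using syncD[OF b(8) words_plus_append[OF v_props(1)[OF j(1)] z'l] _ y(1), of "[Dotted 0]"] y(2) r by simp
    finally show ?thesis .
  qed
  have "sync n s (t + k) G"
    unfolding sync_def
  proof (intro ballI impI)
    fix w w' x assume w: "w \<in> words_plus n s" "w' \<in> words_plus n s" and x: "x \<in> lists (X n)" "length x = t + k"
    have "set (take t x) \<subseteq> set x" "set (drop t x) \<subseteq> set x" by (simp_all add: set_take_subset set_drop_subset)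
    then have "take t x \<in> lists (X n)" "drop t x \<in> lists (X n)" using x by auto
    then show "loc n G (w @ x) = loc n G (w' @ x)"
      using *[OF w(1), of "take t x" "drop t x"] *[OF w(2), of "take t x" "drop t x"] x by simp
  qed
  then show ?thesis by blast
qed

lemma H_in_B: "H \<in> B n s"
  and Core_H: "h \<in> B n r \<Longrightarrow> Core n s H = Core n r h"
proof -
  obtain K where K: "K > 0" "sync n s K H" "sync n r K h" "core_maps n s K H = core_maps n r K h"
    using sync_H by blast
  obtain K' where K': "sync n s K' G" using sync_G by blast
  have "bisync n s (max K K') H G"
    unfolding bisync_def
  proof (intro conjI ballI)
    show "G ` cantor_nr n s \<subseteq> cantor_nr n s" unfolding G_def using H_image by (metis image_subsetI inv_into_into)
    show "G (H x) = x" if "x \<in> cantor_nr n s" for x using that H_inj by (simp add: G_def)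
    show "H (G x) = x" if "x \<in> cantor_nr n s" for x using that H_image by (simp add: G_def f_inv_into_f)
    show "sync n s (max K K') H" "sync n s (max K K') G" using K K' sync_mono by auto
    show "H ` cantor_nr n s \<subseteq> cantor_nr n s" by (simp add: H_image)
  qed (rule ucont_H ucont_G)+
  moreover have "H \<in> extensional (cantor_nr n s)" unfolding H_def by (rule restrict_extensional)
  ultimately show HB: "H \<in> B n s" using bisync_B n s by blast
  show "Core n s H = Core n r h" if "h \<in> B n r"
    using Core_cong[of n s r H h K K] HB that K n r s by simp
qed

end

section \<open>Adjacent points on the circle\<close>

text \<open>The oriented half of \<open>circ_eq\<close>: \<open>x\<close> comes directly after
  \<open>y\<close> in the cyclic order, and the last disjunct closes the circle.\<close>

definition adj :: "nat \<Rightarrow> nat \<Rightarrow> letter word \<Rightarrow> letter word \<Rightarrow> bool" where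
  "adj n r x y \<longleftrightarrow>
     (\<exists>w\<in>words_plus n r. \<exists>i. 0 < i \<and> i \<le> n - 1 \<and>
        x = (w @ [Plain i]) \<frown> (\<lambda>_. Plain 0) \<and> y = (w @ [Plain (i - 1)]) \<frown> (\<lambda>_. Plain (n - 1)))
   \<or> (\<exists>a. 0 < a \<and> a \<le> r - 1 \<and>
        x = [Dotted a] \<frown> (\<lambda>_. Plain 0) \<and> y = [Dotted (a - 1)] \<frown> (\<lambda>_. Plain (n - 1)))
   \<or> x = [Dotted 0] \<frown> (\<lambda>_. Plain 0) \<and> y = [Dotted (r - 1)] \<frown> (\<lambda>_. Plain (n - 1))"

lemma circ_eq_iff: "circ_eq n r x y \<longleftrightarrow> x = y \<or> adj n r x y \<or> adj n r y x"
  unfolding circ_eq_def adj_def doubleton_eq_iff build_conc by blast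

lemma circ_eq_sym: "circ_eq n r x y \<longleftrightarrow> circ_eq n r y x"
  unfolding circ_eq_iff by blast

text \<open>
  The words of length \<open>m + 1\<close> in lexicographic order; the cones of \<open>j\<close> and \<open>j + 1\<close>, modulo their
  number \<open>r * n ^ m\<close>, are neighbours on the circle.
\<close>

primrec wd :: "nat \<Rightarrow> nat \<Rightarrow> nat \<Rightarrow> letter list" where
  "wd n 0 j = [Dotted j]"
| "wd n (Suc m) j = wd n m (j div n) @ [Plain (j mod n)]"

lemma length_wd [simp]: "length (wd n m j) = Suc m"
  by (induction m arbitrary: j) auto

lemma wd_words_plus:
  assumes "n > 0"
  shows "j < r * n ^ m \<Longrightarrow> wd n m j \<in> words_plus n r"
proof (induction m arbitrary: j)
  case (Suc m)
  have "j div n < r * n ^ m" using Suc.prems assms by (intro less_mult_imp_div_less) (simp add: mult_ac)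
  then show ?case using Suc.IH assms by auto
qed simp

lemma wd_surj:
  assumes "v \<in> words_plus n r" "length v = Suc m"
  obtains j where "j < r * n ^ m" "v = wd n m j"
  using assms
proof (induction m arbitrary: v thesis)
  case 0
  then obtain a where "v = [Dotted a]" "a < r" by (auto simp: length_Suc_conv words_plus_def dots_def)
  then show ?case using 0(1)[of a] by simp
next
  case (Suc m)
  obtain w c where w: "v = w @ [c]" "length w = Suc m" using Suc.prems(3) by (cases v rule: rev_cases) auto
  then have "w \<noteq> []" by auto
  then have wp: "w \<in> words_plus n r" "c \<in> X n" using Suc.prems(2) w append_in_words_plus[of w "[c]"] by auto
  obtain i where i: "c = Plain i" "i < n" using wp(2) by (auto simp: X_def)
  obtain q where q: "q < r * n ^ m" "w = wd n m q" using Suc.IH wp w by blast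
  have "q * n + i < (q + 1) * n" using i by simp
  also have "\<dots> \<le> (r * n ^ m) * n" using q by (intro mult_right_mono) auto
  finally have "q * n + i < r * n ^ Suc m" by (simp add: mult_ac)
  moreover have "wd n (Suc m) (q * n + i) = v" using i q w by simp
  ultimately show ?case using Suc.prems(1) by blast
qed

lemma wd_inj: "wd n m i = wd n m j \<Longrightarrow> i = j"
proof (induction m arbitrary: i j)
  case (Suc m)
  then have "i div n = j div n" "i mod n = j mod n" by auto
  then show ?case by (metis div_mult_mod_eq)
qed simp

definition Lend :: "nat \<Rightarrow> nat \<Rightarrow> nat \<Rightarrow> letter word" where
  "Lend n m j = wd n m j \<frown> (\<lambda>_. Plain 0)"

definition Rend :: "nat \<Rightarrow> nat \<Rightarrow> nat \<Rightarrow> letter word" where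
  "Rend n m j = wd n m j \<frown> (\<lambda>_. Plain (n - 1))"

lemma Lend_inj: "Lend n m i = Lend n m j \<Longrightarrow> i = j"
  unfolding Lend_def by (subst (asm) concat_eq) (auto dest: wd_inj)

lemma Rend_inj: "Rend n m i = Rend n m j \<Longrightarrow> i = j"
  unfolding Rend_def by (subst (asm) concat_eq) (auto dest: wd_inj)

lemma Lend_neq_Rend: "n \<ge> 2 \<Longrightarrow> Lend n m i \<noteq> Rend n m j"
  unfolding Lend_def Rend_def by (subst concat_eq) (auto dest: fun_cong)

lemma Lend_cyl: "n > 0 \<Longrightarrow> Lend n m j \<in> cyl n (wd n m i) \<longleftrightarrow> i = j"
  unfolding Lend_def using wd_inj by (auto simp: mem_cyl)

lemma Rend_cyl: "n > 0 \<Longrightarrow> Rend n m j \<in> cyl n (wd n m i) \<longleftrightarrow> i = j"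
  unfolding Rend_def using wd_inj by (auto simp: mem_cyl)

lemma Lend_cantor_nr: "n > 0 \<Longrightarrow> j < r * n ^ m \<Longrightarrow> Lend n m j \<in> cantor_nr n r"
  unfolding Lend_def by (intro conc_in_cantor_nrI wd_words_plus) auto

lemma Rend_cantor_nr: "n > 0 \<Longrightarrow> j < r * n ^ m \<Longrightarrow> Rend n m j \<in> cantor_nr n r"
  unfolding Rend_def by (intro conc_in_cantor_nrI wd_words_plus) auto

text \<open>The adjacent pairs visible at level \<open>m\<close>: the right end of one cone and the
  left end of the next.\<close>

definition adj_at :: "nat \<Rightarrow> nat \<Rightarrow> nat \<Rightarrow> letter word \<Rightarrow> letter word \<Rightarrow> bool" where
  "adj_at n r m x y \<longleftrightarrow> (\<exists>j<r * n ^ m. x = Lend n m ((j + 1) mod (r * n ^ m)) \<and> y = Rend n m j)"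

lemma conc_const: "(w @ [a]) \<frown> (\<lambda>_. a) = w \<frown> (\<lambda>_. a)"
  by (simp add: const_conc flip: conc_conc)

lemma Rend_Suc: "j mod n = n - 1 \<Longrightarrow> Rend n (Suc m) j = Rend n m (j div n)"
  by (simp add: Rend_def conc_const)

lemma Lend_Suc: "j mod n = 0 \<Longrightarrow> Lend n (Suc m) j = Lend n m (j div n)"
  by (simp add: Lend_def conc_const)

lemma succ_mod_refine:
  fixes j n c :: nat
  assumes "j mod n = n - 1" "n > 0"
  shows "(j + 1) mod (c * n) = n * ((j div n + 1) mod c)"
proof -
  have "j = n * (j div n) + (n - 1)" using assms(1) by (metis mult_div_mod_eq)
  then have "j + 1 = n * (j div n + 1)" using assms(2) by (simp add: algebra_simps)
  then show ?thesis by (simp add: mult.commute mult_mod_right)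
qed

lemma div_mod_digit: "(b::nat) < n \<Longrightarrow> (q * n + b) div n = q \<and> (q * n + b) mod n = b"
  by simp

text \<open>Under refinement the right end of cone \<open>q\<close> becomes that of its last child,
  and the left end of the next cone that of its first child.\<close>

lemma adj_at_Suc:
  assumes "adj_at n r m x y" "n > 0"
  shows "adj_at n r (Suc m) x y"
proof -
  obtain q where q: "q < r * n ^ m" "x = Lend n m ((q + 1) mod (r * n ^ m))" "y = Rend n m q"
    using assms(1) unfolding adj_at_def by blast
  define j where "j = q * n + (n - 1)"
  have j: "j mod n = n - 1" "j div n = q" using div_mod_digit[of "n - 1" n q] assms(2) unfolding j_def by linarith+
  have "j < (q + 1) * n" using assms(2) by (simp add: j_def)
  also have "\<dots> \<le> (r * n ^ m) * n" using q by (intro mult_right_mono) auto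
  finally have jl: "j < r * n ^ Suc m" by (simp add: mult_ac)
  have "(j + 1) mod (r * n ^ Suc m) = n * ((q + 1) mod (r * n ^ m))"
    using succ_mod_refine[OF j(1) assms(2), of "r * n ^ m"] j(2) by (simp add: mult_ac)
  then have "x = Lend n (Suc m) ((j + 1) mod (r * n ^ Suc m))"
    using q(2) assms(2) by (simp add: Lend_Suc)
  moreover have "y = Rend n (Suc m) j" using q(3) j by (simp add: Rend_Suc)
  ultimately show ?thesis unfolding adj_at_def using jl by blast
qed

lemma adj_at_mono:
  assumes "adj_at n r m x y" "n > 0" "m \<le> m'"
  shows "adj_at n r m' x y"
  using assms(3) by (induction m' rule: dec_induct) (auto intro: assms adj_at_Suc)

text \<open>Induction on the level: after a last child the pair is one of the parent level;
  otherwise the two cones are siblings and the pair splits at their last letter.\<close>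

lemma Lend_Rend_adj:
  assumes "n > 0" "j < r * n ^ m"
  shows "adj n r (Lend n m ((j + 1) mod (r * n ^ m))) (Rend n m j)"
  using assms(2)
proof (induction m arbitrary: j)
  case 0
  show ?case
  proof (cases "j + 1 < r")
    case True
    then show ?thesis unfolding adj_def by (intro disjI2 disjI1 exI[of _ "j + 1"]) (auto simp: Lend_def Rend_def)
  next
    case False
    then have "j = r - 1" "j + 1 = r" using 0 by auto
    then show ?thesis unfolding adj_def by (intro disjI2) (auto simp: Lend_def Rend_def)
  qed
next
  case (Suc m)
  have q: "j div n < r * n ^ m" using Suc.prems assms by (intro less_mult_imp_div_less) (simp add: mult_ac)
  show ?case
  proof (cases "j mod n = n - 1")
    case True
    have "(j + 1) mod (r * n ^ Suc m) = n * ((j div n + 1) mod (r * n ^ m))"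
      using succ_mod_refine[OF True assms(1), of "r * n ^ m"] by (simp add: mult_ac)
    then have "Lend n (Suc m) ((j + 1) mod (r * n ^ Suc m)) = Lend n m ((j div n + 1) mod (r * n ^ m))"
      using assms by (simp add: Lend_Suc)
    then show ?thesis using Suc.IH[OF q] Rend_Suc[OF True] by simp
  next
    case False
    have "j mod n < n" using assms(1) by simp
    then have lt: "Suc (j mod n) < n" using False by linarith
    then have 1: "Suc j mod n = Suc (j mod n)" "Suc j div n = j div n"
      by (auto simp: mod_Suc div_Suc)
    \<comment> \<open>The last word on the circle ends in the digit \<open>n - 1\<close>, so no
      wraparound occurs here.\<close>
    have "j \<noteq> r * n ^ Suc m - 1"
    proof
      assume j: "j = r * n ^ Suc m - 1"
      then have "Suc j = n * (r * n ^ m)" using Suc.prems by (simp add: mult_ac)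
      then have "Suc j mod n = 0" by simp
      then show False using 1 by simp
    qed
    then have "j + 1 < r * n ^ Suc m" using Suc.prems by linarith
    then have "(j + 1) mod (r * n ^ Suc m) = Suc j" by simp
    then show ?thesis
      unfolding adj_def
      by (intro disjI1 bexI[of _ "wd n m (j div n)"] exI[of _ "Suc (j mod n)"])
        (use 1 lt wd_words_plus[OF assms(1) q] in \<open>auto simp: Lend_def Rend_def\<close>)
  qed
qed

text \<open>A pair that splits after a word \<open>w\<close> is visible from level
  \<open>length w\<close> on; a pair that splits at the dotted letter is visible at every
  level.\<close>

lemma adj_cases:
  assumes "adj n r x y" "n > 0" "r > 0"
  obtains (split) w i where "w \<in> words_plus n r" "i > 0" "i \<le> n - 1"
      "x = (w @ [Plain i]) \<frown> (\<lambda>_. Plain 0)" "y = (w @ [Plain (i - 1)]) \<frown> (\<lambda>_. Plain (n - 1))"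
      "\<And>m. length w \<le> m \<Longrightarrow> adj_at n r m x y"
    | (first) "\<And>m. adj_at n r m x y"
proof -
  consider (1) w i where "w \<in> words_plus n r" "i > 0" "i \<le> n - 1"
      "x = (w @ [Plain i]) \<frown> (\<lambda>_. Plain 0)" "y = (w @ [Plain (i - 1)]) \<frown> (\<lambda>_. Plain (n - 1))"
    | (2) a where "0 < a" "a \<le> r - 1" "x = [Dotted a] \<frown> (\<lambda>_. Plain 0)" "y = [Dotted (a - 1)] \<frown> (\<lambda>_. Plain (n - 1))"
    | (3) "x = [Dotted 0] \<frown> (\<lambda>_. Plain 0)" "y = [Dotted (r - 1)] \<frown> (\<lambda>_. Plain (n - 1))"
    using assms(1) unfolding adj_def by blast
  then show thesis
  proof cases
    case 1
    obtain l where l: "length w = Suc l" using words_plus_nonempty[OF 1(1)] by (cases w) auto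
    obtain q where q: "q < r * n ^ l" "w = wd n l q" using wd_surj[OF 1(1) l] by blast
    define j where "j = q * n + (i - 1)"
    have i: "i - 1 < n" "i < n" "i - 1 + 1 = i" using 1 by auto
    have j1: "j + 1 = q * n + i" using i by (simp add: j_def)
    have "j + 1 < (q + 1) * n" using i j1 by simp
    also have "\<dots> \<le> (r * n ^ l) * n" using q by (intro mult_right_mono) auto
    finally have jl: "j + 1 < r * n ^ Suc l" by (simp add: mult_ac)
    have "j div n = q" "j mod n = i - 1" "(j + 1) div n = q" "(j + 1) mod n = i"
      using div_mod_digit[of "i - 1" n q] div_mod_digit[of i n q] i unfolding j1 j_def by auto
    then have "x = Lend n (Suc l) (j + 1)" "y = Rend n (Suc l) j"
      using 1 q by (auto simp: Lend_def Rend_def)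
    then have "adj_at n r (Suc l) x y"
      unfolding adj_at_def using jl by (intro exI[of _ j]) auto
    then show ?thesis using split[OF 1] adj_at_mono assms(2) l by metis
  next
    case 2
    then have "adj_at n r 0 x y"
      unfolding adj_at_def by (intro exI[of _ "a - 1"]) (auto simp: Lend_def Rend_def)
    then show ?thesis using first adj_at_mono assms(2) by blast
  next
    case 3
    then have "adj_at n r 0 x y"
      unfolding adj_at_def using assms(3) by (intro exI[of _ "r - 1"]) (auto simp: Lend_def Rend_def)
    then show ?thesis using first adj_at_mono assms(2) by blast
  qed
qed

lemma adj_eventually:
  assumes "adj n r x y" "n > 0" "r > 0"
  shows "\<exists>m0. \<forall>m\<ge>m0. adj_at n r m x y"
  using assms by (cases rule: adj_cases) blast+

text \<open>A pair that splits after more than \<open>m\<close> letters would share its first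
  \<open>m + 1\<close> letters.\<close>

lemma adj_level:
  assumes "adj n r x y" "n > 0" "r > 0" "prefix (Suc m) x \<noteq> prefix (Suc m) y"
  shows "adj_at n r m x y"
  using assms(1-3)
proof (cases rule: adj_cases)
  case (split w i)
  have "length w \<le> m"
  proof (rule ccontr)
    assume "\<not> ?thesis"
    then have "prefix (Suc m) x = take (Suc m) w" "prefix (Suc m) y = take (Suc m) w"
      unfolding split(4,5) by simp_all
    then show False using assms(4) by simp
  qed
  then show ?thesis using split by blast
qed blast

lemma adj_in_cantor_nr:
  assumes "adj n r x y" "n > 0" "r > 0"
  shows "x \<in> cantor_nr n r" "y \<in> cantor_nr n r"
proof -
  obtain m where "adj_at n r m x y" using adj_eventually[OF assms] by blast
  then show "x \<in> cantor_nr n r" "y \<in> cantor_nr n r"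
    unfolding adj_at_def using Lend_cantor_nr Rend_cantor_nr assms(2,3) by auto
qed

lemma succ_mod_inj:
  fixes i j c :: nat
  assumes "(i + 1) mod c = (j + 1) mod c" "i < c" "j < c"
  shows "i = j"
  using assms by (metis Suc_eq_plus1 mod_Suc mod_less nat.inject nat.distinct(1))

text \<open>Two adjacent pairs are compared at a level where both are visible. There left ends, and
  likewise right ends, determine their index, and a left end is never a right end.\<close>

lemma adj_unique:
  assumes "adj n r x y" "n \<ge> 2" "r > 0"
  shows "adj n r x y' \<Longrightarrow> y = y'" "adj n r x' y \<Longrightarrow> x = x'" "\<not> adj n r z x" "x \<noteq> y"
proof -
  have n: "n > 0" using assms(2) by simp
  obtain m0 where m0: "\<And>m. m \<ge> m0 \<Longrightarrow> adj_at n r m x y" using adj_eventually[OF assms(1) n assms(3)] by blast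
  show "x \<noteq> y" using m0[of m0] Lend_neq_Rend[OF assms(2)] unfolding adj_at_def by blast
  { assume "adj n r x y'"
    then obtain m1 where m1: "\<And>m. m \<ge> m1 \<Longrightarrow> adj_at n r m x y'" using adj_eventually n assms(3) by blast
    have "adj_at n r (max m0 m1) x y" "adj_at n r (max m0 m1) x y'" using m0 m1 by auto
    then show "y = y'" unfolding adj_at_def using Lend_inj succ_mod_inj by metis }
  { assume "adj n r x' y"
    then obtain m1 where m1: "\<And>m. m \<ge> m1 \<Longrightarrow> adj_at n r m x' y" using adj_eventually n assms(3) by blast
    have "adj_at n r (max m0 m1) x y" "adj_at n r (max m0 m1) x' y" using m0 m1 by auto
    then show "x = x'" unfolding adj_at_def using Rend_inj by metis }
  show "\<not> adj n r z x"
  proof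
    assume "adj n r z x"
    then obtain m1 where m1: "\<And>m. m \<ge> m1 \<Longrightarrow> adj_at n r m z x" using adj_eventually n assms(3) by blast
    have "adj_at n r (max m0 m1) x y" "adj_at n r (max m0 m1) z x" using m0 m1 by auto
    then show False unfolding adj_at_def using Lend_neq_Rend[OF assms(2)] by metis
  qed
qed

lemma partner_unique:
  assumes "circ_eq n r x y" "x \<noteq> y" "circ_eq n r x y'" "x \<noteq> y'" "n \<ge> 2" "r > 0"
  shows "y = y'"
  using assms adj_unique[OF _ assms(5,6)] unfolding circ_eq_iff by metis

section \<open>Points with a partner on the circle\<close>

definition endpoint :: "nat \<Rightarrow> letter word \<Rightarrow> bool" where
  "endpoint n x \<longleftrightarrow> (\<exists>k. suffix k x = (\<lambda>_. Plain 0) \<or> suffix k x = (\<lambda>_. Plain (n - 1)))"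

lemma suffix_const: "suffix k (\<lambda>_. c) = (\<lambda>_. c)"
  by (rule ext) simp

lemma endpoint_conc: "endpoint n (w \<frown> x) \<longleftrightarrow> endpoint n x"
proof
  assume "endpoint n (w \<frown> x)"
  then obtain k c where k: "suffix k (w \<frown> x) = (\<lambda>_. Plain c)" "c = 0 \<or> c = n - 1"
    unfolding endpoint_def by blast
  have "suffix (length w) (suffix k (w \<frown> x)) = (\<lambda>_. Plain c)" unfolding k(1) by (rule suffix_const)
  then have "suffix k x = (\<lambda>_. Plain c)" by (simp del: suffix_conc_fst)
  then show "endpoint n x" using k(2) unfolding endpoint_def by blast
next
  assume "endpoint n x"
  then obtain k c where k: "suffix k x = (\<lambda>_. Plain c)" "c = 0 \<or> c = n - 1"
    unfolding endpoint_def by blast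
  then have "suffix (length w + k) (w \<frown> x) = (\<lambda>_. Plain c)" by simp
  then show "endpoint n (w \<frown> x)" using k(2) unfolding endpoint_def by blast
qed

lemma endpoint_const: "endpoint n (\<lambda>_. Plain 0)" "endpoint n (\<lambda>_. Plain (n - 1))"
  unfolding endpoint_def by (auto intro!: exI[of _ 0])

lemma endpoint_partner:
  assumes "x \<in> cantor_nr n r" "n \<ge> 2" "r > 0"
  shows "endpoint n x \<longleftrightarrow> (\<exists>y\<in>cantor_nr n r. x \<noteq> y \<and> circ_eq n r x y)"
proof
  have n: "n > 0" using assms(2) by simp
  {
    assume "endpoint n x"
    then obtain k c where k: "suffix k x = (\<lambda>_. Plain c)" "c = 0 \<or> c = n - 1"
      unfolding endpoint_def by blast
    \<comment> \<open>One more letter is moved into the prefix, which is then nonempty and equals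
      some \<open>wd n k j\<close>.\<close>
    have "suffix 1 (suffix k x) = (\<lambda>_. Plain c)" unfolding k(1) by (rule suffix_const)
    then have ks: "suffix (Suc k) x = (\<lambda>_. Plain c)" by simp
    obtain j where j: "j < r * n ^ k" "prefix (Suc k) x = wd n k j"
      using wd_surj[OF prefix_in_words_plus(1)[OF assms(1)], of "Suc k" k] by auto
    have "prefix (Suc k) x \<frown> suffix (Suc k) x = x" by simp
    then have x: "x = wd n k j \<frown> (\<lambda>_. Plain c)" unfolding ks j(2) by (rule sym)
    have "\<exists>y. adj n r x y \<or> adj n r y x"
    proof (cases "c = 0")
      case True
      \<comment> \<open>The predecessor of \<open>j\<close> in the cyclic order.\<close>
      define i where "i = (if j = 0 then r * n ^ k - 1 else j - 1)"
      have "i < r * n ^ k" "(i + 1) mod (r * n ^ k) = j" using j by (auto simp: i_def)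
      then show ?thesis using Lend_Rend_adj[OF n, of i r k] x True by (auto simp: Lend_def)
    next
      case False
      then show ?thesis using Lend_Rend_adj[OF n j(1)] x k(2) by (auto simp: Rend_def)
    qed
    then show "\<exists>y\<in>cantor_nr n r. x \<noteq> y \<and> circ_eq n r x y"
      using adj_in_cantor_nr[OF _ n assms(3)] adj_unique(4)[OF _ assms(2,3)] unfolding circ_eq_iff by metis
  }
  assume "\<exists>y\<in>cantor_nr n r. x \<noteq> y \<and> circ_eq n r x y"
  then obtain y where "adj n r x y \<or> adj n r y x" unfolding circ_eq_iff by blast
  then obtain m where "adj_at n r m x y \<or> adj_at n r m y x" using adj_eventually n assms(3) by blast
  then obtain j where "x = Lend n m j \<or> x = Rend n m j" unfolding adj_at_def by blast
  then show "endpoint n x" using endpoint_const unfolding Lend_def Rend_def by (auto simp: endpoint_conc)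
qed


section \<open>Clopen sets with two boundary points\<close>

text \<open>The boundary on the quotient circle, recorded by points of \<open>U\<close>. It refers
  to \<simeq> only, hence is carried along by maps that preserve \<simeq>.\<close>

definition bd :: "nat \<Rightarrow> nat \<Rightarrow> letter word set \<Rightarrow> letter word set" where
  "bd n r U = {x \<in> U. \<exists>y\<in>cantor_nr n r. y \<notin> U \<and> circ_eq n r x y}"

lemma bd_image:
  assumes "inj_on h (cantor_nr n r)" "h ` cantor_nr n r = cantor_nr n r" "U \<subseteq> cantor_nr n r"
    "\<forall>x\<in>cantor_nr n r. \<forall>y\<in>cantor_nr n r. circ_eq n r x y \<longleftrightarrow> circ_eq n r (h x) (h y)"
  shows "bd n r (h ` U) = h ` bd n r U"
proof
  have mem: "h y \<in> h ` U \<longleftrightarrow> y \<in> U" if "y \<in> cantor_nr n r" for y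
    using assms(1,3) that by (meson inj_on_image_mem_iff)
  show "h ` bd n r U \<subseteq> bd n r (h ` U)"
  proof
    fix z assume "z \<in> h ` bd n r U"
    then obtain x y where x: "z = h x" "x \<in> U" and y: "y \<in> cantor_nr n r" "y \<notin> U" "circ_eq n r x y"
      unfolding bd_def by blast
    have "h y \<in> cantor_nr n r" using y assms(2) by blast
    moreover have "h y \<notin> h ` U" using mem y by blast
    moreover have "circ_eq n r (h x) (h y)" using assms(3,4) x y by blast
    ultimately show "z \<in> bd n r (h ` U)" unfolding bd_def using x by blast
  qed
  show "bd n r (h ` U) \<subseteq> h ` bd n r U"
  proof
    fix z assume "z \<in> bd n r (h ` U)"
    then obtain x y where x: "z = h x" "x \<in> U" and y: "y \<in> cantor_nr n r" "y \<notin> h ` U" "circ_eq n r z y"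
      unfolding bd_def by blast
    obtain y' where y': "y' \<in> cantor_nr n r" "y = h y'" using y(1) assms(2) by blast
    have "y' \<notin> U" using y' y by blast
    moreover have "circ_eq n r x y'" using assms(3,4) x y y' by blast
    ultimately show "z \<in> h ` bd n r U" unfolding bd_def using x y' by blast
  qed
qed

text \<open>A partner outside the cone differs from \<open>x\<close> within the first
  \<open>m + 1\<close> letters, so the pair is visible at level \<open>m\<close>.\<close>

lemma bd_cyl:
  assumes "i < r * n ^ m" "n \<ge> 2" "r > 0"
  shows "bd n r (cyl n (wd n m i)) \<subseteq> {Lend n m i, Rend n m i}"
proof
  have n: "n > 0" using assms(2) by simp
  fix x assume "x \<in> bd n r (cyl n (wd n m i))"
  then obtain y where x: "x \<in> cyl n (wd n m i)" and y: "y \<in> cantor_nr n r" "y \<notin> cyl n (wd n m i)" "circ_eq n r x y"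
    unfolding bd_def by blast
  have "wd n m i \<noteq> []" using length_wd[of n m i] by (metis list.size(3) nat.distinct(1))
  then have ne: "prefix (Suc m) x \<noteq> prefix (Suc m) y"
    using x mem_cyl[of x n] mem_cyl_nr[OF y(1), of "wd n m i"] y(2) by auto
  have "adj n r x y \<or> adj n r y x" using x y unfolding circ_eq_iff by blast
  then have "adj_at n r m x y \<or> adj_at n r m y x"
    using adj_level[OF _ n assms(3) ne] adj_level[OF _ n assms(3) ne[symmetric]] by blast
  then obtain j where "x = Lend n m j \<or> x = Rend n m j"
    unfolding adj_at_def by (elim disjE exE conjE) auto
  then show "x \<in> {Lend n m i, Rend n m i}"
    using x Lend_cyl[OF n, of m j i] Rend_cyl[OF n, of m j i] by auto
qed

lemma shift_mod_inj:
  fixes a c i j :: nat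
  assumes "(a + i) mod c = (a + j) mod c" "i < c" "j < c"
  shows "i = j"
proof -
  have "i mod c = j mod c"
    using assms(1) cong_add_lcancel_nat[of a i j c] unfolding cong_def by blast
  then show ?thesis using assms by simp
qed

text \<open>On a walk round the circle of \<open>c\<close> cones, each entry into \<open>U\<close>
  contributes a left end to the boundary and each exit a right end. Two boundary points allow just
  one entry and one exit, so the cones of \<open>U\<close> form a single run of length
  \<open>N\<close>.\<close>

lemma clopen_interval:
  assumes n: "n \<ge> 2" and r: "r > 0" and lev: "level n r (Suc m) U" and ne: "U \<noteq> {}" "U \<noteq> cantor_nr n r"
    and bd: "bd n r U \<subseteq> {p, q}"
  obtains j0 N where "0 < N" "N < r * n ^ m"
    "bij_betw (\<lambda>i. wd n m ((j0 + i) mod (r * n ^ m))) {..<N} (cyls n r (Suc m) U)"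
    "{p, q} = {Lend n m ((j0 + 0) mod (r * n ^ m)), Rend n m ((j0 + (N - 1)) mod (r * n ^ m))}"
proof -
  define c where "c = r * n ^ m"
  have n0: "n > 0" using n by simp
  have c0: "c > 0" using n0 r by (simp add: c_def)
  define J where "J j \<longleftrightarrow> cyl n (wd n m (j mod c)) \<subseteq> U" for j
  have lt: "j mod c < r * n ^ m" for j using c0 by (simp add: c_def)
  have wp: "wd n m (j mod c) \<in> words_plus n r" for j using wd_words_plus[OF n0 lt] .
  have JL: "J j \<longleftrightarrow> Lend n m (j mod c) \<in> U" for j
    unfolding J_def using level_cyl_iff[OF lev wp] Lend_cyl[OF n0] by auto
  have JR: "J j \<longleftrightarrow> Rend n m (j mod c) \<in> U" for j
    unfolding J_def using level_cyl_iff[OF lev wp] Rend_cyl[OF n0] by auto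
  have Jmod: "J (j mod c) = J j" for j by (simp add: J_def)
  have circ: "circ_eq n r (Lend n m ((j + 1) mod c)) (Rend n m (j mod c))" for j
  proof -
    have "(j mod c + 1) mod c = (j + 1) mod c" by (simp add: mod_simps)
    then show ?thesis using Lend_Rend_adj[OF n0 lt] unfolding circ_eq_iff c_def by metis
  qed
  have startL: "Lend n m ((j + 1) mod c) \<in> bd n r U" if "J (j + 1)" "\<not> J j" for j
    unfolding bd_def using that circ[of j] Rend_cantor_nr[OF n0 lt[of j]] JL JR by blast
  have endR: "Rend n m (j mod c) \<in> bd n r U" if "\<not> J (j + 1)" "J j" for j
    unfolding bd_def using that circ[of j] circ_eq_sym Lend_cantor_nr[OF n0 lt[of "j + 1"]] JL JR by blast
  have cyl_of: "\<exists>j<c. x \<in> cyl n (wd n m j)" if x: "x \<in> cantor_nr n r" for x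
  proof -
    obtain j where "j < r * n ^ m" "prefix (Suc m) x = wd n m j"
      using wd_surj[OF prefix_in_words_plus(1)[OF x], of "Suc m" m] by auto
    then show ?thesis using mem_cyl_nr[OF x, of "wd n m j"] length_wd[of n m j]
      by (metis c_def list.size(3) nat.distinct(1))
  qed
  have Ux: "x \<in> U \<longleftrightarrow> J j" if "x \<in> cyl n (wd n m j)" "j < c" for x j
    using level_cyl_iff[OF lev wp[of j], of x] that unfolding J_def by simp
  obtain a where a: "\<not> J a"
  proof -
    obtain x where "x \<in> cantor_nr n r" "x \<notin> U" using ne(2) lev unfolding level_def by blast
    then show thesis using that cyl_of Ux by blast
  qed
  obtain d where d: "J (a + d)"
  proof -
    obtain x where x: "x \<in> U" using ne(1) by blast
    then have "x \<in> cantor_nr n r" using lev unfolding level_def by blast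
    then obtain j where j: "j < c" "x \<in> cyl n (wd n m j)" using cyl_of by blast
    then have "J j" using Ux x by blast
    \<comment> \<open>\<open>c - a mod c\<close> plays the part of \<open>- a\<close> modulo
      \<open>c\<close>, so some number of steps from \<open>a\<close> leads to
      \<open>j\<close>.\<close>
    moreover have "(a + (j + (c - a mod c))) mod c = j mod c"
    proof -
      have "(a + (j + (c - a mod c))) mod c = (a mod c + (j + (c - a mod c))) mod c" by (simp add: mod_simps)
      also have "a mod c + (j + (c - a mod c)) = j + c"
        using less_imp_le[OF mod_less_divisor[OF c0, of a]] by simp
      finally show ?thesis by simp
    qed
    ultimately have "J (a + (j + (c - a mod c)))" unfolding J_def by simp
    then show thesis using that by blast
  qed
  \<comment> \<open>Walking from a cone outside \<open>U\<close>, the first cone inside starts the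
    run; \<open>j1\<close> is the cone just before it.\<close>
  define d0 where "d0 = (LEAST d. J (a + d))"
  have d0: "J (a + d0)" "\<And>i. i < d0 \<Longrightarrow> \<not> J (a + i)"
    unfolding d0_def using LeastI[of "\<lambda>d. J (a + d)", OF d] not_less_Least by blast+
  have "d0 \<noteq> 0" using a d0(1) by (metis add.right_neutral)
  then obtain j1 where j1: "a + d0 = j1 + 1" "\<not> J j1" using d0(2)[of "d0 - 1"] by (metis Nat.add_diff_assoc Suc_eq_plus1 Suc_pred' add_Suc_right diff_less not_gr_zero zero_less_one)
  define j0 where "j0 = j1 + 1"
  have j0: "J j0" "\<not> J j1" using d0(1) j1 by (auto simp: j0_def)
  \<comment> \<open>One step short of a full turn the walk is back at \<open>j1\<close>, so the run
    ends by then.\<close>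
  have notlast: "\<not> J (j0 + (c - 1))"
  proof -
    have "(j0 + (c - 1)) mod c = j1 mod c" using c0 by (simp add: j0_def)
    then show ?thesis using j0(2) by (simp add: J_def)
  qed
  define N where "N = (LEAST i. \<not> J (j0 + i))"
  have N: "\<not> J (j0 + N)" "\<And>i. i < N \<Longrightarrow> J (j0 + i)" "N \<le> c - 1"
    unfolding N_def using LeastI[of "\<lambda>i. \<not> J (j0 + i)", OF notlast] not_less_Least[of _ "\<lambda>i. \<not> J (j0 + i)"]
      Least_le[of "\<lambda>i. \<not> J (j0 + i)", OF notlast] by blast+
  have N0: "N > 0" using N(1) j0(1) by (metis add.right_neutral not_gr_zero)
  have Nc: "N < c" using N(3) c0 by linarith
  have L0: "Lend n m (j0 mod c) \<in> bd n r U" using startL[of j1] j0 by (simp add: j0_def)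
  have RN: "Rend n m ((j0 + (N - 1)) mod c) \<in> bd n r U"
    using endR[of "j0 + (N - 1)"] N(1) N(2)[of "N - 1"] N0 by simp
  have LR: "Lend n m (j0 mod c) \<noteq> Rend n m ((j0 + (N - 1)) mod c)" using Lend_neq_Rend[OF n] .
  \<comment> \<open>The entry and the exit are two distinct boundary points and so exhaust
    \<open>{p, q}\<close>.\<close>
  have pq: "{p, q} = {Lend n m (j0 mod c), Rend n m ((j0 + (N - 1)) mod c)}"
    using L0 RN LR bd by blast
  \<comment> \<open>A second entry would put another left end into the boundary, and within one turn
    the left ends are distinct.\<close>
  have tail: "\<not> J (j0 + i)" if "N \<le> i" "i < c" for i
  proof
    assume "J (j0 + i)"
    then have ex: "J (j0 + (N + (i - N)))" using that by simp
    define e where "e = (LEAST e. J (j0 + (N + e)))"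
    have e: "J (j0 + (N + e))" "\<And>i. i < e \<Longrightarrow> \<not> J (j0 + (N + i))" "e \<le> i - N"
      unfolding e_def using LeastI[of "\<lambda>e. J (j0 + (N + e))", OF ex] not_less_Least[of _ "\<lambda>e. J (j0 + (N + e))"]
        Least_le[of "\<lambda>e. J (j0 + (N + e))", OF ex] by blast+
    have "e \<noteq> 0" using e(1) N(1) by (metis add.right_neutral)
    then have "\<not> J (j0 + (N + (e - 1)))" "j0 + (N + (e - 1)) + 1 = j0 + (N + e)" using e(2)[of "e - 1"] by auto
    then have "Lend n m ((j0 + (N + e)) mod c) \<in> bd n r U" using startL[of "j0 + (N + (e - 1))"] e(1) by simp
    then have "Lend n m ((j0 + (N + e)) mod c) \<in> {Lend n m (j0 mod c), Rend n m ((j0 + (N - 1)) mod c)}"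
      using bd pq by blast
    then have "Lend n m ((j0 + (N + e)) mod c) = Lend n m (j0 mod c)" using Lend_neq_Rend[OF n] by blast
    then have "(j0 + (N + e)) mod c = (j0 + 0) mod c" using Lend_inj by fastforce
    then have "N + e = 0" by (rule shift_mod_inj) (use e(3) that c0 in auto)
    then show False using N0 by simp
  qed
  have "bij_betw (\<lambda>i. wd n m ((j0 + i) mod c)) {..<N} (cyls n r (Suc m) U)"
    unfolding bij_betw_def
  proof
    show "inj_on (\<lambda>i. wd n m ((j0 + i) mod c)) {..<N}"
      using wd_inj shift_mod_inj[of j0 _ c] Nc by (intro inj_onI) (metis lessThan_iff less_trans)
    show "(\<lambda>i. wd n m ((j0 + i) mod c)) ` {..<N} = cyls n r (Suc m) U"
    proof
      show "(\<lambda>i. wd n m ((j0 + i) mod c)) ` {..<N} \<subseteq> cyls n r (Suc m) U"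
        using N(2) wp unfolding cyls_def J_def by auto
      show "cyls n r (Suc m) U \<subseteq> (\<lambda>i. wd n m ((j0 + i) mod c)) ` {..<N}"
      proof
        fix w assume w: "w \<in> cyls n r (Suc m) U"
        then obtain j where j: "j < r * n ^ m" "w = wd n m j" using wd_surj unfolding cyls_def by blast
        define i where "i = (j + (c - j0 mod c)) mod c"
        have i: "i < c" using c0 by (simp add: i_def)
        have "(j0 + i) mod c = (j0 mod c + (j + (c - j0 mod c))) mod c" by (simp add: i_def mod_simps)
        also have "j0 mod c + (j + (c - j0 mod c)) = j + c"
          using less_imp_le[OF mod_less_divisor[OF c0, of j0]] by simp
        finally have ij: "(j0 + i) mod c = j" using j by (simp add: c_def)
        then have "J (j0 + i)" using w j unfolding J_def cyls_def by simp
        then have "i < N" using tail i by (meson not_le)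
        then show "w \<in> (\<lambda>i. wd n m ((j0 + i) mod c)) ` {..<N}" using ij j by blast
      qed
    qed
  qed
  then show thesis using that[of N j0] N0 Nc pq unfolding c_def by simp
qed

section \<open>Transplanting circle homeomorphisms\<close>

lemma succ_mod_neq:
  fixes q c :: nat
  assumes "q < c" "c > 1"
  shows "(q + 1) mod c \<noteq> q"
proof (cases "q + 1 < c")
  case False
  then have qc: "q + 1 = c" using assms(1) by linarith
  have "(q + 1) mod c = 0" unfolding qc by (rule mod_self)
  then show ?thesis using assms(2) qc by linarith
qed simp

text \<open>The words \<open>wd n m'\<close> have length \<open>m' + 1\<close>, hence
  \<open>m = Suc m'\<close>. By \<open>proper\<close> the cone after the last one of the run lies
  outside it, so neighbours in the run have consecutive indices. The two alternatives of
  \<open>ends\<close> are the orientations of \<open>h\<close>, each with its order of the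
  copies.\<close>

locale circular_transplant = transplant +
  fixes m' j0 :: nat
  assumes m': "m = Suc m'" "m' \<ge> 1" and proper: "t * (n - 1) + 1 < r * n ^ m'"
    and v_wd: "\<And>j. j \<le> t * (n - 1) \<Longrightarrow> v j = wd n m' ((j0 + j) mod (r * n ^ m'))"
    and circ: "\<And>x y. x \<in> cantor_nr n r \<Longrightarrow> y \<in> cantor_nr n r \<Longrightarrow> circ_eq n r x y \<longleftrightarrow> circ_eq n r (h x) (h y)"
    and ends: "(\<forall>a<s. \<rho> a = a) \<and> h (u \<frown> (\<lambda>_. Plain 0)) = v 0 \<frown> (\<lambda>_. Plain 0) \<and>
        h (u \<frown> (\<lambda>_. Plain (n - 1))) = v (t * (n - 1)) \<frown> (\<lambda>_. Plain (n - 1)) \<or>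
      (\<forall>a<s. \<rho> a = s - 1 - a) \<and> h (u \<frown> (\<lambda>_. Plain 0)) = v (t * (n - 1)) \<frown> (\<lambda>_. Plain (n - 1)) \<and>
        h (u \<frown> (\<lambda>_. Plain (n - 1))) = v 0 \<frown> (\<lambda>_. Plain 0)"
begin

lemma n0: "n > 0" using n by simp

text \<open>Within one cone the pair splits in the common tail, which is kept. In different cones
  the points are the end of one and the start of the next, so the indices are consecutive and
  \<open>code_adjacent\<close> applies.\<close>

lemma adj_code:
  assumes adj: "adj n r (v j \<frown> e) (v j' \<frown> e')" and j: "j \<le> t * (n - 1)" "j' \<le> t * (n - 1)" and a: "a < s"
  shows "adj n s ([Dotted a] \<frown> code n t j \<frown> e) ([Dotted a] \<frown> code n t j' \<frown> e')"
proof (cases "v j = v j'")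
  case True
  then have jj: "j' = j" using v_inj[OF j] by simp
  have pv: "prefix m (v j \<frown> e) = v j" "prefix m (v j' \<frown> e') = v j"
    using v_props(2)[OF j(1)] jj by auto
  from adj n0 r show ?thesis
  proof (cases rule: adj_cases)
    case (split w i)
    have "length w \<ge> m"
    proof (rule ccontr)
      assume l: "\<not> ?thesis"
      have "prefix (Suc (length w)) (v j \<frown> e) = prefix (Suc (length w)) (v j' \<frown> e')"
        by (rule prefix_eq_mono[where k = m]) (use pv l in auto)
      then have "w @ [Plain i] = w @ [Plain (i - 1)]" unfolding split(4,5) by simp
      then show False using split(2) by simp
    qed
    then have "take m w = v j" using pv(1) unfolding split(4) by simp
    then obtain w' where w: "w = v j @ w'" by (metis append_take_drop_id)
    have w'l: "w' \<in> lists (X n)" using split(1) v_props(1)[OF j(1)] append_in_words_plus[of "v j" w' n r] words_plus_nonempty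
      unfolding w by blast
    have "v j \<frown> e = v j \<frown> (w' @ [Plain i]) \<frown> (\<lambda>_. Plain 0)" "v j \<frown> e' = v j \<frown> (w' @ [Plain (i - 1)]) \<frown> (\<lambda>_. Plain (n - 1))"
      using split(4,5) unfolding w jj by simp_all
    then have e: "e = (w' @ [Plain i]) \<frown> (\<lambda>_. Plain 0)" "e' = (w' @ [Plain (i - 1)]) \<frown> (\<lambda>_. Plain (n - 1))"
      by (simp_all only: same_concat_eq)
    have "[Dotted a] @ code n t j @ w' \<in> words_plus n s" using a w'l code_lists[OF n] by simp
    then show ?thesis
      unfolding adj_def e jj using split(2,3)
      by (intro disjI1 bexI[of _ "[Dotted a] @ code n t j @ w'"] exI[of _ i]) auto
  next
    case first
    obtain q where q: "v j \<frown> e = Lend n m' ((q + 1) mod (r * n ^ m'))" "v j' \<frown> e' = Rend n m' q" "q < r * n ^ m'"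
      using first[of m'] unfolding adj_at_def by blast
    have "prefix m (v j \<frown> e) = wd n m' ((q + 1) mod (r * n ^ m'))" "prefix m (v j' \<frown> e') = wd n m' q"
      unfolding q(1,2) by (simp_all add: Lend_def Rend_def m'(1))
    \<comment> \<open>A pair visible at level \<open>m'\<close> inside a single cone would make that
      cone its own successor.\<close>
    then have "(q + 1) mod (r * n ^ m') = q" using pv wd_inj by metis
    moreover have "r * n ^ m' > 1" using proper by simp
    ultimately have False using succ_mod_neq[OF q(3)] by blast
    then show ?thesis ..
  qed
next
  case False
  let ?c = "r * n ^ m'"
  have pv: "prefix (Suc m') (v j \<frown> e) = v j" "prefix (Suc m') (v j' \<frown> e') = v j'"
    using v_props(2)[OF j(1)] v_props(2)[OF j(2)] m'(1) by auto
  then have "adj_at n r m' (v j \<frown> e) (v j' \<frown> e')" using adj_level[OF adj n0 r] False by simp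
  then obtain q where q: "v j \<frown> e = Lend n m' ((q + 1) mod ?c)" "v j' \<frown> e' = Rend n m' q" "q < ?c"
    unfolding adj_at_def by blast
  have l: "length (v j) = Suc m'" "length (v j') = Suc m'" using v_props(2) j m'(1) by auto
  have e: "v j = wd n m' ((q + 1) mod ?c)" "e = (\<lambda>_. Plain 0)" "v j' = wd n m' q" "e' = (\<lambda>_. Plain (n - 1))"
    using q(1,2) l unfolding Lend_def Rend_def by simp_all
  have "(j0 + j) mod ?c = (q + 1) mod ?c" using e(1) v_wd[OF j(1)] wd_inj by metis
  moreover have "(j0 + j') mod ?c = q" using e(3) v_wd[OF j(2)] wd_inj by metis
  ultimately have "(j0 + j) mod ?c = ((j0 + j') mod ?c + 1) mod ?c" by simp
  also have "\<dots> = (j0 + Suc j') mod ?c" by (simp add: mod_simps)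
  finally have jj: "j = Suc j'" by (rule shift_mod_inj) (use j proper in auto)
  then obtain w i where w: "w \<in> lists (X n)" "i > 0" "i \<le> n - 1"
    "code n t (Suc j') \<frown> (\<lambda>_. Plain 0) = (w @ [Plain i]) \<frown> (\<lambda>_. Plain 0)"
    "code n t j' \<frown> (\<lambda>_. Plain (n - 1)) = (w @ [Plain (i - 1)]) \<frown> (\<lambda>_. Plain (n - 1))"
    using code_adjacent[OF n, of j' t] j by auto
  have "[Dotted a] \<frown> code n t j \<frown> e = (([Dotted a] @ w) @ [Plain i]) \<frown> (\<lambda>_. Plain 0)"
    "[Dotted a] \<frown> code n t j' \<frown> e' = (([Dotted a] @ w) @ [Plain (i - 1)]) \<frown> (\<lambda>_. Plain (n - 1))"
    unfolding e(2,4) jj w(4,5) by simp_all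
  moreover have "[Dotted a] @ w \<in> words_plus n s" using a w(1) by simp
  ultimately show ?thesis unfolding adj_def using w(2,3) by blast
qed

text \<open>The first and the last code word continue to the constant sequences \<open>0\<close> and
  \<open>n - 1\<close>, so the ends of \<open>h(u C)\<close> become the ends of a whole
  copy.\<close>

lemma H_ends:
  "(\<forall>a<s. H ([Dotted a] \<frown> (\<lambda>_. Plain 0)) = [Dotted a] \<frown> (\<lambda>_. Plain 0) \<and>
      H ([Dotted a] \<frown> (\<lambda>_. Plain (n - 1))) = [Dotted a] \<frown> (\<lambda>_. Plain (n - 1))) \<or>
    (\<forall>a<s. H ([Dotted a] \<frown> (\<lambda>_. Plain 0)) = [Dotted (s - 1 - a)] \<frown> (\<lambda>_. Plain (n - 1)) \<and>
      H ([Dotted a] \<frown> (\<lambda>_. Plain (n - 1))) = [Dotted (s - 1 - a)] \<frown> (\<lambda>_. Plain 0))"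
proof -
  have first: "H ([Dotted a] \<frown> d) = [Dotted (\<rho> a)] \<frown> (\<lambda>_. Plain 0)"
    if "a < s" "d \<in> cantor n" "h (u \<frown> d) = v 0 \<frown> (\<lambda>_. Plain 0)" for a d
    using H_eq[OF that(1,2) le0 that(3)] unfolding code_first[OF n] .
  have last: "H ([Dotted a] \<frown> d) = [Dotted (\<rho> a)] \<frown> (\<lambda>_. Plain (n - 1))"
    if "a < s" "d \<in> cantor n" "h (u \<frown> d) = v (t * (n - 1)) \<frown> (\<lambda>_. Plain (n - 1))" for a d
    using H_eq[OF that(1,2) order_refl that(3)] unfolding code_last .
  have c: "(\<lambda>_. Plain 0) \<in> cantor n" "(\<lambda>_. Plain (n - 1)) \<in> cantor n" using n by auto
  from ends show ?thesis
  proof (elim disjE conjE)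
    assume "\<forall>a<s. \<rho> a = a" "h (u \<frown> (\<lambda>_. Plain 0)) = v 0 \<frown> (\<lambda>_. Plain 0)"
      "h (u \<frown> (\<lambda>_. Plain (n - 1))) = v (t * (n - 1)) \<frown> (\<lambda>_. Plain (n - 1))"
    then show ?thesis using first[OF _ c(1)] last[OF _ c(2)] by metis
  next
    assume "\<forall>a<s. \<rho> a = s - 1 - a" "h (u \<frown> (\<lambda>_. Plain 0)) = v (t * (n - 1)) \<frown> (\<lambda>_. Plain (n - 1))"
      "h (u \<frown> (\<lambda>_. Plain (n - 1))) = v 0 \<frown> (\<lambda>_. Plain 0)"
    then show ?thesis using first[OF _ c(2)] last[OF _ c(1)] by metis
  qed
qed

text \<open>A pair with the same dotted letter is sent by \<open>h\<close> to an adjacent pair, in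
  one order or the other, and \<open>adj_code\<close> transports both. Pairs at the junctions of
  copies are settled by \<open>H_ends\<close>.\<close>

lemma H_adj:
  assumes "adj n s x y"
  shows "circ_eq n s (H x) (H y)"
proof -
  consider (1) w i where "w \<in> words_plus n s" "i > 0" "i \<le> n - 1"
      "x = (w @ [Plain i]) \<frown> (\<lambda>_. Plain 0)" "y = (w @ [Plain (i - 1)]) \<frown> (\<lambda>_. Plain (n - 1))"
    | (2) a where "0 < a" "a \<le> s - 1" "x = [Dotted a] \<frown> (\<lambda>_. Plain 0)" "y = [Dotted (a - 1)] \<frown> (\<lambda>_. Plain (n - 1))"
    | (3) "x = [Dotted 0] \<frown> (\<lambda>_. Plain 0)" "y = [Dotted (s - 1)] \<frown> (\<lambda>_. Plain (n - 1))"
    using assms unfolding adj_def by blast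
  then show ?thesis
  proof cases
    case 1
    obtain a w' where w: "w = Dotted a # w'" "a < s" "w' \<in> lists (X n)" using 1(1) by (rule words_plus_cases)
    define d d' where "d = (w' @ [Plain i]) \<frown> (\<lambda>_. Plain 0)" and "d' = (w' @ [Plain (i - 1)]) \<frown> (\<lambda>_. Plain (n - 1))"
    have i: "i < n" "i - 1 < n" "n - 1 < n" using 1(3) n by auto
    have c: "d \<in> cantor n" "d' \<in> cantor n" using w(3) i n0 by (auto simp: d_def d'_def)
    have xy: "x = [Dotted a] \<frown> d" "y = [Dotted a] \<frown> d'" using 1(4,5) by (simp_all add: d_def d'_def w(1))
    have "u @ w' \<in> words_plus n r" using u w(3) by blast
    then have adj: "adj n r (u \<frown> d) (u \<frown> d')"
      unfolding adj_def d_def d'_def using 1(2,3)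
      by (intro disjI1 bexI[of _ "u @ w'"] exI[of _ i]) auto
    have C: "u \<frown> d \<in> cantor_nr n r" "u \<frown> d' \<in> cantor_nr n r" using c u by auto
    obtain j e where j: "j \<le> t * (n - 1)" "h (u \<frown> d) = v j \<frown> e" using h_split[OF c(1)] by blast
    obtain j' e' where j': "j' \<le> t * (n - 1)" "h (u \<frown> d') = v j' \<frown> e'" using h_split[OF c(2)] by blast
    have "u \<frown> d \<noteq> u \<frown> d'" using adj_unique(4)[OF adj n r] .
    then have "h (u \<frown> d) \<noteq> h (u \<frown> d')" using b(9) C by (meson inj_onD)
    moreover have "circ_eq n r (h (u \<frown> d)) (h (u \<frown> d'))" using circ[OF C] adj unfolding circ_eq_iff by blast
    ultimately have "adj n r (v j \<frown> e) (v j' \<frown> e') \<or> adj n r (v j' \<frown> e') (v j \<frown> e)"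
      unfolding circ_eq_iff j(2) j'(2) by blast
    moreover have "\<rho> a < s" using bij_betwE[OF rho] w(2) by auto
    ultimately show ?thesis
      unfolding xy H_eq[OF w(2) c(1) j] H_eq[OF w(2) c(2) j'] circ_eq_iff
      using adj_code[OF _ j(1) j'(1)] adj_code[OF _ j'(1) j(1)] by blast
  next
    case 2
    then have a: "a < s" "a - 1 < s" by auto
    from H_ends show ?thesis
    proof
      assume "\<forall>a<s. H ([Dotted a] \<frown> (\<lambda>_. Plain 0)) = [Dotted a] \<frown> (\<lambda>_. Plain 0) \<and>
        H ([Dotted a] \<frown> (\<lambda>_. Plain (n - 1))) = [Dotted a] \<frown> (\<lambda>_. Plain (n - 1))"
      then have "H x = x" "H y = y" using a unfolding 2(3,4) by blast+
      then show ?thesis using assms unfolding circ_eq_iff by simp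
    next
      assume *: "\<forall>a<s. H ([Dotted a] \<frown> (\<lambda>_. Plain 0)) = [Dotted (s - 1 - a)] \<frown> (\<lambda>_. Plain (n - 1)) \<and>
        H ([Dotted a] \<frown> (\<lambda>_. Plain (n - 1))) = [Dotted (s - 1 - a)] \<frown> (\<lambda>_. Plain 0)"
      \<comment> \<open>Reversing the copies sends the junction of \<open>a - 1\<close> and
        \<open>a\<close> to that of \<open>b - 1\<close> and \<open>b\<close>, with the two sides
        exchanged.\<close>
      define b where "b = s - 1 - (a - 1)"
      have b: "0 < b" "b \<le> s - 1" "s - 1 - a = b - 1" using 2(1,2) by (auto simp: b_def)
      have "H x = [Dotted (b - 1)] \<frown> (\<lambda>_. Plain (n - 1))" "H y = [Dotted b] \<frown> (\<lambda>_. Plain 0)"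
        using *[rule_format, OF a(1)] *[rule_format, OF a(2)] b(3) unfolding 2(3,4) b_def by metis+
      then have "adj n s (H y) (H x)" unfolding adj_def using b by blast
      then show ?thesis unfolding circ_eq_iff by blast
    qed
  next
    case 3
    have a: "0 < s" "s - 1 < s" using s by auto
    from H_ends show ?thesis
    proof
      assume "\<forall>a<s. H ([Dotted a] \<frown> (\<lambda>_. Plain 0)) = [Dotted a] \<frown> (\<lambda>_. Plain 0) \<and>
        H ([Dotted a] \<frown> (\<lambda>_. Plain (n - 1))) = [Dotted a] \<frown> (\<lambda>_. Plain (n - 1))"
      then have "H x = x" "H y = y" using a unfolding 3 by blast+
      then show ?thesis using assms unfolding circ_eq_iff by simp
    next
      assume *: "\<forall>a<s. H ([Dotted a] \<frown> (\<lambda>_. Plain 0)) = [Dotted (s - 1 - a)] \<frown> (\<lambda>_. Plain (n - 1)) \<and>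
        H ([Dotted a] \<frown> (\<lambda>_. Plain (n - 1))) = [Dotted (s - 1 - a)] \<frown> (\<lambda>_. Plain 0)"
      have "s - 1 - 0 = s - 1" "s - 1 - (s - 1) = 0" by simp_all
      then have "H x = y" "H y = x" using * a unfolding 3 by metis+
      then show ?thesis using assms unfolding circ_eq_iff by simp
    qed
  qed
qed

lemma H_circ_eq: "circ_eq n s x y \<Longrightarrow> circ_eq n s (H x) (H y)"
  using H_adj circ_eq_iff by metis

text \<open>Being an endpoint depends on the tail only, so it passes from \<open>H x\<close> to
  \<open>h (u \<frown> d)\<close>. The partner of that point is pulled back by \<open>g\<close>,
  which makes \<open>u \<frown> d\<close>, and with it \<open>x\<close>, an endpoint.\<close>

lemma endpoint_H:
  assumes "x \<in> cantor_nr n s" "endpoint n (H x)"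
  shows "endpoint n x"
proof -
  obtain a d j e where *: "a < s" "d \<in> cantor n" "j \<le> t * (n - 1)" "e \<in> cantor n" "h (u \<frown> d) = v j \<frown> e"
    "x = [Dotted a] \<frown> d" "H x = [Dotted (\<rho> a)] \<frown> code n t j \<frown> e" using assms(1) by (rule H_cases)
  have C: "u \<frown> d \<in> cantor_nr n r" using * u by auto
  have "endpoint n (h (u \<frown> d))" using assms(2) unfolding *(5,7) by (simp only: endpoint_conc)
  then obtain y where y: "y \<in> cantor_nr n r" "h (u \<frown> d) \<noteq> y" "circ_eq n r (h (u \<frown> d)) y"
    using endpoint_partner[OF b(1)[OF C] n r] by blast
  have "circ_eq n r (u \<frown> d) (g y)" using circ[OF C b(2)[OF y(1)]] y(3) b(4)[OF y(1)] by simp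
  moreover have "u \<frown> d \<noteq> g y" using y(2) b(4)[OF y(1)] by auto
  ultimately have "endpoint n (u \<frown> d)" using endpoint_partner[OF C n r] b(2)[OF y(1)] by blast
  then show ?thesis unfolding *(6) by (simp only: endpoint_conc)
qed

text \<open>For the converse implication of \<simeq>: if \<open>H x\<close> has a partner
  \<open>H y\<close>, then \<open>x\<close> is an endpoint and has some partner \<open>z\<close>.
  Then \<open>H z\<close> is a partner of \<open>H x\<close> as well, so \<open>H z = H y\<close>
  and \<open>z = y\<close>.\<close>

lemma H_in_TB: "H \<in> TB n s"
proof -
  have "circ_eq n s x y" if x: "x \<in> cantor_nr n s" and y: "y \<in> cantor_nr n s" and c: "circ_eq n s (H x) (H y)" for x y
  proof (cases "H x = H y")
    case True
    then have "x = y" using H_inj x y by (meson inj_onD)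
    then show ?thesis by (simp add: circ_eq_iff)
  next
    case False
    have Hx: "H x \<in> cantor_nr n s" "H y \<in> cantor_nr n s" using H_image x y by auto
    have "endpoint n (H x)" using endpoint_partner[OF Hx(1) n s] Hx(2) False c by blast
    then have "endpoint n x" using endpoint_H x by blast
    then obtain z where z: "z \<in> cantor_nr n s" "x \<noteq> z" "circ_eq n s x z"
      using endpoint_partner[OF x n s] by blast
    have "H x \<noteq> H z" using H_inj x z by (meson inj_onD)
    then have "H z = H y" using partner_unique[OF H_circ_eq[OF z(3)] _ c False n s] by blast
    then have "z = y" using H_inj y z by (meson inj_onD)
    then show ?thesis using z by simp
  qed
  then show ?thesis unfolding TB_def using H_in_B H_circ_eq by blast
qed

end


section \<open>Independence of the number of first letters\<close>

text \<open>For \<open>n = 3\<close> a unit modulo \<open>n - 1\<close> is \<open>1\<close>.\<close>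

lemma card_image_cyls_3:
  assumes "bisync 3 r k h g" "r > 0" "u \<in> words_plus 3 r" "level 3 r m (h ` cyl 3 u)" "m > 0"
  obtains t where "card (cyls 3 r m (h ` cyl 3 u)) = t * (3 - 1) + 1"
proof -
  obtain c d where c: "\<And>u. u \<in> words_plus 3 r \<Longrightarrow> has_sig 3 r (h ` cyl 3 u) c" "[c * d = 1] (mod (3 - 1))"
    using signature_unit[OF assms(1) _ assms(2)] by auto
  have "odd c" using c(2) by (auto simp: cong_def mod2_eq_if split: if_splits)
  moreover have "[card (cyls 3 r m (h ` cyl 3 u)) = c] (mod (3 - 1))"
    using has_sig_level[OF c(1)[OF assms(3)] assms(4,5)] by simp
  ultimately have "odd (card (cyls 3 r m (h ` cyl 3 u)))"
    by (auto simp: cong_def mod2_eq_if split: if_splits)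
  then obtain t where "card (cyls 3 r m (h ` cyl 3 u)) = 2 * t + 1" by (rule oddE)
  then show thesis using that[of t] by (simp add: mult.commute)
qed

text \<open>Without \<simeq> only the number of cones matters: any enumeration of them serves as
  \<open>v\<close>, and the copies stay in place.\<close>

lemma Onr_3_subset:
  assumes "r > 0" "s > 0"
  shows "Onr 3 r \<subseteq> Onr 3 s"
proof
  fix T assume "T \<in> Onr 3 r"
  then obtain h where h: "h \<in> B 3 r" "T = Core 3 r h" by (auto simp: Onr_def)
  define g where "g = inv_into (cantor_nr 3 r) h"
  obtain k where k: "bisync 3 r k h g" using B_bisync[OF h(1) _ assms(1)] unfolding g_def by auto
  let ?u = "[Dotted 0]"
  have u: "?u \<in> words_plus 3 r" using assms(1) by simp
  obtain m where m: "m > 0" "level 3 r m (h ` cyl 3 ?u)" using image_level[OF k u] by blast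
  obtain t where t: "card (cyls 3 r m (h ` cyl 3 ?u)) = t * (3 - 1) + 1"
    using card_image_cyls_3[OF k assms(1) u m(2,1)] .
  obtain v where v: "bij_betw v {0..<t * (3 - 1) + 1} (cyls 3 r m (h ` cyl 3 ?u))"
    using ex_bij_betw_nat_finite[OF finite_cyls, of 3 r m "h ` cyl 3 ?u"] unfolding t by blast
  have "{0..<t * (3 - 1) + 1} = {..t * (3 - 1)}" by auto
  then interpret transplant 3 r s k h g ?u m t v id
    using v m k u assms by unfold_locales (auto simp: bij_betw_def)
  show "T \<in> Onr 3 s" unfolding Onr_def using H_in_B Core_H[OF h(1)] h(2) by blast
qed

lemma TOnr_3_subset:
  assumes "r > 0" "s > 0"
  shows "TOnr 3 r \<subseteq> TOnr 3 s"
proof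
  fix T assume "T \<in> TOnr 3 r"
  then obtain h where hT: "h \<in> TB 3 r" "T = Core 3 r h" by (auto simp: TOnr_def)
  then have h: "h \<in> B 3 r" and circ: "\<forall>x\<in>cantor_nr 3 r. \<forall>y\<in>cantor_nr 3 r. circ_eq 3 r x y \<longleftrightarrow> circ_eq 3 r (h x) (h y)"
    by (auto simp: TB_def)
  define g where "g = inv_into (cantor_nr 3 r) h"
  obtain k where k: "bisync 3 r k h g" using B_bisync[OF h(1) _ assms(1)] unfolding g_def by auto
  note b = bisyncD[OF k]
  \<comment> \<open>A word of two letters: for \<open>r = 1\<close> the cone of one dotted letter
    would be the whole space, which has no boundary.\<close>
  define u where "u = wd 3 1 0"
  have u: "u \<in> words_plus 3 r" unfolding u_def using assms(1) by (intro wd_words_plus) auto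
  have hC: "h ` cantor_nr 3 r = cantor_nr 3 r" using b(1,2,4) by (force simp: image_iff)
  define U where "U = h ` cyl 3 u"
  obtain m0 where m0: "level 3 r m0 U" using image_level[OF k u] unfolding U_def by blast
  \<comment> \<open>One more than a level of \<open>U\<close>, so that \<open>1 \<le> m'\<close>
    while \<open>Suc m'\<close> is still a level.\<close>
  define m' where "m' = Suc m0"
  have lev: "level 3 r (Suc m') U" using level_mono[OF m0] by (simp add: m'_def)
  have "U \<noteq> {}" using cyl_nonempty[of 3 u] by (simp add: U_def)
  moreover have "U \<noteq> cantor_nr 3 r"
  proof
    assume "U = cantor_nr 3 r"
    then have "cyl 3 u = cantor_nr 3 r" using hC inj_on_image_eq_iff[OF b(9) cyl_subset[OF u] order_refl] by (simp add: U_def)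
    \<comment> \<open>A point of the neighbouring cone, which exists already for
      \<open>r = 1\<close>.\<close>
    moreover have "Lend 3 1 1 \<in> cantor_nr 3 r" using Lend_cantor_nr[of 3 1 r 1] assms(1) by simp
    ultimately show False using Lend_cyl[of 3 1 1 0] by (simp add: u_def)
  qed
  moreover have "bd 3 r U \<subseteq> {h (Lend 3 1 0), h (Rend 3 1 0)}"
    using bd_image[OF b(9) hC cyl_subset[OF u] circ] bd_cyl[of 0 r 3 1] assms(1) unfolding U_def u_def by auto
  ultimately obtain j0 N where N: "0 < N" "N < r * 3 ^ m'"
    "bij_betw (\<lambda>i. wd 3 m' ((j0 + i) mod (r * 3 ^ m'))) {..<N} (cyls 3 r (Suc m') U)"
    "{h (Lend 3 1 0), h (Rend 3 1 0)} = {Lend 3 m' ((j0 + 0) mod (r * 3 ^ m')), Rend 3 m' ((j0 + (N - 1)) mod (r * 3 ^ m'))}"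
    using clopen_interval[OF _ assms(1) lev] by (metis numeral_3_eq_3 numeral_2_eq_2 le_SucI order_refl)
  obtain t where t: "card (cyls 3 r (Suc m') U) = t * (3 - 1) + 1"
    using card_image_cyls_3[OF k assms(1) u, of "Suc m'"] lev unfolding U_def by blast
  have Nt: "N = t * (3 - 1) + 1" using bij_betw_same_card[OF N(3)] t by simp
  define v where "v i = wd 3 m' ((j0 + i) mod (r * 3 ^ m'))" for i
  have "{..<N} = {..t * (3 - 1)}" using Nt by auto
  then have v: "bij_betw v {..t * (3 - 1)} (cyls 3 r (Suc m') (h ` cyl 3 u))"
    using N(3) unfolding v_def U_def by simp
  have "{h (u \<frown> (\<lambda>_. Plain 0)), h (u \<frown> (\<lambda>_. Plain (3 - 1)))} = {v 0 \<frown> (\<lambda>_. Plain 0), v (t * (3 - 1)) \<frown> (\<lambda>_. Plain (3 - 1))}"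
    using N(4) Nt unfolding Lend_def Rend_def v_def u_def by simp
  then have ends: "h (u \<frown> (\<lambda>_. Plain 0)) = v 0 \<frown> (\<lambda>_. Plain 0) \<and>
        h (u \<frown> (\<lambda>_. Plain (3 - 1))) = v (t * (3 - 1)) \<frown> (\<lambda>_. Plain (3 - 1)) \<or>
      h (u \<frown> (\<lambda>_. Plain 0)) = v (t * (3 - 1)) \<frown> (\<lambda>_. Plain (3 - 1)) \<and>
        h (u \<frown> (\<lambda>_. Plain (3 - 1))) = v 0 \<frown> (\<lambda>_. Plain 0)"
    unfolding doubleton_eq_iff .
  \<comment> \<open>The case in which \<open>h\<close> keeps the order of the two ends; otherwise
    \<open>\<rho>\<close> lists the copies backwards.\<close>
  define up where "up \<longleftrightarrow> h (u \<frown> (\<lambda>_. Plain 0)) = v 0 \<frown> (\<lambda>_. Plain 0) \<and>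
        h (u \<frown> (\<lambda>_. Plain (3 - 1))) = v (t * (3 - 1)) \<frown> (\<lambda>_. Plain (3 - 1))"
  define \<rho> where "\<rho> a = (if up then a else s - 1 - a)" for a
  have rho: "bij_betw \<rho> {..<s} {..<s}"
    by (rule bij_betw_byWitness[where f' = \<rho>]) (auto simp: \<rho>_def)
  interpret circular_transplant 3 r s k h g u "Suc m'" t v \<rho> m' j0
  proof unfold_locales
    show "level 3 r (Suc m') (h ` cyl 3 u)" using lev by (simp add: U_def)
    show "t * (3 - 1) + 1 < r * 3 ^ m'" using N(2) Nt by simp
    show "1 \<le> m'" by (simp add: m'_def)
    show "(\<forall>a<s. \<rho> a = a) \<and> h (u \<frown> (\<lambda>_. Plain 0)) = v 0 \<frown> (\<lambda>_. Plain 0) \<and>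
        h (u \<frown> (\<lambda>_. Plain (3 - 1))) = v (t * (3 - 1)) \<frown> (\<lambda>_. Plain (3 - 1)) \<or>
      (\<forall>a<s. \<rho> a = s - 1 - a) \<and> h (u \<frown> (\<lambda>_. Plain 0)) = v (t * (3 - 1)) \<frown> (\<lambda>_. Plain (3 - 1)) \<and>
        h (u \<frown> (\<lambda>_. Plain (3 - 1))) = v 0 \<frown> (\<lambda>_. Plain 0)"
    proof (cases up)
      case True
      then have "\<forall>a<s. \<rho> a = a" by (simp add: \<rho>_def)
      then show ?thesis using True unfolding up_def by blast
    next
      case False
      then have "\<forall>a<s. \<rho> a = s - 1 - a" by (simp add: \<rho>_def)
      then show ?thesis using ends False unfolding up_def by blast
    qed
  qed (use assms k u v rho circ in \<open>auto simp: v_def\<close>)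
  show "T \<in> TOnr 3 s" unfolding TOnr_def using H_in_TB Core_H[OF h] hT(2) by blast
qed

theorem theorem1p5:
  shows "\<exists>n r s :: nat. n > 2 \<and> 1 \<le> r \<and> r \<le> n - 1 \<and> 1 \<le> s \<and> s \<le> n - 1 \<and>
           TOnr n r = TOnr n s \<and> Onr n r = Onr n s \<and>
           gcd (n - 1) r \<noteq> gcd (n - 1) s"
proof (intro exI conjI)
  show "TOnr 3 1 = TOnr 3 2" using TOnr_3_subset[of 1 2] TOnr_3_subset[of 2 1] by simp
  show "Onr 3 1 = Onr 3 2" using Onr_3_subset[of 1 2] Onr_3_subset[of 2 1] by simp
qed simp_all

end
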